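(* Let $(X,\omega_X)$ be a fixed compact Kähler manifold without boundary, of complex dimension $n$, with $\int_X\omega_X^n=1$. Let $p>n$, $K>0$, and let $\gamma\in C^0(X)$ be nonnegative with $\dim_{\mathcal H}\{\gamma=0\}<2n-1$. Let $q=q(n,p)>1$ be the Sobolev exponent (see context). There exists $c=c(n,p,K,\gamma)>0$ such that for every $\omega\in\mathcal W(n,p,\infty,K,\gamma)$, if $0=\lambda_0<\lambda_1\le\lambda_2\le\cdots$ denotes the increasing sequence of eigenvalues of $-\Delta_\omega$, counted with multiplicity, then for any $k\in\mathbb N$, $$\lambda_k\ge c\,I_\omega^{-1}\,k^{\frac{q-1}q}.$$
   Context: For a Kähler metric $\omega$ on $X$ put $V_\omega=\int_X\omega^n$, $I_\omega=[\omega]\cdot[\omega_X]^{n-1}$, $e^{F_\omega}=\frac{1}{V_\omega}\frac{\omega^n}{\omega_X^n}$, $\mathcal N_p(\omega)=\int_X|F_\omega|^pe^{F_\omega}\omega_X^n$. Define $$\mathcal W(n,p,\infty,K,\gamma)=\{\omega\text{ Kähler metric on }X:\ \mathcal N_p(\omega)\le K,\ e^{F_\omega}\ge\gamma\}.$$ Sobolev exponent: $q=q(n,p)>1$ denotes a fixed exponent (which exists) depending only on $n,p$ such that for all $K>0$ and all nonnegative $\gamma\in C^0(X)$ with $\dim_{\mathcal H}\{\gamma=0\}<2n-1$ there is $C_S=C_S(n,p,K,\gamma,q)>0$ with $$\Big(\frac1{V_\omega}\int_X|u-\overline u|^{2q}\omega^n\Big)^{1/q}\le C_S\frac{I_\omega}{V_\omega}\int_X|\nabla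 u|^2_\omega\,\omega^n,\qquad \overline u=\frac1{V_\omega}\int_Xu\,\omega^n,$$ for all $\omega\in\mathcal W(n,p,\infty,K,\gamma)$ and $u\in W^{1,2}(X)$. The Laplacian is normalized by $\int_X u\,\Delta_\omega u\,\omega^n=-\int_X|\nabla u|^2_\omega\,\omega^n$. The manifold $(X,\omega_X)$ is fixed and constants may depend on it. *)

theory Defs
  imports "HOL-Analysis.Analysis" "HOL-Library.Function_Algebras"
begin

section \<open>Smooth functions on open subsets of a Euclidean space\<close>

fun Ck_on :: "nat \<Rightarrow> 'e::euclidean_space set \<Rightarrow> ('e \<Rightarrow> 'f::real_normed_vector) \<Rightarrow> bool" where
  "Ck_on 0 S f \<longleftrightarrow> continuous_on S f"
| "Ck_on (Suc k) S f \<longleftrightarrow> (\<forall>z\<in>S. f differentiable (at z)) \<and>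
     (\<forall>b\<in>Basis. Ck_on k S (\<lambda>z. frechet_derivative f (at z) b))"

definition smooth_on :: "'e::euclidean_space set \<Rightarrow> ('e \<Rightarrow> 'f::real_normed_vector) \<Rightarrow> bool" where
  "smooth_on S f \<longleftrightarrow> (\<forall>k. Ck_on k S f)"

text \<open>The Wirtinger derivatives \<open>\<partial>/\<partial>z\<^sub>j\<close> and \<open>\<partial>/\<partial>\<zeta>\<^sub>j\<close> with \<open>\<zeta>\<^sub>j\<close> the conjugate of \<open>z\<^sub>j\<close>.\<close>

definition dz :: "'n::finite \<Rightarrow> (complex^'n \<Rightarrow> complex) \<Rightarrow> complex^'n \<Rightarrow> complex" where
  "dz j f z = (frechet_derivative f (at z) (axis j 1) - \<i> * frechet_derivative f (at z) (axis j \<i>)) / 2"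

definition dzbar :: "'n::finite \<Rightarrow> (complex^'n \<Rightarrow> complex) \<Rightarrow> complex^'n \<Rightarrow> complex" where
  "dzbar j f z = (frechet_derivative f (at z) (axis j 1) + \<i> * frechet_derivative f (at z) (axis j \<i>)) / 2"

definition holomorphic_map_on :: "(complex^'n::finite) set \<Rightarrow> (complex^'n \<Rightarrow> complex^'n) \<Rightarrow> bool" where
  "holomorphic_map_on S f \<longleftrightarrow>
     (\<forall>z\<in>S. \<exists>J :: complex^'n^'n. (f has_derivative (\<lambda>v. J *v v)) (at z))"


section \<open>Complex manifolds\<close>

text \<open>
  The manifold is a whole type \<open>'a\<close> carrying its topology; the complex dimension is \<open>CARD('n)\<close>.
  A chart is a pair of its domain and its coordinate map; the values of the coordinate map outside
  the domain are irrelevant.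
\<close>

type_synonym ('a, 'n) chart = "'a set \<times> ('a \<Rightarrow> complex^'n)"

abbreviation dom_ch :: "('a, 'n::finite) chart \<Rightarrow> 'a set" where
  "dom_ch c \<equiv> fst c"

abbreviation crd :: "('a, 'n::finite) chart \<Rightarrow> 'a \<Rightarrow> complex^'n" where
  "crd c \<equiv> snd c"

definition img_ch :: "('a, 'n::finite) chart \<Rightarrow> (complex^'n) set" where
  "img_ch c = crd c ` dom_ch c"

definition pt :: "('a, 'n::finite) chart \<Rightarrow> complex^'n \<Rightarrow> 'a" where
  "pt c = inv_into (dom_ch c) (crd c)"

definition trans_map :: "('a, 'n::finite) chart \<Rightarrow> ('a, 'n) chart \<Rightarrow> complex^'n \<Rightarrow> complex^'n" where
  "trans_map c d = crd d \<circ> pt c"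

definition complex_atlas :: "('a::topological_space, 'n::finite) chart set \<Rightarrow> bool" where
  "complex_atlas \<A> \<longleftrightarrow>
     (\<Union>c\<in>\<A>. dom_ch c) = UNIV \<and>
     (\<forall>c\<in>\<A>. open (dom_ch c) \<and> open (img_ch c) \<and>
        homeomorphism (dom_ch c) (img_ch c) (crd c) (pt c)) \<and>
     (\<forall>c\<in>\<A>. \<forall>d\<in>\<A>. holomorphic_map_on (crd c ` (dom_ch c \<inter> dom_ch d)) (trans_map c d))"

definition tangent_map ::
    "('a, 'n::finite) chart \<Rightarrow> ('a, 'n) chart \<Rightarrow> 'a \<Rightarrow> complex^'n \<Rightarrow> complex^'n" where
  "tangent_map c d x = frechet_derivative (trans_map c d) (at (crd c x))"

text \<open>All pointwise quantities computed below with \<open>chart_at\<close> are independent of the chart.\<close>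

definition chart_at :: "('a, 'n::finite) chart set \<Rightarrow> 'a \<Rightarrow> ('a, 'n) chart" where
  "chart_at \<A> x = (SOME c. c \<in> \<A> \<and> x \<in> dom_ch c)"

definition smooth_fun :: "('a, 'n::finite) chart set \<Rightarrow> ('a \<Rightarrow> real) \<Rightarrow> bool" where
  "smooth_fun \<A> u \<longleftrightarrow> (\<forall>c\<in>\<A>. smooth_on (img_ch c) (u \<circ> pt c))"


section \<open>Kaehler metrics\<close>

text \<open>
  A real (1,1)-form \<open>\<omega> = i \<Sum>\<^sub>j\<^sub>k g\<^sub>j\<^sub>k dz\<^sub>j \<and> d\<zeta>\<^sub>k\<close> (\<open>\<zeta>\<^sub>k\<close> the conjugate of \<open>z\<^sub>k\<close>) is given by its
  coefficient matrices: \<open>\<omega> c x\<close> is \<open>(g\<^sub>j\<^sub>k)\<close> at the point \<open>x\<close> in the chart \<open>c\<close>.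
\<close>

type_synonym ('a, 'n) form11 = "('a, 'n) chart \<Rightarrow> 'a \<Rightarrow> complex^'n^'n"

definition hform :: "complex^'n^'n::finite \<Rightarrow> complex^'n \<Rightarrow> complex^'n \<Rightarrow> complex" where
  "hform G v w = (\<Sum>j\<in>UNIV. \<Sum>k\<in>UNIV. G $ j $ k * v $ j * cnj (w $ k))"

definition kahler_metric :: "('a, 'n::finite) chart set \<Rightarrow> ('a, 'n) form11 \<Rightarrow> bool" where
  "kahler_metric \<A> \<omega> \<longleftrightarrow>
     \<comment> \<open>well-defined as a tensor\<close>
     (\<forall>c\<in>\<A>. \<forall>d\<in>\<A>. \<forall>x\<in>dom_ch c \<inter> dom_ch d. \<forall>v w.
        hform (\<omega> c x) v w = hform (\<omega> d x) (tangent_map c d x v) (tangent_map c d x w)) \<and>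
     \<comment> \<open>smooth\<close>
     (\<forall>c\<in>\<A>. \<forall>j k. smooth_on (img_ch c) (\<lambda>z. \<omega> c (pt c z) $ j $ k)) \<and>
     \<comment> \<open>Hermitian and positive definite\<close>
     (\<forall>c\<in>\<A>. \<forall>x\<in>dom_ch c. (\<forall>j k. \<omega> c x $ k $ j = cnj (\<omega> c x $ j $ k)) \<and>
        (\<forall>v. v \<noteq> 0 \<longrightarrow> Re (hform (\<omega> c x) v v) > 0)) \<and>
     \<comment> \<open>closed: the (2,1) and the (1,2) part of the exterior derivative vanish\<close>
     (\<forall>c\<in>\<A>. \<forall>z\<in>img_ch c. \<forall>j k l.
        dz l (\<lambda>z. \<omega> c (pt c z) $ j $ k) z = dz j (\<lambda>z. \<omega> c (pt c z) $ l $ k) z \<and>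
        dzbar l (\<lambda>z. \<omega> c (pt c z) $ j $ k) z = dzbar k (\<lambda>z. \<omega> c (pt c z) $ j $ l) z)"

definition compact_kahler_manifold ::
    "('a::t2_space, 'n::finite) chart set \<Rightarrow> ('a, 'n) form11 \<Rightarrow> bool" where
  "compact_kahler_manifold \<A> \<omega>\<^sub>X \<longleftrightarrow>
     compact (UNIV :: 'a set) \<and> connected (UNIV :: 'a set) \<and>
     complex_atlas \<A> \<and> kahler_metric \<A> \<omega>\<^sub>X"


section \<open>Top-degree forms and integration\<close>

text \<open>
  For (1,1)-forms \<open>\<Omega> i\<close> with coefficient matrices \<open>G i\<close>, indexed by the \<open>n\<close>-element type \<open>'n\<close>,
  expanding the wedge product of all \<open>\<Omega> i\<close> gives \<open>wedge_coeff G\<close> times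
  \<open>(i dz\<^sub>1 \<and> d\<zeta>\<^sub>1) \<and> \<dots> \<and> (i dz\<^sub>n \<and> d\<zeta>\<^sub>n)\<close>, and \<open>i dz \<and> d\<zeta> = 2 dx \<and> dy\<close>.  Hence \<open>wedge_density G\<close> is
  the density of the wedge product with respect to Lebesgue measure.
\<close>

definition wedge_coeff :: "('n::finite \<Rightarrow> complex^'n^'n) \<Rightarrow> complex" where
  "wedge_coeff G = (\<Sum>\<sigma> | \<sigma> permutes (UNIV :: 'n set). \<Sum>\<tau> | \<tau> permutes (UNIV :: 'n set).
     of_int (sign \<sigma> * sign \<tau>) * (\<Prod>i\<in>UNIV. G i $ \<sigma> i $ \<tau> i))"

definition wedge_density :: "('n::finite \<Rightarrow> complex^'n^'n) \<Rightarrow> real" where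
  "wedge_density G = 2 ^ CARD('n) * Re (wedge_coeff G)"

text \<open>
  Integration over the manifold against the wedge product of \<open>n\<close> positive (1,1)-forms: the unique
  Borel measure which in every chart has this density.
\<close>

definition wedge_measure ::
    "('a::topological_space, 'n::finite) chart set \<Rightarrow> ('n \<Rightarrow> ('a, 'n) form11) \<Rightarrow> 'a measure" where
  "wedge_measure \<A> \<Omega> = (THE \<mu>. sets \<mu> = sets borel \<and>
     (\<forall>c\<in>\<A>. \<forall>A\<in>sets borel. A \<subseteq> dom_ch c \<longrightarrow>
        emeasure \<mu> A = (\<integral>\<^sup>+ z\<in>crd c ` A. ennreal (wedge_density (\<lambda>i. \<Omega> i c (pt c z))) \<partial>lborel)))"

definition top_power ::
    "('a::topological_space, 'n::finite) chart set \<Rightarrow> ('a, 'n) form11 \<Rightarrow> 'a measure" where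
  "top_power \<A> \<omega> = wedge_measure \<A> (\<lambda>_. \<omega>)"

definition total_vol :: "('a::topological_space, 'n::finite) chart set \<Rightarrow> ('a, 'n) form11 \<Rightarrow> real" where
  "total_vol \<A> \<omega> = measure (top_power \<A> \<omega>) UNIV"

text \<open>
  \<open>[\<omega>]\<cdot>[\<omega>\<^sub>X]\<^sup>n\<^sup>-\<^sup>1\<close>: one factor \<open>\<omega>\<close> and \<open>n - 1\<close> factors \<open>\<omega>\<^sub>X\<close>.  As (1,1)-forms commute, the index
  receiving \<open>\<omega>\<close> is immaterial.
\<close>

definition I_class ::
    "('a::topological_space, 'n::finite) chart set \<Rightarrow> ('a, 'n) form11 \<Rightarrow> ('a, 'n) form11 \<Rightarrow> real" where
  "I_class \<A> \<omega>\<^sub>X \<omega> =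
     measure (wedge_measure \<A> (\<lambda>i. if i = (SOME i. True) then \<omega> else \<omega>\<^sub>X)) UNIV"

definition exp_F ::
    "('a::topological_space, 'n::finite) chart set \<Rightarrow> ('a, 'n) form11 \<Rightarrow> ('a, 'n) form11 \<Rightarrow> 'a \<Rightarrow> real" where
  "exp_F \<A> \<omega>\<^sub>X \<omega> x = (let c = chart_at \<A> x in
     (1 / total_vol \<A> \<omega>) * (wedge_density (\<lambda>_. \<omega> c x) / wedge_density (\<lambda>_. \<omega>\<^sub>X c x)))"

definition F_fun ::
    "('a::topological_space, 'n::finite) chart set \<Rightarrow> ('a, 'n) form11 \<Rightarrow> ('a, 'n) form11 \<Rightarrow> 'a \<Rightarrow> real" where
  "F_fun \<A> \<omega>\<^sub>X \<omega> x = ln (exp_F \<A> \<omega>\<^sub>X \<omega> x)"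

definition N_entropy ::
    "('a::topological_space, 'n::finite) chart set \<Rightarrow> ('a, 'n) form11 \<Rightarrow> real \<Rightarrow> ('a, 'n) form11 \<Rightarrow> real" where
  "N_entropy \<A> \<omega>\<^sub>X p \<omega> =
     (\<integral>x. \<bar>F_fun \<A> \<omega>\<^sub>X \<omega> x\<bar> powr p * exp (F_fun \<A> \<omega>\<^sub>X \<omega> x) \<partial>top_power \<A> \<omega>\<^sub>X)"

definition W_class ::
    "('a::topological_space, 'n::finite) chart set \<Rightarrow> ('a, 'n) form11 \<Rightarrow> real \<Rightarrow> real \<Rightarrow> ('a \<Rightarrow> real)
      \<Rightarrow> ('a, 'n) form11 set" where
  "W_class \<A> \<omega>\<^sub>X p K \<gamma> =
     {\<omega>. kahler_metric \<A> \<omega> \<and> N_entropy \<A> \<omega>\<^sub>X p \<omega> \<le> K \<and> (\<forall>x. exp_F \<A> \<omega>\<^sub>X \<omega> x \<ge> \<gamma> x)}"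


section \<open>Riemannian distance and Hausdorff dimension\<close>

text \<open>The Riemannian metric of \<open>\<omega>\<close> is \<open>\<omega>(\<cdot>, J\<cdot>)\<close>, so that \<open>|v|\<^sup>2 = 2 \<Sum>\<^sub>j\<^sub>k g\<^sub>j\<^sub>k v\<^sub>j cnj v\<^sub>k\<close>.\<close>

definition piecewise_C1_curve ::
    "('a::topological_space, 'n::finite) chart set \<Rightarrow> (real \<Rightarrow> 'a) \<Rightarrow> bool" where
  "piecewise_C1_curve \<A> \<alpha> \<longleftrightarrow> continuous_on {0..1} \<alpha> \<and>
     (\<forall>c\<in>\<A>. \<forall>a b. 0 \<le> a \<and> a \<le> b \<and> b \<le> 1 \<and> \<alpha> ` {a..b} \<subseteq> dom_ch c \<longrightarrow>
        (crd c \<circ> \<alpha>) piecewise_C1_differentiable_on {a..b})"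

text \<open>
  The speed of such a curve is only required to be continuous off a finite set and may be unbounded,
  so the length may be infinite; it is therefore an extended nonnegative real.
\<close>

definition curve_length ::
    "('a, 'n::finite) chart set \<Rightarrow> ('a, 'n) form11 \<Rightarrow> (real \<Rightarrow> 'a) \<Rightarrow> ennreal" where
  "curve_length \<A> \<omega> \<alpha> = (\<integral>\<^sup>+ t\<in>{0..1}. ennreal (
     let c = chart_at \<A> (\<alpha> t); v = vector_derivative (crd c \<circ> \<alpha>) (at t)
     in sqrt (2 * Re (hform (\<omega> c (\<alpha> t)) v v))) \<partial>lborel)"

definition riem_dist ::
    "('a::topological_space, 'n::finite) chart set \<Rightarrow> ('a, 'n) form11 \<Rightarrow> 'a \<Rightarrow> 'a \<Rightarrow> real" where
  "riem_dist \<A> \<omega> x y = enn2real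
     (Inf {curve_length \<A> \<omega> \<alpha> | \<alpha>. piecewise_C1_curve \<A> \<alpha> \<and> \<alpha> 0 = x \<and> \<alpha> 1 = y})"

definition diam_wrt :: "('a \<Rightarrow> 'a \<Rightarrow> real) \<Rightarrow> 'a set \<Rightarrow> ereal" where
  "diam_wrt d E = Sup (insert 0 {ereal (d x y) | x y. x \<in> E \<and> y \<in> E})"

definition hausdorff_pre :: "('a \<Rightarrow> 'a \<Rightarrow> real) \<Rightarrow> real \<Rightarrow> real \<Rightarrow> 'a set \<Rightarrow> ennreal" where
  "hausdorff_pre d s \<delta> A = Inf {(\<Sum>i. ennreal (real_of_ereal (diam_wrt d (E i)) powr s)) | E :: nat \<Rightarrow> 'a set.
     A \<subseteq> (\<Union>i. E i) \<and> (\<forall>i. diam_wrt d (E i) \<le> ereal \<delta>)}"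

definition hausdorff_measure :: "('a \<Rightarrow> 'a \<Rightarrow> real) \<Rightarrow> real \<Rightarrow> 'a set \<Rightarrow> ennreal" where
  "hausdorff_measure d s A = (SUP \<delta>\<in>{0<..}. hausdorff_pre d s \<delta> A)"

text \<open>Restricting to \<open>s > 0\<close> does not affect the infimum; the empty set has dimension 0.\<close>

definition hausdorff_dim :: "('a \<Rightarrow> 'a \<Rightarrow> real) \<Rightarrow> 'a set \<Rightarrow> ereal" where
  "hausdorff_dim d A = Inf {ereal s | s. s > 0 \<and> hausdorff_measure d s A = 0}"

definition admissible_weight ::
    "('a::topological_space, 'n::finite) chart set \<Rightarrow> ('a, 'n) form11 \<Rightarrow> ('a \<Rightarrow> real) \<Rightarrow> bool" where
  "admissible_weight \<A> \<omega>\<^sub>X \<gamma> \<longleftrightarrow>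
     continuous_on UNIV \<gamma> \<and> (\<forall>x. \<gamma> x \<ge> 0) \<and>
     hausdorff_dim (riem_dist \<A> \<omega>\<^sub>X) {x. \<gamma> x = 0} < ereal (2 * real CARD('n) - 1)"


section \<open>Sobolev functions\<close>

text \<open>
  The differential of a real function \<open>u\<close> is determined by its (1,0)-part
  \<open>\<partial>u = \<Sum>\<^sub>j u\<^sub>j dz\<^sub>j\<close>.  \<open>weak_del \<A> u D\<close> says that \<open>D\<close>, with \<open>D c x $ j\<close> the coefficient of \<open>dz\<^sub>j\<close> at
  \<open>x\<close> in the chart \<open>c\<close>, is the weak \<open>\<partial>u\<close>.  It is unique up to null sets; the transformation rule is
  required at every point so that \<open>D\<close> is a section of the cotangent bundle.
\<close>

type_synonym ('a, 'n) form10 = "('a, 'n) chart \<Rightarrow> 'a \<Rightarrow> complex^'n"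

definition test_function :: "(complex^'n::finite) set \<Rightarrow> (complex^'n \<Rightarrow> complex) \<Rightarrow> bool" where
  "test_function S \<eta> \<longleftrightarrow> smooth_on UNIV \<eta> \<and> (\<exists>C. compact C \<and> C \<subseteq> S \<and> (\<forall>z. z \<notin> C \<longrightarrow> \<eta> z = 0))"

definition loc_integrable_on :: "(complex^'n::finite) set \<Rightarrow> (complex^'n \<Rightarrow> complex) \<Rightarrow> bool" where
  "loc_integrable_on S f \<longleftrightarrow> (\<forall>C. compact C \<and> C \<subseteq> S \<longrightarrow> set_integrable lborel C f)"

definition weak_del ::
    "('a, 'n::finite) chart set \<Rightarrow> ('a \<Rightarrow> real) \<Rightarrow> ('a, 'n) form10 \<Rightarrow> bool" where
  "weak_del \<A> u D \<longleftrightarrow>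
     (\<forall>c\<in>\<A>. \<forall>d\<in>\<A>. \<forall>x\<in>dom_ch c \<inter> dom_ch d. \<forall>v.
        (\<Sum>j\<in>UNIV. D c x $ j * v $ j) = (\<Sum>j\<in>UNIV. D d x $ j * tangent_map c d x v $ j)) \<and>
     (\<forall>c\<in>\<A>. loc_integrable_on (img_ch c) (\<lambda>z. complex_of_real (u (pt c z))) \<and>
        (\<forall>j. loc_integrable_on (img_ch c) (\<lambda>z. D c (pt c z) $ j) \<and>
          (\<forall>\<eta>. test_function (img_ch c) \<eta> \<longrightarrow>
             (LINT z:img_ch c|lborel. complex_of_real (u (pt c z)) * dz j \<eta> z)
              = - (LINT z:img_ch c|lborel. D c (pt c z) $ j * \<eta> z))))"

text \<open>
  \<open>|\<nabla>u|\<^sup>2 = \<Sum>\<^sub>j\<^sub>k g\<^sup>j\<^sup>k u\<^sub>j cnj u\<^sub>k\<close>, where \<open>\<Sum>\<^sub>k g\<^sup>j\<^sup>k g\<^sub>l\<^sub>k = \<delta>\<^sub>j\<^sub>l\<close>, i.e. \<open>g\<^sup>j\<^sup>k\<close> is the \<open>(k,j)\<close> entry of the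
  inverse matrix of \<open>(g\<^sub>j\<^sub>k)\<close>.
\<close>

definition grad_sq ::
    "('a, 'n::finite) chart set \<Rightarrow> ('a, 'n) form11 \<Rightarrow> ('a, 'n) form10 \<Rightarrow> 'a \<Rightarrow> real" where
  "grad_sq \<A> \<omega> D x = (let c = chart_at \<A> x in
     Re (\<Sum>j\<in>UNIV. \<Sum>k\<in>UNIV. matrix_inv (\<omega> c x) $ k $ j * D c x $ j * cnj (D c x $ k)))"

text \<open>\<open>W12 \<A> \<omega>\<^sub>X u D\<close>: \<open>u\<close> is in the Sobolev space \<open>W\<^sup>1\<^sup>,\<^sup>2\<close> and has weak derivative \<open>D\<close>.\<close>

definition W12 ::
    "('a::topological_space, 'n::finite) chart set \<Rightarrow> ('a, 'n) form11 \<Rightarrow> ('a \<Rightarrow> real) \<Rightarrow> ('a, 'n) form10 \<Rightarrow> bool" where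
  "W12 \<A> \<omega>\<^sub>X u D \<longleftrightarrow> u \<in> borel_measurable borel \<and> weak_del \<A> u D \<and>
     integrable (top_power \<A> \<omega>\<^sub>X) (\<lambda>x. (u x)\<^sup>2) \<and>
     integrable (top_power \<A> \<omega>\<^sub>X) (grad_sq \<A> \<omega>\<^sub>X D)"

definition mean ::
    "('a::topological_space, 'n::finite) chart set \<Rightarrow> ('a, 'n) form11 \<Rightarrow> ('a \<Rightarrow> real) \<Rightarrow> real" where
  "mean \<A> \<omega> u = (1 / total_vol \<A> \<omega>) * (\<integral>x. u x \<partial>top_power \<A> \<omega>)"

definition sobolev_exponent ::
    "('a::topological_space, 'n::finite) chart set \<Rightarrow> ('a, 'n) form11 \<Rightarrow> real \<Rightarrow> real \<Rightarrow> bool" where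
  "sobolev_exponent \<A> \<omega>\<^sub>X p q \<longleftrightarrow> q > 1 \<and>
     (\<forall>K \<gamma>. K > 0 \<and> admissible_weight \<A> \<omega>\<^sub>X \<gamma> \<longrightarrow>
       (\<exists>C\<^sub>S>0. \<forall>\<omega>\<in>W_class \<A> \<omega>\<^sub>X p K \<gamma>. \<forall>u D. W12 \<A> \<omega>\<^sub>X u D \<longrightarrow>
          integrable (top_power \<A> \<omega>) (\<lambda>x. \<bar>u x - mean \<A> \<omega> u\<bar> powr (2 * q)) \<and>
          ((1 / total_vol \<A> \<omega>) * (\<integral>x. \<bar>u x - mean \<A> \<omega> u\<bar> powr (2 * q) \<partial>top_power \<A> \<omega>)) powr (1 / q)
            \<le> C\<^sub>S * (I_class \<A> \<omega>\<^sub>X \<omega> / total_vol \<A> \<omega>) * (\<integral>x. grad_sq \<A> \<omega> D x \<partial>top_power \<A> \<omega>)))"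


section \<open>The spectrum of the Laplacian\<close>

text \<open>
  \<open>\<Delta>u = \<Sum>\<^sub>j\<^sub>k g\<^sup>j\<^sup>k \<partial>\<^sub>j \<partial>\<^sub>k u\<close> (\<open>\<partial>\<^sub>k\<close> the conjugate derivative): with \<open>grad_sq\<close> above, this is the
  Laplacian with \<open>\<integral> u \<Delta>u \<omega>\<^sup>n = - \<integral> |\<nabla>u|\<^sup>2 \<omega>\<^sup>n\<close>.  The sum is real for real \<open>u\<close>.
\<close>

definition laplacian ::
    "('a, 'n::finite) chart set \<Rightarrow> ('a, 'n) form11 \<Rightarrow> ('a \<Rightarrow> real) \<Rightarrow> 'a \<Rightarrow> real" where
  "laplacian \<A> \<omega> u x = (let c = chart_at \<A> x in
     Re (\<Sum>j\<in>UNIV. \<Sum>k\<in>UNIV. matrix_inv (\<omega> c x) $ k $ j *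
       dz j (dzbar k (\<lambda>z. complex_of_real (u (pt c z)))) (crd c x)))"

definition eigenspace ::
    "('a, 'n::finite) chart set \<Rightarrow> ('a, 'n) form11 \<Rightarrow> real \<Rightarrow> ('a \<Rightarrow> real) set" where
  "eigenspace \<A> \<omega> \<mu> = {u. smooth_fun \<A> u \<and> (\<forall>x. - laplacian \<A> \<omega> u x = \<mu> * u x)}"

interpretation fun_vs: vector_space "\<lambda>(r::real) (u::'a \<Rightarrow> real). (\<lambda>x. r * u x)"
  by unfold_locales (auto simp: fun_eq_iff algebra_simps)

text \<open>
  \<open>lam\<close> is the nondecreasing enumeration, starting with index 0, of the eigenvalues of \<open>-\<Delta>\<close> with
  multiplicity: each real \<open>\<mu>\<close> occurs exactly as often as the (finite) dimension of its eigenspace.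
\<close>

definition eigenvalue_sequence ::
    "('a, 'n::finite) chart set \<Rightarrow> ('a, 'n) form11 \<Rightarrow> (nat \<Rightarrow> real) \<Rightarrow> bool" where
  "eigenvalue_sequence \<A> \<omega> lam \<longleftrightarrow> incseq lam \<and>
     (\<forall>\<mu>. finite {k. lam k = \<mu>} \<and>
        (\<exists>B. finite B \<and> fun_vs.independent B \<and> fun_vs.span B = eigenspace \<A> \<omega> \<mu> \<and>
             card B = card {k. lam k = \<mu>}))"

end

theory Submission
  imports Defs "HOL-Complex_Analysis.Conformal_Mappings"
begin

text \<open>
  Let \<open>A = - \<Delta>\<close>, \<open>\<lambda> = \<lambda>\<^sub>k\<close>, let \<open>S = C\<^sub>S I\<^sub>\<omega>\<close> be the constant of the Sobolev inequality, written for averages with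
  respect to the normalized volume, and let \<open>E\<close> be the span of the eigenfunctions with eigenvalues
  at most \<open>\<lambda>\<close>, where \<open>k > 0\<close>.  The heart of the proof is the estimate
  \<open>sup g\<^sup>2 \<le> C (S \<lambda>) powr (q/(q-1)) * avg g\<^sup>2\<close> for all \<open>g \<in> E\<close>, with \<open>C\<close> depending on \<open>q\<close> only.  It gives the
  theorem by a trace argument: for an orthonormal basis \<open>e\<^sub>i\<close> of \<open>E\<close> the estimate for
  \<open>g = (\<Sum>i. e\<^sub>i(x) e\<^sub>i)\<close> at the point \<open>x\<close> says \<open>(\<Sum>i. e\<^sub>i(x)\<^sup>2) \<le> C (S \<lambda>) powr (q/(q-1))\<close>, and the average of the left
  side over \<open>x\<close> is \<open>dim E > k\<close> (\<open>card_eigen_le\<close>).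

  The sup estimate is a Moser iteration along resolvents.  On the finite-dimensional space \<open>E\<close> every
  function of \<open>A\<close> acts on coefficients, so \<open>g\<close> may be written as \<open>v\<^sub>J\<close> with \<open>v\<^sub>j = (1 + s\<^sub>j A) v\<^sub>j\<^sub>+\<^sub>1\<close> and
  \<open>s\<^sub>j = 1/(2^j \<lambda>)\<close>; as \<open>(\<Sum>j. s\<^sub>j) \<lambda> \<le> 2\<close>, the function \<open>v\<^sub>0\<close> is at most \<open>exp 2\<close> times larger than \<open>g\<close> in
  quadratic mean.  Testing the equation for \<open>v\<^sub>j\<^sub>+\<^sub>1\<close> with \<open>sgn v \<bar>v\<bar> powr (2a-1)\<close>, \<open>a = q^j\<close>, bounds the
  gradient of \<open>sgn v \<bar>v\<bar> powr a\<close> by the \<open>2a\<close>-th moment of \<open>v\<^sub>j\<close> (\<open>resolvent_step\<close>), and the Sobolev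
  inequality turns this into a bound for the moment of order \<open>2aq\<close> of \<open>v\<^sub>j\<^sub>+\<^sub>1\<close> (\<open>moser_step\<close>).  The losses
  \<open>(16 S \<lambda> 2^j) powr (1/q^j)\<close> have a finite product.  The chain rule for the gradient enters essentially
  here: for quadratic forms without it a Sobolev inequality does not bound the number of eigenvalues.
  The mean value in the Sobolev inequality contributes a term of lower order, which is absorbed because
  \<open>S \<lambda> \<ge> 1\<close> as soon as \<open>E\<close> contains a nonconstant function (\<open>poincare\<close>).

  All this holds for an abstract Dirichlet form.  That the continuously differentiable functions on a
  compact Kaehler manifold carry one rests on three facts.  The volume measure exists, because the
  densities in two charts differ by the factor \<open>\<bar>det J\<bar>\<^sup>2\<close>, which is the real Jacobian determinant of a
  holomorphic map with complex Jacobian matrix \<open>J\<close> (\<open>det_realify\<close>, \<open>ex1_volume\<close>).  The Sobolev inequality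
  applies to such functions, since they lie in \<open>W\<^sup>1\<^sup>,\<^sup>2\<close> (\<open>W12_del_of\<close>).  And smooth eigenfunctions satisfy
  the weak equation \<open>\<integral> \<langle>\<nabla>\<phi>, \<nabla>u\<rangle> = \<mu> \<integral> \<phi> u\<close> (\<open>eigenfunction_weak\<close>), because closedness of \<open>\<omega>\<close> makes the
  Laplacian a divergence: \<open>(\<Sum>j. \<partial>\<^sub>j (det g * g\<^sup>j\<^sup>k)) = 0\<close> (\<open>kahler_divergence_0\<close>).
\<close>

section \<open>Signed powers and elementary inequalities\<close>

text \<open>The odd power function.  Unlike \<open>\<bar>s\<bar> powr a\<close> it is continuously differentiable for every \<open>a \<ge> 1\<close>,
  including the first step \<open>a = 1\<close> of the iteration, where it is the identity.\<close>

definition signed_powr :: "real \<Rightarrow> real \<Rightarrow> real" where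
  "signed_powr a s = sgn s * \<bar>s\<bar> powr a"

text \<open>The case distinction is needed at \<open>s = 0\<close>, because \<open>0 powr 0 = 0\<close>.\<close>

definition signed_powr_deriv :: "real \<Rightarrow> real \<Rightarrow> real" where
  "signed_powr_deriv a s = (if a = 1 then 1 else a * \<bar>s\<bar> powr (a - 1))"

lemma abs_signed_powr: "\<bar>signed_powr a s\<bar> = \<bar>s\<bar> powr a"
  by (cases "s = 0") (auto simp: signed_powr_def abs_mult abs_sgn_eq)

lemma signed_powr_mult_self: "signed_powr a s * s = \<bar>s\<bar> powr (a + 1)"
proof (cases "s = 0")
  case False
  have "signed_powr a s * s = \<bar>s\<bar> powr a * \<bar>s\<bar>"
    by (simp add: signed_powr_def sgn_if)
  also have "\<dots> = \<bar>s\<bar> powr (a + 1)" using False by (simp add: powr_add)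
  finally show ?thesis .
qed (simp add: signed_powr_def)

lemma signed_powr_mult_le: "signed_powr a s * t \<le> \<bar>s\<bar> powr a * \<bar>t\<bar>"
  using abs_ge_self[of "signed_powr a s * t"] by (simp add: abs_mult abs_signed_powr)

lemma continuous_abs_powr: "b > 0 \<Longrightarrow> continuous_on A (\<lambda>s::real. \<bar>s\<bar> powr b)"
  by (intro continuous_on_powr') (auto intro!: continuous_intros)

lemma continuous_signed_powr_deriv: "a \<ge> 1 \<Longrightarrow> continuous_on UNIV (signed_powr_deriv a)"
  unfolding signed_powr_deriv_def [abs_def]
  by (cases "a = 1") (auto intro!: continuous_intros continuous_abs_powr)

lemma signed_powr_deriv_nonneg: "a \<ge> 1 \<Longrightarrow> signed_powr_deriv a s \<ge> 0"
  by (simp add: signed_powr_deriv_def)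

lemma DERIV_signed_powr:
  assumes "a \<ge> 1" shows "(signed_powr a has_real_derivative signed_powr_deriv a s) (at s)"
proof (cases "a = 1")
  case True
  have "signed_powr a = (\<lambda>s. s)" using True by (auto simp: fun_eq_iff signed_powr_def sgn_if)
  then show ?thesis using True by (simp add: signed_powr_deriv_def)
next
  case False
  hence a: "a > 1" using assms by simp
  consider "s > 0" | "s < 0" | "s = 0" by linarith
  then show ?thesis
  proof cases
    case 1
    have "((\<lambda>s. s powr a) has_real_derivative a * s powr (a - 1)) (at s)"
      using has_real_derivative_powr[OF 1, of a] by simp
    then show ?thesis
      by (rule has_field_derivative_transform_within_open[where S = "{0<..}", THEN DERIV_cong])
         (use 1 a in \<open>auto simp: signed_powr_def signed_powr_deriv_def\<close>)
  next
    case 2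
    have "((\<lambda>s. - ((-s) powr a)) has_real_derivative a * (-s) powr (a - 1)) (at s)"
      using 2 by (auto intro!: derivative_eq_intros)
    then show ?thesis
      by (rule has_field_derivative_transform_within_open[where S = "{..<0}", THEN DERIV_cong])
         (use 2 a in \<open>auto simp: signed_powr_def signed_powr_deriv_def\<close>)
  next
    case 3
    have "((\<lambda>h. \<bar>h\<bar> powr (a - 1)) \<longlongrightarrow> \<bar>0\<bar> powr (a - 1)) (at (0::real))"
      using continuous_abs_powr[of "a - 1" UNIV] a
      unfolding continuous_on_eq_continuous_at[OF open_UNIV] isCont_def by fastforce
    then have "((\<lambda>h. \<bar>h\<bar> powr (a - 1)) \<longlongrightarrow> 0) (at (0::real))" by simp
    moreover have "\<forall>\<^sub>F h in at (0::real). \<bar>h\<bar> powr (a - 1) = (signed_powr a (0 + h) - signed_powr a 0) / h"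
      by (rule eventually_at_topological[THEN iffD2])
         (auto intro!: exI[of _ UNIV] simp: signed_powr_def powr_diff sgn_if field_simps)
    ultimately have "((\<lambda>h. (signed_powr a (0 + h) - signed_powr a 0) / h) \<longlongrightarrow> 0) (at 0)"
      by (rule Lim_transform_eventually)
    then show ?thesis using 3 a by (simp add: DERIV_def signed_powr_deriv_def)
  qed
qed

text \<open>Compares the gradients of two powers of \<open>v\<close>: with \<open>w = sgn v \<bar>v\<bar> powr a\<close> and the test function
  \<open>\<phi> = sgn v \<bar>v\<bar> powr (2a-1)\<close> it says \<open>\<bar>\<nabla>w\<bar>\<^sup>2 \<le> a \<langle>\<nabla>\<phi>, \<nabla>v\<rangle>\<close>.\<close>

lemma signed_powr_deriv_square_le:
  assumes "a \<ge> 1"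
  shows "(signed_powr_deriv a s)\<^sup>2 \<le> a * signed_powr_deriv (2 * a - 1) s"
proof (cases "a = 1")
  case True then show ?thesis by (simp add: signed_powr_deriv_def)
next
  case False
  have "(\<bar>s\<bar> powr (a - 1))\<^sup>2 = \<bar>s\<bar> powr (2 * a - 1 - 1)"
    by (simp add: power2_eq_square flip: powr_add)
  then have "(signed_powr_deriv a s)\<^sup>2 = (a * a) * \<bar>s\<bar> powr (2 * a - 1 - 1)"
    using False by (simp add: signed_powr_deriv_def power_mult_distrib power2_eq_square)
  also have "\<dots> \<le> (a * (2 * a - 1)) * \<bar>s\<bar> powr (2 * a - 1 - 1)"
    using assms by (intro mult_right_mono mult_left_mono) auto
  also have "\<dots> = a * signed_powr_deriv (2 * a - 1) s" using False by (simp add: signed_powr_deriv_def)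
  finally show ?thesis .
qed

text \<open>Young's inequality, as convexity of \<open>exp\<close> between \<open>r ln x\<close> and \<open>r ln y\<close>.\<close>

lemma powr_young:
  fixes x y :: real
  assumes "x \<ge> 0" "y \<ge> 0" "r > 1"
  shows "x powr (r - 1) * y \<le> (1 - 1/r) * x powr r + (1/r) * y powr r"
proof (cases "x = 0 \<or> y = 0")
  case True then show ?thesis using assms by auto
next
  case False
  hence "x > 0" "y > 0" using assms by auto
  have "exp ((1 - 1/r) *\<^sub>R (r * ln x) + (1/r) *\<^sub>R (r * ln y)) \<le> (1 - 1/r) * exp (r * ln x) + (1/r) * exp (r * ln y)"
    by (rule convex_onD[OF exp_convex]) (use assms in auto)
  moreover have "(1 - 1/r) *\<^sub>R (r * ln x) + (1/r) *\<^sub>R (r * ln y) = (r - 1) * ln x + ln y"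
    using assms by (simp add: field_simps)
  ultimately have "exp ((r - 1) * ln x + ln y) \<le> (1 - 1/r) * exp (r * ln x) + (1/r) * exp (r * ln y)"
    by metis
  then show ?thesis using \<open>x > 0\<close> \<open>y > 0\<close> by (simp add: powr_def exp_add)
qed

text \<open>The factor \<open>4 powr q\<close> arises when \<open>\<bar>w\<bar> powr (2q)\<close> is bounded by the same powers of \<open>\<bar>w - m\<bar>\<close> and \<open>\<bar>m\<bar>\<close>.\<close>

lemma powr_add_le:
  fixes x y :: real
  assumes "x \<ge> 0" "y \<ge> 0" "q \<ge> 1"
  shows "(4 powr q * (x + y)) powr (1/q) \<le> 8 * (x powr (1/q) + y powr (1/q))"
proof -
  have "(4 powr q * (x + y)) powr (1/q) = 4 * (x + y) powr (1/q)"
    using assms by (simp add: powr_mult powr_powr)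
  also have "(x + y) powr (1/q) \<le> (2 * max x y) powr (1/q)"
    using assms by (intro powr_mono2) auto
  also have "\<dots> = 2 powr (1/q) * max x y powr (1/q)" using assms by (simp add: powr_mult)
  also have "\<dots> \<le> 2 * max x y powr (1/q)"
    using assms powr_mono[of "1/q" 1 2] by (intro mult_right_mono) auto
  also have "max x y powr (1/q) \<le> x powr (1/q) + y powr (1/q)" by (auto simp: max_def)
  finally show ?thesis by simp
qed

section \<open>Dirichlet forms and Moser iteration along resolvents\<close>

text \<open>The product of the losses \<open>(16 * 2^j) powr (1/q^j)\<close> over all steps of the iteration.\<close>

definition moser_const :: "real \<Rightarrow> real" where
  "moser_const q = 16 powr (q/(q-1)) * 2 powr (\<Sum>j. real j * (1/q)^j)"

text \<open>A strongly local Dirichlet form with a continuous carre du champ \<open>\<Gamma>\<close> on a compact space; on a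
  Riemannian manifold \<open>\<Gamma> u v = \<langle>\<nabla>u, \<nabla>v\<rangle>\<close>.  The core \<open>D\<close> consists of continuous functions, and \<open>\<Gamma> u v\<close> is
  continuous, so that all integrals below exist.\<close>

locale dirichlet_form =
  fixes M :: "'a::topological_space measure" and D :: "('a \<Rightarrow> real) set"
    and \<Gamma> :: "('a \<Rightarrow> real) \<Rightarrow> ('a \<Rightarrow> real) \<Rightarrow> 'a \<Rightarrow> real"
  assumes compact: "compact (UNIV :: 'a set)"
    and sets_M: "sets M = sets borel"
    and emeasure_finite: "emeasure M UNIV \<noteq> \<infinity>"
    and emeasure_open_pos: "\<And>U. open U \<Longrightarrow> U \<noteq> {} \<Longrightarrow> emeasure M U > 0"
    and cont: "\<And>u. u \<in> D \<Longrightarrow> continuous_on UNIV u"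
    and cont_\<Gamma>: "\<And>u v. u \<in> D \<Longrightarrow> v \<in> D \<Longrightarrow> continuous_on UNIV (\<Gamma> u v)"
    and const: "\<And>a. (\<lambda>x. a) \<in> D"
    and lincomb: "\<And>u v a b. u \<in> D \<Longrightarrow> v \<in> D \<Longrightarrow> (\<lambda>x. a * u x + b * v x) \<in> D"
    and \<Gamma>_lincomb: "\<And>u v w a b x. u \<in> D \<Longrightarrow> v \<in> D \<Longrightarrow> w \<in> D \<Longrightarrow>
          \<Gamma> (\<lambda>x. a * u x + b * v x) w x = a * \<Gamma> u w x + b * \<Gamma> v w x"
    and \<Gamma>_sym: "\<And>u v x. u \<in> D \<Longrightarrow> v \<in> D \<Longrightarrow> \<Gamma> u v x = \<Gamma> v u x"
    and \<Gamma>_nonneg: "\<And>u x. u \<in> D \<Longrightarrow> \<Gamma> u u x \<ge> 0"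
    and chain: "\<And>u \<phi> \<phi>'. u \<in> D \<Longrightarrow> (\<And>s. (\<phi> has_real_derivative \<phi>' s) (at s)) \<Longrightarrow>
          continuous_on UNIV \<phi>' \<Longrightarrow> (\<lambda>x. \<phi> (u x)) \<in> D"
    and \<Gamma>_chain: "\<And>u v \<phi> \<phi>' x. u \<in> D \<Longrightarrow> v \<in> D \<Longrightarrow> (\<And>s. (\<phi> has_real_derivative \<phi>' s) (at s)) \<Longrightarrow>
          continuous_on UNIV \<phi>' \<Longrightarrow> \<Gamma> (\<lambda>x. \<phi> (u x)) v x = \<phi>' (u x) * \<Gamma> u v x"
begin

definition avg :: "('a \<Rightarrow> real) \<Rightarrow> real" where
  "avg f = (1 / measure M UNIV) * (\<integral>x. f x \<partial>M)"

text \<open>The weak form of the eigenvalue equation; it is linear in \<open>e\<close>, so that for sums of eigenfunctions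
  the generator itself never appears.\<close>

definition weak_eigen :: "real \<Rightarrow> ('a \<Rightarrow> real) \<Rightarrow> bool" where
  "weak_eigen l e \<longleftrightarrow> e \<in> D \<and> (\<forall>\<phi>\<in>D. (\<integral>x. \<Gamma> \<phi> e x \<partial>M) = l * (\<integral>x. \<phi> x * e x \<partial>M))"

lemma space_M [simp]: "space M = UNIV"
  using sets_eq_imp_space_eq[OF sets_M] by simp

sublocale finite_measure M
  by (rule finite_measureI) (use emeasure_finite in simp)

lemma vol_pos: "measure M UNIV > 0"
  using emeasure_open_pos[of UNIV] by (simp add: emeasure_eq_measure)

lemma integrable_cont:
  fixes f :: "'a \<Rightarrow> real"
  assumes "continuous_on UNIV f" shows "integrable M f"
proof -
  have "bounded (range f)" using compact_continuous_image[OF assms compact] by (rule compact_imp_bounded)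
  then obtain B where B: "\<And>x. norm (f x) \<le> B" by (auto simp: bounded_iff)
  have "f \<in> borel_measurable borel" using assms by (rule borel_measurable_continuous_onI)
  then have "f \<in> borel_measurable M" using sets_M measurable_cong_sets[of M borel] by blast
  then show ?thesis using B by (intro integrable_const_bound[of _ B]) auto
qed

lemma avg_add: "continuous_on UNIV f \<Longrightarrow> continuous_on UNIV g \<Longrightarrow> avg (\<lambda>x. f x + g x) = avg f + avg g"
  by (simp add: avg_def integrable_cont algebra_simps)

lemma avg_diff: "continuous_on UNIV f \<Longrightarrow> continuous_on UNIV g \<Longrightarrow> avg (\<lambda>x. f x - g x) = avg f - avg g"
  by (simp add: avg_def integrable_cont algebra_simps)

lemma avg_cmult: "avg (\<lambda>x. c * f x) = c * avg f"
  by (simp add: avg_def)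

lemma avg_const [simp]: "avg (\<lambda>x. c) = c"
  using vol_pos by (simp add: avg_def)

lemma avg_sum: "(\<And>i. i \<in> I \<Longrightarrow> continuous_on UNIV (f i)) \<Longrightarrow> avg (\<lambda>x. \<Sum>i\<in>I. f i x) = (\<Sum>i\<in>I. avg (f i))"
  by (simp add: avg_def integrable_cont Bochner_Integration.integral_sum sum_distrib_left)

lemma avg_mono:
  assumes "continuous_on UNIV f" "continuous_on UNIV g" "\<And>x. f x \<le> g x"
  shows "avg f \<le> avg g"
  unfolding avg_def using vol_pos assms
  by (intro mult_left_mono integral_mono integrable_cont) auto

lemma avg_nonneg: "(\<And>x. f x \<ge> 0) \<Longrightarrow> avg f \<ge> 0"
  unfolding avg_def using vol_pos by (intro mult_nonneg_nonneg integral_nonneg) auto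

lemma integral_eq_avg: "(\<integral>x. f x \<partial>M) = measure M UNIV * avg f"
  using vol_pos by (simp add: avg_def)

lemma weak_eigen_iff: "weak_eigen l e \<longleftrightarrow> e \<in> D \<and> (\<forall>\<phi>\<in>D. avg (\<Gamma> \<phi> e) = l * avg (\<lambda>x. \<phi> x * e x))"
  using vol_pos by (simp add: weak_eigen_def integral_eq_avg)

lemma avg_le_sup_open:
  assumes f: "continuous_on UNIV f" "\<And>x. f x \<ge> 0" and U: "open U" and b: "b \<ge> 0" "\<And>x. x \<in> U \<Longrightarrow> f x \<ge> b"
  shows "b * (measure M U / measure M UNIV) \<le> avg f"
proof -
  have [measurable]: "U \<in> sets M" using U sets_M by simp
  have "(\<integral>x. b * indicator U x \<partial>M) \<le> (\<integral>x. f x \<partial>M)"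
  proof (rule integral_mono)
    show "integrable M (\<lambda>x. b * indicator U x)"
      by (intro integrable_mult_right integrable_real_indicator) (auto simp: less_top[symmetric])
  qed (use f b in \<open>auto intro!: integrable_cont simp: indicator_def\<close>)
  then show ?thesis using vol_pos by (simp add: avg_def field_simps)
qed

text \<open>The equation for \<open>v\<close> is \<open>v + s A v = f\<close> in weak form.  It is tested with \<open>\<phi> = sgn v \<bar>v\<bar> powr (2a-1)\<close>: then
  \<open>\<phi> v = \<bar>v\<bar> powr (2a)\<close>, while \<open>\<phi> f\<close> is split by Young's inequality in such a way that the part with \<open>v\<close> can
  be absorbed.\<close>

lemma resolvent_step:
  assumes vf: "v \<in> D" "f \<in> D" and s: "s > 0" and a: "a \<ge> 1"
    and eq: "\<And>\<phi>. \<phi> \<in> D \<Longrightarrow> avg (\<lambda>x. \<phi> x * v x) + s * avg (\<Gamma> \<phi> v) = avg (\<lambda>x. \<phi> x * f x)"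
  defines "w \<equiv> \<lambda>x. signed_powr a (v x)"
  shows "s * avg (\<Gamma> w w) \<le> avg (\<lambda>x. \<bar>f x\<bar> powr (2 * a)) / 2"
    and "avg (\<lambda>x. \<bar>v x\<bar> powr (2 * a)) \<le> avg (\<lambda>x. \<bar>f x\<bar> powr (2 * a))"
proof -
  \<comment> \<open>the exponent of the test function\<close>
  define b where "b = 2 * a - 1"
  have b: "b \<ge> 1" using a by (simp add: b_def)
  note [continuous_intros] = cont[OF vf(1)] cont[OF vf(2)]
  have cp: "continuous_on UNIV (\<lambda>x. \<bar>h x\<bar> powr c)" if "continuous_on UNIV h" "c > 0" for h :: "'a \<Rightarrow> real" and c
    using continuous_on_compose2[OF continuous_abs_powr[OF that(2), of UNIV] that(1)] by simp
  have wD: "w \<in> D" unfolding w_def by (rule chain[OF vf(1) DERIV_signed_powr[OF a] continuous_signed_powr_deriv[OF a]])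
  have pD: "(\<lambda>x. signed_powr b (v x)) \<in> D" by (rule chain[OF vf(1) DERIV_signed_powr[OF b] continuous_signed_powr_deriv[OF b]])
  have Gw: "\<Gamma> w w x = (signed_powr_deriv a (v x))\<^sup>2 * \<Gamma> v v x" for x
  proof -
    have "\<Gamma> w w x = signed_powr_deriv a (v x) * \<Gamma> v w x" 
      unfolding w_def by (rule \<Gamma>_chain[OF vf(1) wD[unfolded w_def] DERIV_signed_powr[OF a] continuous_signed_powr_deriv[OF a]])
    also have "\<Gamma> v w x = \<Gamma> w v x" by (rule \<Gamma>_sym[OF vf(1) wD])
    also have "\<dots> = signed_powr_deriv a (v x) * \<Gamma> v v x"
      unfolding w_def by (rule \<Gamma>_chain[OF vf(1) vf(1) DERIV_signed_powr[OF a] continuous_signed_powr_deriv[OF a]])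
    finally show ?thesis by (simp add: power2_eq_square)
  qed
  let ?p = "\<lambda>x. signed_powr b (v x)"
  have Gp: "\<Gamma> ?p v x = signed_powr_deriv b (v x) * \<Gamma> v v x" for x
    by (rule \<Gamma>_chain[OF vf(1) vf(1) DERIV_signed_powr[OF b] continuous_signed_powr_deriv[OF b]])
  have nn: "0 \<le> \<Gamma> ?p v x" for x
    unfolding Gp using signed_powr_deriv_nonneg[OF b] \<Gamma>_nonneg[OF vf(1)] by simp
  have le1: "avg (\<Gamma> w w) \<le> a * avg (\<Gamma> ?p v)"
    unfolding avg_cmult[symmetric]
  proof (rule avg_mono)
    fix x show "\<Gamma> w w x \<le> a * \<Gamma> ?p v x"
      unfolding Gw Gp using signed_powr_deriv_square_le[OF a, of "v x"] \<Gamma>_nonneg[OF vf(1), of x]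
      by (simp add: b_def mult_right_mono flip: mult.assoc)
  qed (auto intro!: continuous_intros cont_\<Gamma> wD pD vf)
  have main: "avg (\<lambda>x. \<bar>v x\<bar> powr (2 * a)) + s * avg (\<Gamma> ?p v) \<le>
     (1 - 1/(2*a)) * avg (\<lambda>x. \<bar>v x\<bar> powr (2 * a)) + 1/(2*a) * avg (\<lambda>x. \<bar>f x\<bar> powr (2 * a))"
  proof -
    have "avg (\<lambda>x. \<bar>v x\<bar> powr (2 * a)) = avg (\<lambda>x. ?p x * v x)"
      by (simp add: signed_powr_mult_self b_def)
    then have "avg (\<lambda>x. \<bar>v x\<bar> powr (2 * a)) + s * avg (\<Gamma> ?p v) = avg (\<lambda>x. ?p x * f x)"
      using eq[OF pD] by simp
    also have "\<dots> \<le> avg (\<lambda>x. (1 - 1/(2*a)) * \<bar>v x\<bar> powr (2 * a) + 1/(2*a) * \<bar>f x\<bar> powr (2 * a))"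
    proof (rule avg_mono)
      fix x
      have "?p x * f x \<le> \<bar>v x\<bar> powr b * \<bar>f x\<bar>" by (rule signed_powr_mult_le)
      also have "\<dots> \<le> (1 - 1/(2*a)) * \<bar>v x\<bar> powr (2 * a) + 1/(2*a) * \<bar>f x\<bar> powr (2 * a)"
        using powr_young[of "\<bar>v x\<bar>" "\<bar>f x\<bar>" "2 * a"] a by (simp add: b_def)
      finally show "?p x * f x \<le> (1 - 1/(2*a)) * \<bar>v x\<bar> powr (2 * a) + 1/(2*a) * \<bar>f x\<bar> powr (2 * a)" .
    qed (use a cont[OF pD] in \<open>auto intro!: continuous_intros cp\<close>)
    also have "\<dots> = (1 - 1/(2*a)) * avg (\<lambda>x. \<bar>v x\<bar> powr (2 * a)) + 1/(2*a) * avg (\<lambda>x. \<bar>f x\<bar> powr (2 * a))"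
      using a by (subst avg_add) (auto intro!: continuous_intros cp simp: avg_cmult simp del: times_divide_eq_left)
    finally show ?thesis .
  qed
  define X where "X = avg (\<lambda>x. \<bar>v x\<bar> powr (2 * a))"
  define Y where "Y = avg (\<lambda>x. \<bar>f x\<bar> powr (2 * a))"
  define Z where "Z = avg (\<Gamma> ?p v)"
  have nonneg: "X \<ge> 0" "Z \<ge> 0" unfolding X_def Z_def by (auto intro!: avg_nonneg nn)
  have m: "X + s * Z \<le> (1 - 1/(2*a)) * X + 1/(2*a) * Y" using main by (simp add: X_def Y_def Z_def)
  then have "1/(2*a) * X + s * Z \<le> 1/(2*a) * Y" by (simp add: algebra_simps)
  then have "2*a * (1/(2*a) * X + s * Z) \<le> 2*a * (1/(2*a) * Y)" using a by (intro mult_left_mono) auto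
  then have m2: "X + 2 * (a * (s * Z)) \<le> Y" using a by (simp add: algebra_simps)
  have "s * avg (\<Gamma> w w) \<le> s * (a * Z)" using le1 s by (simp add: Z_def)
  then show "s * avg (\<Gamma> w w) \<le> Y / 2" using m2 nonneg by (simp add: algebra_simps)
  show "X \<le> Y" using m2 nonneg a s by (smt (verit) mult_nonneg_nonneg)
qed

text \<open>The variance is nonnegative.\<close>

lemma avg_square_mean_le:
  assumes "continuous_on UNIV w" shows "(avg w)\<^sup>2 \<le> avg (\<lambda>x. (w x)\<^sup>2)"
proof -
  have "0 \<le> avg (\<lambda>x. (w x - avg w)\<^sup>2)" by (rule avg_nonneg) simp
  also have "avg (\<lambda>x. (w x - avg w)\<^sup>2) = avg (\<lambda>x. ((w x)\<^sup>2 - (2 * avg w) * w x) + (avg w)\<^sup>2)"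
    by (simp add: power2_diff algebra_simps)
  also have "\<dots> = avg (\<lambda>x. (w x)\<^sup>2) - (2 * avg w) * avg w + (avg w)\<^sup>2"
    using assms by (subst avg_add, auto intro!: continuous_intros, subst avg_diff, auto intro!: continuous_intros simp: avg_cmult)
  finally show ?thesis by (simp add: power2_eq_square)
qed


lemma D_sum: "finite I \<Longrightarrow> (\<And>i. i \<in> I \<Longrightarrow> e i \<in> D) \<Longrightarrow> (\<lambda>x. \<Sum>i\<in>I. c i * e i x) \<in> D"
proof (induction I rule: finite_induct)
  case empty then show ?case using const[of 0] by simp
next
  case (insert i I)
  then show ?case using lincomb[of "e i" "\<lambda>x. \<Sum>i\<in>I. c i * e i x" "c i" 1] by simp
qed

text \<open>On sums of eigenfunctions the generator acts by multiplying the coefficients.\<close>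

lemma avg_\<Gamma>_sum:
  assumes "finite I" "\<And>i. i \<in> I \<Longrightarrow> weak_eigen (l i) (e i)" "\<phi> \<in> D"
  shows "avg (\<Gamma> \<phi> (\<lambda>x. \<Sum>i\<in>I. c i * e i x)) = avg (\<lambda>x. \<phi> x * (\<Sum>i\<in>I. (l i * c i) * e i x))"
  using assms(1,2)
proof (induction I rule: finite_induct)
  case empty
  have "\<Gamma> \<phi> (\<lambda>x. 0) = (\<lambda>x. 0)"
    using \<Gamma>_sym[OF assms(3) const[of 0]] \<Gamma>_lincomb[OF assms(3) assms(3) assms(3), of 0 0] by (auto simp: fun_eq_iff)
  then show ?case by simp
next
  case (insert i I)
  let ?g = "\<lambda>x. \<Sum>i\<in>I. c i * e i x"
  let ?h = "\<lambda>x. \<Sum>i\<in>I. (l i * c i) * e i x"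
  have eD: "e j \<in> D" if "j \<in> insert i I" for j using insert.prems[OF that] by (simp add: weak_eigen_def)
  have gD: "?g \<in> D" "?h \<in> D" by (rule D_sum; use insert eD in auto)+
  have iD: "e i \<in> D" by (rule eD) simp
  have eq: "\<Gamma> \<phi> (\<lambda>x. c i * e i x + 1 * ?g x) = (\<lambda>x. c i * \<Gamma> \<phi> (e i) x + \<Gamma> \<phi> ?g x)"
  proof
    fix x
    have "\<Gamma> \<phi> (\<lambda>x. c i * e i x + 1 * ?g x) x = \<Gamma> (\<lambda>x. c i * e i x + 1 * ?g x) \<phi> x"
      by (rule \<Gamma>_sym[OF assms(3) lincomb[OF iD gD(1)]])
    also have "\<dots> = c i * \<Gamma> (e i) \<phi> x + 1 * \<Gamma> ?g \<phi> x" by (rule \<Gamma>_lincomb[OF iD gD(1) assms(3)])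
    also have "\<Gamma> (e i) \<phi> x = \<Gamma> \<phi> (e i) x" by (rule \<Gamma>_sym[OF iD assms(3)])
    also have "\<Gamma> ?g \<phi> x = \<Gamma> \<phi> ?g x" by (rule \<Gamma>_sym[OF gD(1) assms(3)])
    finally show "\<Gamma> \<phi> (\<lambda>x. c i * e i x + 1 * ?g x) x = c i * \<Gamma> \<phi> (e i) x + \<Gamma> \<phi> ?g x" by simp
  qed
  have "avg (\<Gamma> \<phi> (\<lambda>x. \<Sum>i\<in>insert i I. c i * e i x)) = c i * avg (\<Gamma> \<phi> (e i)) + avg (\<Gamma> \<phi> ?g)"
    using insert.hyps eq avg_add[of "\<lambda>x. c i * \<Gamma> \<phi> (e i) x" "\<Gamma> \<phi> ?g"] cont_\<Gamma>[OF assms(3) iD] cont_\<Gamma>[OF assms(3) gD(1)]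
    by (simp add: avg_cmult continuous_on_mult_left)
  also have "avg (\<Gamma> \<phi> (e i)) = l i * avg (\<lambda>x. \<phi> x * e i x)"
    using insert.prems[of i] assms(3) by (auto simp: weak_eigen_iff)
  also have "avg (\<Gamma> \<phi> ?g) = avg (\<lambda>x. \<phi> x * ?h x)" using insert by simp
  also have "c i * (l i * avg (\<lambda>x. \<phi> x * e i x)) + avg (\<lambda>x. \<phi> x * ?h x) =
     avg (\<lambda>x. (c i * l i) * (\<phi> x * e i x) + \<phi> x * ?h x)"
    using cont[OF assms(3)] cont[OF iD] cont[OF gD(2)]
    by (subst avg_add) (auto intro!: continuous_intros simp: avg_cmult)
  also have "\<dots> = avg (\<lambda>x. \<phi> x * (\<Sum>i\<in>insert i I. (l i * c i) * e i x))"
    using insert.hyps by (simp add: algebra_simps)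
  finally show ?case .
qed

definition orthonormal :: "'i set \<Rightarrow> ('i \<Rightarrow> 'a \<Rightarrow> real) \<Rightarrow> bool" where
  "orthonormal I e \<longleftrightarrow> (\<forall>i\<in>I. \<forall>j\<in>I. avg (\<lambda>x. e i x * e j x) = (if i = j then 1 else 0))"

lemma avg_square_sum:
  assumes "finite I" "\<And>i. i \<in> I \<Longrightarrow> e i \<in> D" "orthonormal I e"
  shows "avg (\<lambda>x. (\<Sum>i\<in>I. c i * e i x)\<^sup>2) = (\<Sum>i\<in>I. (c i)\<^sup>2)"
proof -
  have "avg (\<lambda>x. (\<Sum>i\<in>I. c i * e i x)\<^sup>2) = avg (\<lambda>x. \<Sum>i\<in>I. \<Sum>j\<in>I. (c i * c j) * (e i x * e j x))"
    by (simp add: power2_eq_square sum_product algebra_simps)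
  also have "\<dots> = (\<Sum>i\<in>I. \<Sum>j\<in>I. (c i * c j) * avg (\<lambda>x. e i x * e j x))"
    using cont[OF assms(2)]
    by (subst avg_sum, (auto intro!: continuous_intros)[], intro sum.cong refl, subst avg_sum)
       (auto intro!: continuous_intros simp: avg_cmult)
  also have "\<dots> = (\<Sum>i\<in>I. \<Sum>j\<in>I. if j = i then (c i)\<^sup>2 else 0)"
    using assms(3) by (intro sum.cong refl) (auto simp: orthonormal_def power2_eq_square)
  also have "\<dots> = (\<Sum>i\<in>I. (c i)\<^sup>2)" using assms(1) by simp
  finally show ?thesis .
qed

lemma Pi_one_plus_le_exp:
  fixes x :: "'i \<Rightarrow> real"
  assumes "\<And>i. i \<in> I \<Longrightarrow> x i \<ge> 0"
  shows "(\<Prod>i\<in>I. 1 + x i) \<le> exp (\<Sum>i\<in>I. x i)"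
proof (cases "finite I")
  case True
  have "(\<Prod>i\<in>I. 1 + x i) \<le> (\<Prod>i\<in>I. exp (x i))"
    by (rule prod_mono) (use assms in \<open>auto intro: exp_ge_add_one_self add_nonneg_nonneg\<close>)
  then show ?thesis using True by (simp add: exp_sum)
qed simp

end

locale sobolev_dirichlet_form = dirichlet_form +
  fixes q S :: real
  assumes q: "q > 1" and S: "S \<ge> 0"
    and sobolev: "\<And>u. u \<in> D \<Longrightarrow> avg (\<lambda>x. \<bar>u x - avg u\<bar> powr (2 * q)) powr (1/q) \<le> S * avg (\<Gamma> u u)"
begin

text \<open>The Sobolev inequality for \<open>w\<close>, after splitting \<open>w\<close> into its mean and the rest; the mean contributes
  the second summand.\<close>

lemma sobolev_gain:
  assumes v: "v \<in> D" and a: "a \<ge> 1"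
  defines "w \<equiv> \<lambda>x. signed_powr a (v x)"
  shows "avg (\<lambda>x. \<bar>v x\<bar> powr (2 * (a * q))) powr (1/q) \<le> 8 * (S * avg (\<Gamma> w w) + avg (\<lambda>x. \<bar>v x\<bar> powr (2 * a)))"
proof -
  define m where "m = avg w"
  have wD: "w \<in> D" unfolding w_def by (rule chain[OF v DERIV_signed_powr[OF a] continuous_signed_powr_deriv[OF a]])
  note [continuous_intros] = cont[OF v] cont[OF wD]
  have cp: "continuous_on UNIV (\<lambda>x. \<bar>h x\<bar> powr c)" if "continuous_on UNIV h" "c > 0" for h :: "'a \<Rightarrow> real" and c
    using continuous_on_compose2[OF continuous_abs_powr[OF that(2), of UNIV] that(1)] by simp
  define X where "X = avg (\<lambda>x. \<bar>w x - m\<bar> powr (2 * q))"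
  have X0: "X \<ge> 0" unfolding X_def by (rule avg_nonneg) simp
  have aw: "\<bar>v x\<bar> powr (2 * (a * q)) = \<bar>w x\<bar> powr (2 * q)" for x
    by (simp add: w_def abs_signed_powr powr_powr mult.left_commute)
  have aw2: "(w x)\<^sup>2 = \<bar>v x\<bar> powr (2 * a)" for x
  proof -
    have "(w x)\<^sup>2 = \<bar>w x\<bar>\<^sup>2" by simp
    also have "\<dots> = \<bar>v x\<bar> powr (a + a)" unfolding w_def abs_signed_powr power2_eq_square by (rule powr_add[symmetric])
    also have "a + a = 2 * a" by simp
    finally show ?thesis .
  qed
  have pt: "\<bar>w x\<bar> powr (2 * q) \<le> 4 powr q * (\<bar>w x - m\<bar> powr (2 * q) + \<bar>m\<bar> powr (2 * q))" for x
  proof -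
    define t where "t = max \<bar>w x - m\<bar> \<bar>m\<bar>"
    have "\<bar>w x\<bar> \<le> \<bar>w x - m\<bar> + \<bar>m\<bar>" by linarith
    also have "\<dots> \<le> 2 * t" unfolding t_def
      using add_mono[OF max.cobounded1[of "\<bar>w x - m\<bar>" "\<bar>m\<bar>"] max.cobounded2[of "\<bar>m\<bar>" "\<bar>w x - m\<bar>"]]
      by (simp only: mult_2)
    finally have "\<bar>w x\<bar> \<le> 2 * t" .
    then have "\<bar>w x\<bar> powr (2 * q) \<le> (2 * t) powr (2 * q)" using q by (intro powr_mono2) auto
    also have "\<dots> = 2 powr (2 * q) * t powr (2 * q)" by (simp add: powr_mult t_def)
    also have "2 powr (2 * q) = (4::real) powr q" using powr_powr[of 2 2 q] by simp
    also have "t powr (2 * q) \<le> \<bar>w x - m\<bar> powr (2 * q) + \<bar>m\<bar> powr (2 * q)"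
      by (auto simp: t_def max_def)
    finally show ?thesis by simp
  qed
  have "avg (\<lambda>x. \<bar>v x\<bar> powr (2 * (a * q))) \<le> avg (\<lambda>x. 4 powr q * (\<bar>w x - m\<bar> powr (2 * q) + \<bar>m\<bar> powr (2 * q)))"
    unfolding aw by (rule avg_mono) (use pt q in \<open>auto intro!: continuous_intros cp\<close>)
  also have "\<dots> = 4 powr q * (X + \<bar>m\<bar> powr (2 * q))"
    unfolding avg_cmult X_def using q by (subst avg_add) (auto intro!: continuous_intros cp)
  finally have "avg (\<lambda>x. \<bar>v x\<bar> powr (2 * (a * q))) powr (1/q) \<le> (4 powr q * (X + \<bar>m\<bar> powr (2 * q))) powr (1/q)"
    using q by (intro powr_mono2) (auto intro!: avg_nonneg)
  also have "\<dots> \<le> 8 * (X powr (1/q) + (\<bar>m\<bar> powr (2 * q)) powr (1/q))"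
    by (rule powr_add_le) (use X0 q in auto)
  also have "(\<bar>m\<bar> powr (2 * q)) powr (1/q) = m\<^sup>2"
    using q by (cases "m = 0") (auto simp: powr_powr)
  also have "m\<^sup>2 \<le> avg (\<lambda>x. \<bar>v x\<bar> powr (2 * a))"
    using avg_square_mean_le[OF cont[OF wD]] unfolding m_def aw2 .
  also have "X powr (1/q) \<le> S * avg (\<Gamma> w w)" unfolding X_def m_def by (rule sobolev[OF wD])
  finally show ?thesis by simp
qed

lemma moser_step:
  assumes "v \<in> D" "f \<in> D" "s > 0" "a \<ge> 1"
    and "\<And>\<phi>. \<phi> \<in> D \<Longrightarrow> avg (\<lambda>x. \<phi> x * v x) + s * avg (\<Gamma> \<phi> v) = avg (\<lambda>x. \<phi> x * f x)"
  shows "avg (\<lambda>x. \<bar>v x\<bar> powr (2 * (a * q))) powr (1/q) \<le> 8 * (S / s + 1) * avg (\<lambda>x. \<bar>f x\<bar> powr (2 * a))"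
proof -
  define w where "w = (\<lambda>x. signed_powr a (v x))"
  define Y where "Y = avg (\<lambda>x. \<bar>f x\<bar> powr (2 * a))"
  have Y0: "Y \<ge> 0" unfolding Y_def by (rule avg_nonneg) simp
  note r1 = resolvent_step(1)[OF assms, folded w_def Y_def]
  have r2: "avg (\<lambda>x. \<bar>v x\<bar> powr (2 * a)) \<le> Y"
    unfolding Y_def by (rule resolvent_step(2)[OF assms])
  have "avg (\<Gamma> w w) \<le> Y / s" using r1 assms(3) Y0 by (simp add: field_simps)
  then have "S * avg (\<Gamma> w w) \<le> S * (Y / s)" using S by (rule mult_left_mono)
  with sobolev_gain[OF assms(1,4), folded w_def] r2 
  have "avg (\<lambda>x. \<bar>v x\<bar> powr (2 * (a * q))) powr (1/q) \<le> 8 * (S * (Y / s) + Y)"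
    by (meson add_mono mult_left_mono order_trans zero_le_numeral)
  then show ?thesis unfolding Y_def[symmetric] by (simp add: algebra_simps)
qed

text \<open>Both \<open>(\<Sum>j. 1/q^j) = q/(q-1)\<close> and \<open>(\<Sum>j. j/q^j)\<close> converge because \<open>q > 1\<close>; the first one is the exponent in
  the final estimate.\<close>

lemma moser_product_le:
  assumes T: "T \<ge> 1"
  shows "(\<Prod>j<J. (16 * T * 2^j) powr (1/q^j)) \<le> moser_const q * T powr (q/(q-1))"
proof -
  have iq: "norm (1/q) < 1" "0 \<le> 1/q" using q by auto
  have s1: "summable (\<lambda>j. (1/q)^j)" and s2: "summable (\<lambda>j. real j * (1/q)^j)"
  proof -
    show "summable (\<lambda>j. (1/q)^j)" by (rule summable_geometric[OF iq(1)])
    have "summable (\<lambda>j. of_nat (Suc j) * (1/q)^j)" using geometric_deriv_sums[OF iq(1)] by (rule sums_summable)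
    then show "summable (\<lambda>j. real j * (1/q)^j)"
      by (rule summable_comparison_test') (use iq q in \<open>auto intro!: mult_right_mono simp: abs_mult\<close>)
  qed
  have e1: "(\<Sum>j<J. (1/q)^j) \<le> q/(q-1)"
  proof -
    have "(\<Sum>j<J. (1/q)^j) \<le> (\<Sum>j. (1/q)^j)" using s1 iq by (intro sum_le_suminf) auto
    also have "\<dots> = q/(q-1)" using suminf_geometric[OF iq(1)] q by (simp add: field_simps)
    finally show ?thesis .
  qed
  have e2: "(\<Sum>j<J. real j * (1/q)^j) \<le> (\<Sum>j. real j * (1/q)^j)"
    using s2 iq by (intro sum_le_suminf) auto
  have eq: "(16 * T * 2^j) powr (1/q^j) = (16*T) powr ((1/q)^j) * 2 powr (real j * (1/q)^j)" for j
    using T by (simp add: powr_mult powr_powr power_one_over flip: powr_realpow)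
  have pp: "(\<Prod>j<J. c powr (f j)) = c powr (\<Sum>j<J. f j)" if "c > 0" for c :: real and f :: "nat \<Rightarrow> real"
    using that by (induction J) (auto simp: powr_add)
  have "(\<Prod>j<J. (16 * T * 2^j) powr (1/q^j)) = (16*T) powr (\<Sum>j<J. (1/q)^j) * 2 powr (\<Sum>j<J. real j * (1/q)^j)"
    unfolding eq prod.distrib using T by (simp add: pp)
  also have "\<dots> \<le> (16*T) powr (q/(q-1)) * 2 powr (\<Sum>j. real j * (1/q)^j)"
    using e1 e2 T by (intro mult_mono powr_mono) auto
  also have "\<dots> = moser_const q * T powr (q/(q-1))"
    using T by (simp add: moser_const_def powr_mult)
  finally show ?thesis .
qed

text \<open>One step raises the exponent by the factor \<open>q\<close>.  Since \<open>S l = T \<ge> 1\<close>, the constant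
  \<open>8 (2^j T + 1)\<close> of the \<open>j\<close>-th step is at most \<open>16 T 2^j\<close>.\<close>

lemma moser_iteration:
  assumes T: "T \<ge> 1" and l: "l > 0" and Sl: "S * l = T"
    and vD: "\<And>j. v j \<in> D"
    and eq: "\<And>\<phi> j. j < J \<Longrightarrow> \<phi> \<in> D \<Longrightarrow> avg (\<lambda>x. \<phi> x * v (Suc j) x) + (1/(2^j * l)) * avg (\<Gamma> \<phi> (v (Suc j))) = avg (\<lambda>x. \<phi> x * v j x)"
  shows "avg (\<lambda>x. \<bar>v J x\<bar> powr (2 * q^J)) powr (1/q^J) \<le> moser_const q * T powr (q/(q-1)) * avg (\<lambda>x. (v 0 x)\<^sup>2)"
proof -
  define A where "A j = avg (\<lambda>x. \<bar>v j x\<bar> powr (2 * q^j))" for j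
  have A0: "A j \<ge> 0" for j unfolding A_def by (rule avg_nonneg) simp
  have step: "A (Suc j) powr (1/q) \<le> (16 * T * 2^j) * A j" if "j < J" for j
  proof -
    have "A (Suc j) powr (1/q) \<le> 8 * (S / (1/(2^j * l)) + 1) * A j"
      unfolding A_def power_Suc2 by (rule moser_step[OF vD vD]) (use q l eq that in auto)
    also have "S / (1/(2^j * l)) = 2^j * T" using Sl by (simp add: field_simps)
    also have "8 * (2^j * T + 1) * A j \<le> (16 * T * 2^j) * A j"
    proof (rule mult_right_mono[OF _ A0])
      have "1 * 1 \<le> 2^j * T" using T by (intro mult_mono) auto
      then show "8 * (2^j * T + 1) \<le> 16 * T * 2^j" by (simp add: algebra_simps)
    qed
    finally show ?thesis .
  qed
  have "A i powr (1/q^i) \<le> (\<Prod>j<i. (16 * T * 2^j) powr (1/q^j)) * A 0" if "i \<le> J" for i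
    using that
  proof (induction i)
    case 0 then show ?case using A0[of 0] by simp
  next
    case (Suc i)
    have "A (Suc i) powr (1/q^Suc i) = (A (Suc i) powr (1/q)) powr (1/q^i)"
      by (simp add: powr_powr)
    also have "\<dots> \<le> ((16 * T * 2^i) * A i) powr (1/q^i)"
      using step[of i] Suc.prems q by (intro powr_mono2) auto
    also have "\<dots> = (16 * T * 2^i) powr (1/q^i) * A i powr (1/q^i)"
      using T A0 by (simp add: powr_mult)
    also have "\<dots> \<le> (16 * T * 2^i) powr (1/q^i) * ((\<Prod>j<i. (16 * T * 2^j) powr (1/q^j)) * A 0)"
      using Suc by (intro mult_left_mono) auto
    finally show ?case by (simp add: mult_ac)
  qed
  from this[of J] have "A J powr (1/q^J) \<le> (\<Prod>j<J. (16 * T * 2^j) powr (1/q^j)) * A 0" by simp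
  also have "\<dots> \<le> moser_const q * T powr (q/(q-1)) * A 0"
    by (rule mult_right_mono[OF moser_product_le[OF T] A0])
  also have "A 0 = avg (\<lambda>x. (v 0 x)\<^sup>2)" unfolding A_def
    by (rule arg_cong[where f = avg]) (auto simp: fun_eq_iff)
  finally show ?thesis unfolding A_def .
qed

text \<open>Averages of high powers see the supremum: on the open set where \<open>g\<^sup>2 > b\<close>, a set of positive relative
  measure \<open>\<theta>\<close>, one loses only the factor \<open>\<theta> powr (1/q^J)\<close>, which tends to 1.\<close>

lemma square_le_of_avg_powr_le:
  assumes g: "continuous_on UNIV g" and bd: "\<And>J. avg (\<lambda>x. \<bar>g x\<bar> powr (2 * q^J)) powr (1/q^J) \<le> B"
  shows "(g x)\<^sup>2 \<le> B"
proof (rule ccontr)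
  assume "\<not> (g x)\<^sup>2 \<le> B"
  then obtain b where b: "B < b" "b < (g x)\<^sup>2" using dense[of B "(g x)\<^sup>2"] by auto
  have B0: "B \<ge> 0" using bd[of 0] by (smt (verit) powr_ge_zero)
  define U where "U = {y. b < (g y)\<^sup>2}"
  have U: "open U" "x \<in> U" unfolding U_def using b
    by (auto intro!: open_Collect_less continuous_intros g)
  define \<theta> where "\<theta> = measure M U / measure M UNIV"
  have "emeasure M U > 0" using emeasure_open_pos[OF U(1)] U(2) by auto
  then have th: "\<theta> > 0" unfolding \<theta>_def using vol_pos by (simp add: emeasure_eq_measure)
  have le: "b * \<theta> powr (1/q^J) \<le> B" for J
  proof -
    have qJ: "q^J > 0" using q by simp
    have "b powr (q^J) * \<theta> \<le> avg (\<lambda>x. \<bar>g x\<bar> powr (2 * q^J))"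
      unfolding \<theta>_def
    proof (rule avg_le_sup_open[OF _ _ U(1)])
      show "continuous_on UNIV (\<lambda>x. \<bar>g x\<bar> powr (2 * q^J))"
        using continuous_on_compose2[OF continuous_abs_powr[of _ UNIV] g, of "2 * q^J"] qJ by auto
      fix y assume "y \<in> U"
      then have "b powr (q^J) \<le> ((g y)\<^sup>2) powr (q^J)" using b B0 qJ by (intro powr_mono2) (auto simp: U_def)
      also have "(g y)\<^sup>2 = \<bar>g y\<bar> powr 2" by simp
      also have "(\<bar>g y\<bar> powr 2) powr (q^J) = \<bar>g y\<bar> powr (2 * q^J)" by (simp only: powr_powr)
      finally show "b powr (q^J) \<le> \<bar>g y\<bar> powr (2 * q^J)" .
    qed auto
    then have "(b powr (q^J) * \<theta>) powr (1/q^J) \<le> avg (\<lambda>x. \<bar>g x\<bar> powr (2 * q^J)) powr (1/q^J)"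
      using th qJ by (intro powr_mono2) auto
    also have "\<dots> \<le> B" by (rule bd)
    also have "(b powr (q^J) * \<theta>) powr (1/q^J) = b * \<theta> powr (1/q^J)"
      using th b B0 qJ q by (simp add: powr_mult powr_powr)
    finally show ?thesis .
  qed
  have "(\<lambda>J. (1/q)^J) \<longlonglongrightarrow> 0" using q by (intro LIMSEQ_power_zero) (auto simp: field_simps)
  then have "(\<lambda>J. \<theta> powr ((1/q)^J)) \<longlonglongrightarrow> \<theta> powr 0" using th by (intro tendsto_powr tendsto_const) auto
  then have "(\<lambda>J. b * \<theta> powr (1/q^J)) \<longlonglongrightarrow> b * 1" using th by (intro tendsto_intros) (simp add: power_one_over)
  then have "b \<le> B" using le by (intro LIMSEQ_le_const2[of _ b]) auto
  then show False using b by simp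
qed


text \<open>Two orthonormal functions span a nonzero function \<open>f\<close> of mean zero, and \<open>avg (\<Gamma> f f) \<le> L * avg f\<^sup>2\<close>.  For
  such \<open>f\<close> the Sobolev inequality bounds \<open>avg f\<^sup>2\<close> by \<open>S * avg (\<Gamma> f f)\<close>.\<close>

lemma poincare:
  assumes fin: "finite I" and card: "card I \<ge> 2" and e: "\<And>i. i \<in> I \<Longrightarrow> weak_eigen (l i) (e i)"
    and on: "orthonormal I e" and l: "\<And>i. i \<in> I \<Longrightarrow> l i \<le> L"
  shows "S * L \<ge> 1"
proof -
  obtain i j where ij: "i \<in> I" "j \<in> I" "i \<noteq> j"
    using card card_2_iff' by (metis card_le_Suc0_iff_eq fin not_less_eq_eq numeral_2_eq_2)
  have eD: "e i \<in> D" if "i \<in> I" for i using e[OF that] by (simp add: weak_eigen_def)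
  have on': "orthonormal {i,j} e" using on ij by (auto simp: orthonormal_def)
  obtain a b where ab: "a \<noteq> 0 \<or> b \<noteq> 0" "a * avg (e i) + b * avg (e j) = 0"
  proof (cases "avg (e i) = 0 \<and> avg (e j) = 0")
    case True then show ?thesis using that[of 1 0] by simp
  next
    case False then show ?thesis using that[of "avg (e j)" "- avg (e i)"] by auto
  qed
  define c where "c k = (if k = i then a else b)" for k
  define f where "f = (\<lambda>x. \<Sum>k\<in>{i,j}. c k * e k x)"
  have fD: "f \<in> D" unfolding f_def by (rule D_sum) (use ij eD in auto)
  have sq: "avg (\<lambda>x. (f x)\<^sup>2) = a\<^sup>2 + b\<^sup>2"
    unfolding f_def by (subst avg_square_sum) (use ij eD on' in \<open>auto simp: c_def\<close>)
  have pos: "a\<^sup>2 + b\<^sup>2 > 0" using ab by (simp add: sum_power2_gt_zero_iff)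
  have mean: "avg f = 0"
    unfolding f_def using ij ab cont[OF eD] by (simp add: c_def avg_add avg_cmult continuous_on_mult_left)
  have "avg (\<Gamma> f f) = avg (\<lambda>x. f x * (\<Sum>k\<in>{i,j}. (l k * c k) * e k x))"
    by (subst (2) f_def, subst avg_\<Gamma>_sum[OF _ _ fD]) (use ij e in auto)
  also have "\<dots> = avg (\<lambda>x. (l i * a\<^sup>2) * (e i x * e i x) + ((l i + l j) * a * b) * (e i x * e j x) + (l j * b\<^sup>2) * (e j x * e j x))"
    unfolding f_def using ij by (simp add: c_def algebra_simps power2_eq_square)
  also have "\<dots> = l i * a\<^sup>2 + l j * b\<^sup>2"
    using on' ij cont[OF eD] by (simp add: avg_add avg_cmult continuous_on_mult_left continuous_on_add continuous_on_mult orthonormal_def)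
  also have "\<dots> \<le> L * a\<^sup>2 + L * b\<^sup>2" using l ij by (intro add_mono mult_right_mono) auto
  finally have G: "avg (\<Gamma> f f) \<le> L * (a\<^sup>2 + b\<^sup>2)" by (simp add: algebra_simps)
  define X where "X = avg (\<lambda>x. \<bar>f x\<bar> powr (2 * q))"
  have cpf: "continuous_on UNIV (\<lambda>x. \<bar>f x\<bar> powr (2 * q))"
    using continuous_on_compose2[OF continuous_abs_powr[of "2 * q" UNIV] cont[OF fD]] q by auto
  define t where "t = X powr (1/q)"
  have X0: "X \<ge> 0" unfolding X_def by (rule avg_nonneg) simp
  have "t \<ge> 0" by (simp add: t_def)
  \<comment> \<open>Young's inequality gives the comparison of the averages of \<open>f\<^sup>2\<close> and \<open>\<bar>f\<bar>\<^sup>2\<^sup>q\<close>\<close>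
  have jen: "a\<^sup>2 + b\<^sup>2 \<le> t"
  proof -
    define y where "y = a\<^sup>2 + b\<^sup>2"
    have y: "y > 0" using pos by (simp add: y_def)
    have "avg (\<lambda>x. y powr (q - 1) * (f x)\<^sup>2) \<le> avg (\<lambda>x. (1 - 1/q) * y powr q + (1/q) * \<bar>f x\<bar> powr (2 * q))"
    proof (rule avg_mono)
      fix x
      have "((f x)\<^sup>2) powr q = \<bar>f x\<bar> powr (2 * q)"
        using powr_powr[of "\<bar>f x\<bar>" 2 q] by simp
      then show "y powr (q - 1) * (f x)\<^sup>2 \<le> (1 - 1/q) * y powr q + (1/q) * \<bar>f x\<bar> powr (2 * q)"
        using powr_young[of y "(f x)\<^sup>2" q] y q by simp
    qed (intro continuous_intros cont[OF fD] cpf)+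
    also have "\<dots> = (1 - 1/q) * y powr q + (1/q) * X"
      using cpf by (subst avg_add) (auto intro!: continuous_intros simp: avg_cmult X_def simp del: times_divide_eq_left)
    also have "avg (\<lambda>x. y powr (q - 1) * (f x)\<^sup>2) = y powr q"
      using powr_mult_base[of y "q - 1"] y by (simp add: avg_cmult sq mult.commute flip: y_def)
    finally have "y powr q \<le> X" using q by (simp add: field_simps)
    then have "(y powr q) powr (1/q) \<le> t" unfolding t_def using q y by (intro powr_mono2) auto
    then show ?thesis using y q by (simp add: powr_powr y_def)
  qed
  have "t \<le> S * avg (\<Gamma> f f)" using sobolev[OF fD] by (simp add: mean t_def X_def)
  also have "\<dots> \<le> S * (L * (a\<^sup>2 + b\<^sup>2))" using G S by (rule mult_left_mono)
  finally have "1 * (a\<^sup>2 + b\<^sup>2) \<le> (S * L) * (a\<^sup>2 + b\<^sup>2)" using jen by (simp add: mult.assoc)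
  then show ?thesis using pos by (simp only: mult_le_cancel_right_pos)
qed

text \<open>The sup estimate on the span of the \<open>e i\<close>, followed by the trace argument.\<close>

theorem card_eigen_le:
  assumes fin: "finite I" and card: "card I \<ge> 2" and e: "\<And>i. i \<in> I \<Longrightarrow> weak_eigen (l i) (e i)"
    and on: "orthonormal I e" and l: "\<And>i. i \<in> I \<Longrightarrow> 0 \<le> l i" "\<And>i. i \<in> I \<Longrightarrow> l i \<le> L"
  shows "real (card I) \<le> exp 4 * moser_const q * (S * L) powr (q/(q-1))"
proof -
  define T where "T = S * L"
  have T: "T \<ge> 1" unfolding T_def by (rule poincare[OF fin card e on l(2)])
  have L: "L > 0" using T S by (simp add: T_def) (metis S mult_nonneg_nonpos not_le not_one_le_zero order_trans)
  have eD: "e i \<in> D" if "i \<in> I" for i using e[OF that] by (simp add: weak_eigen_def)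
  define C where "C = exp 4 * moser_const q * T powr (q/(q-1))"
  have mc: "moser_const q \<ge> 0" by (simp add: moser_const_def)
  have sup: "(\<Sum>i\<in>I. a i * e i x)\<^sup>2 \<le> C * (\<Sum>i\<in>I. (a i)\<^sup>2)" for a x
  proof (rule square_le_of_avg_powr_le)
    show "continuous_on UNIV (\<lambda>x. \<Sum>i\<in>I. a i * e i x)"
      by (rule cont[OF D_sum[OF fin eD]])
    fix J :: nat
    \<comment> \<open>the coefficients of \<open>v\<^sub>j = (1 + s\<^sub>j A) \<dots> (1 + s\<^sub>J\<^sub>-\<^sub>1 A) g\<close>; in particular \<open>v\<^sub>J = g\<close>\<close>
    define m where "m j i = (\<Prod>k\<in>{j..<J}. 1 + 1/(2^k * L) * l i)" for j i
    define v where "v j = (\<lambda>x. \<Sum>i\<in>I. (a i * m j i) * e i x)" for j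
    have vD: "v j \<in> D" for j unfolding v_def by (rule D_sum[OF fin eD])
    have "avg (\<lambda>x. \<bar>v J x\<bar> powr (2 * q^J)) powr (1/q^J) \<le> moser_const q * T powr (q/(q-1)) * avg (\<lambda>x. (v 0 x)\<^sup>2)"
    proof (rule moser_iteration[OF T L T_def[symmetric] vD])
      fix \<phi> j assume j: "j < J" and p: "\<phi> \<in> D"
      let ?s = "1/(2^j * L)"
      let ?h = "\<lambda>x. \<Sum>i\<in>I. (l i * (a i * m (Suc j) i)) * e i x"
      have hD: "?h \<in> D" by (rule D_sum[OF fin eD])
      have mj: "m j i = (1 + ?s * l i) * m (Suc j) i" for i
        unfolding m_def using prod.atLeast_Suc_lessThan[OF j, of "\<lambda>k. 1 + 1/(2^k * L) * l i"] by simp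
      have "avg (\<lambda>x. \<phi> x * v (Suc j) x) + ?s * avg (\<Gamma> \<phi> (v (Suc j))) =
        avg (\<lambda>x. \<phi> x * v (Suc j) x) + ?s * avg (\<lambda>x. \<phi> x * ?h x)"
        by (subst (2) v_def, subst avg_\<Gamma>_sum[OF fin e p]) auto
      also have "\<dots> = avg (\<lambda>x. \<phi> x * v (Suc j) x + ?s * (\<phi> x * ?h x))"
        unfolding avg_cmult[symmetric, of ?s]
        by (rule avg_add[symmetric])
           (intro continuous_on_mult continuous_on_mult_left cont p vD hD)+
      also have "\<dots> = avg (\<lambda>x. \<phi> x * v j x)"
      proof (rule arg_cong[where f = avg], rule ext)
        fix x
        have "v j x = v (Suc j) x + ?s * ?h x"
          unfolding v_def mj sum_distrib_left sum.distrib[symmetric]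
          by (intro sum.cong refl) (simp add: algebra_simps)
        then show "\<phi> x * v (Suc j) x + ?s * (\<phi> x * ?h x) = \<phi> x * v j x" by (simp add: algebra_simps)
      qed
      finally show "avg (\<lambda>x. \<phi> x * v (Suc j) x) + ?s * avg (\<Gamma> \<phi> (v (Suc j))) = avg (\<lambda>x. \<phi> x * v j x)" .
    qed
    also have "avg (\<lambda>x. (v 0 x)\<^sup>2) = (\<Sum>i\<in>I. (a i * m 0 i)\<^sup>2)"
      unfolding v_def by (rule avg_square_sum[OF fin eD on])
    also have "moser_const q * T powr (q/(q-1)) * (\<Sum>i\<in>I. (a i * m 0 i)\<^sup>2) \<le>
        moser_const q * T powr (q/(q-1)) * (\<Sum>i\<in>I. exp 4 * (a i)\<^sup>2)"
    proof (rule mult_left_mono[OF sum_mono])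
      fix i assume i: "i \<in> I"
      have "m 0 i \<le> exp (\<Sum>k\<in>{0..<J}. 1/(2^k * L) * l i)"
        unfolding m_def by (rule Pi_one_plus_le_exp) (use l i L in auto)
      also have "(\<Sum>k\<in>{0..<J}. 1/(2^k * L) * l i) \<le> (\<Sum>k\<in>{0..<J}. (1/2)^k)"
        using l i L by (intro sum_mono) (auto simp: field_simps)
      also have "\<dots> \<le> (\<Sum>k. (1/2)^k)"
        by (intro sum_le_suminf summable_geometric) auto
      also have "\<dots> = (2::real)" using suminf_geometric[of "1/2::real"] by simp
      finally have "m 0 i \<le> exp 2" by simp
      moreover have "m 0 i \<ge> 0" unfolding m_def by (intro prod_nonneg) (use l i L in auto)
      ultimately have "(m 0 i)\<^sup>2 \<le> (exp 2)\<^sup>2" by (intro power_mono) auto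
      also have "(exp 2)\<^sup>2 = exp (4::real)" by (simp flip: exp_double)
      finally show "(a i * m 0 i)\<^sup>2 \<le> exp 4 * (a i)\<^sup>2"
        by (simp add: power_mult_distrib mult.commute[of "(a i)\<^sup>2"] mult_right_mono)
    qed (use mc in simp)
    also have "v J = (\<lambda>x. \<Sum>i\<in>I. a i * e i x)" by (simp add: v_def m_def)
    finally show "avg (\<lambda>x. \<bar>\<Sum>i\<in>I. a i * e i x\<bar> powr (2 * q^J)) powr (1/q^J) \<le> C * (\<Sum>i\<in>I. (a i)\<^sup>2)"
      by (simp add: C_def sum_distrib_left[symmetric] mult_ac)
  qed
  \<comment> \<open>the sup estimate for the function \<open>(\<Sum>i. e\<^sub>i(x) e\<^sub>i)\<close>, evaluated at \<open>x\<close> itself\<close>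
  have "(\<Sum>i\<in>I. (e i x)\<^sup>2) \<le> C" for x
  proof -
    define r where "r = (\<Sum>i\<in>I. (e i x)\<^sup>2)"
    have "r\<^sup>2 \<le> C * r" using sup[of "\<lambda>i. e i x" x] by (simp add: r_def power2_eq_square)
    moreover have "r \<ge> 0" unfolding r_def by (rule sum_nonneg) simp
    moreover have "C \<ge> 0" using mc by (simp add: C_def)
    ultimately show ?thesis unfolding r_def[symmetric]
      by (cases "r = 0") (auto simp: power2_eq_square)
  qed
  then have "avg (\<lambda>x. \<Sum>i\<in>I. (e i x)\<^sup>2) \<le> avg (\<lambda>x. C)"
    using cont[OF eD] by (intro avg_mono) (auto intro!: continuous_intros)
  moreover have "avg (\<lambda>x. \<Sum>i\<in>I. (e i x)\<^sup>2) = (\<Sum>i\<in>I. avg (\<lambda>x. (e i x)\<^sup>2))"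
    using cont[OF eD] by (intro avg_sum) (auto intro!: continuous_intros)
  moreover have "\<dots> = real (card I)"
    using on by (simp add: orthonormal_def power2_eq_square)
  ultimately show ?thesis by (simp add: C_def T_def)
qed

end

section \<open>Orthonormal systems of eigenfunctions\<close>

context dirichlet_form
begin

text \<open>Nonempty open sets have positive measure, so the inner product is definite on continuous functions.\<close>

lemma avg_square_eq_0:
  assumes u: "u \<in> D" and z: "avg (\<lambda>x. u x * u x) = 0" shows "u x = 0"
proof (rule ccontr)
  assume "u x \<noteq> 0"
  define b where "b = (u x)\<^sup>2 / 2"
  have b: "b > 0" "b < (u x)\<^sup>2" using \<open>u x \<noteq> 0\<close> by (auto simp: b_def)
  define U where "U = {y. b < (u y)\<^sup>2}"
  have U: "open U" "x \<in> U" unfolding U_def using b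
    by (auto intro!: open_Collect_less continuous_intros cont[OF u])
  have "b * (measure M U / measure M UNIV) \<le> avg (\<lambda>x. (u x)\<^sup>2)"
    by (rule avg_le_sup_open[OF _ _ U(1)]) (use b in \<open>auto simp: U_def intro!: continuous_intros cont[OF u]\<close>)
  moreover have "emeasure M U > 0" using emeasure_open_pos[OF U(1)] U(2) by auto
  then have "measure M U > 0" by (simp add: emeasure_eq_measure)
  then have "b * (measure M U / measure M UNIV) > 0" using b(1) vol_pos by (intro mult_pos_pos divide_pos_pos)
  moreover have "avg (\<lambda>x. (u x)\<^sup>2) = 0" using z by (simp add: power2_eq_square)
  ultimately show False by linarith
qed

lemma subspace_D: "fun_vs.subspace D"
proof (rule fun_vs.subspaceI)
  show "0 \<in> D" using const[of 0] by (simp add: zero_fun_def)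
  show "u + v \<in> D" if "u \<in> D" "v \<in> D" for u v
    using lincomb[OF that, of 1 1] by (simp add: plus_fun_def)
  show "(\<lambda>x. c * u x) \<in> D" if "u \<in> D" for c u
    using lincomb[OF that that, of c 0] by simp
qed

lemma span_sum_scaled:
  assumes "\<And>i. i \<in> I \<Longrightarrow> e i \<in> fun_vs.span B"
  shows "(\<lambda>x. \<Sum>i\<in>I. c i * e i x) \<in> fun_vs.span B"
  using assms
proof (induction I rule: infinite_finite_induct)
  case (insert i I)
  have "(\<lambda>x. c i * e i x) + (\<lambda>x. \<Sum>i\<in>I. c i * e i x) \<in> fun_vs.span B"
    using insert by (intro fun_vs.span_add fun_vs.span_scale) auto
  then show ?case using insert.hyps by (simp add: plus_fun_def)
qed (use fun_vs.span_zero in \<open>auto simp: zero_fun_def\<close>)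

lemma gram_schmidt:
  assumes "finite B" "fun_vs.independent B" "B \<subseteq> D"
  shows "\<exists>e :: nat \<Rightarrow> 'a \<Rightarrow> real. (\<forall>i<card B. e i \<in> fun_vs.span B) \<and>
     (\<forall>i<card B. \<forall>j<card B. avg (\<lambda>x. e i x * e j x) = (if i = j then 1 else 0))"
  using assms
proof (induction B rule: finite_induct)
  case empty then show ?case by simp
next
  case (insert b B)
  define m where "m = card B"
  have indB: "fun_vs.independent B" and bB: "b \<notin> fun_vs.span B"
    using insert.prems(1) insert.hyps(2) by (auto simp: fun_vs.independent_insert)
  obtain e where e': "\<forall>i<m. e i \<in> fun_vs.span B"
    "\<forall>i<m. \<forall>j<m. avg (\<lambda>x. e i x * e j x) = (if i = j then 1 else 0)"
    using insert.IH[OF indB] insert.prems(2) unfolding m_def by blast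
  have e: "\<And>i. i < m \<Longrightarrow> e i \<in> fun_vs.span B"
    "\<And>i j. i < m \<Longrightarrow> j < m \<Longrightarrow> avg (\<lambda>x. e i x * e j x) = (if i = j then 1 else 0)"
    using e' by blast+
  have spanD: "fun_vs.span B \<subseteq> D"
    by (rule fun_vs.span_minimal[OF _ subspace_D]) (use insert.prems(2) in auto)
  have eD: "e i \<in> D" if "i < m" for i using e(1)[OF that] spanD by auto
  have bD: "b \<in> D" using insert.prems(2) by auto
  define a where "a i = avg (\<lambda>x. b x * e i x)" for i
  define p where "p = (\<lambda>x. \<Sum>i<m. a i * e i x)"
  define w where "w = (\<lambda>x. b x - p x)"
  have pS: "p \<in> fun_vs.span B" unfolding p_def by (rule span_sum_scaled) (use e(1) in auto)
  have pD: "p \<in> D" using pS spanD by auto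
  have wD: "w \<in> D" using lincomb[OF bD pD, of 1 "-1"] by (simp add: w_def)
  have we: "avg (\<lambda>x. w x * e j x) = 0" if j: "j < m" for j
  proof -
    have "avg (\<lambda>x. p x * e j x) = avg (\<lambda>x. \<Sum>i<m. a i * (e i x * e j x))"
      by (simp add: p_def sum_distrib_right mult.assoc)
    also have "\<dots> = (\<Sum>i<m. a i * avg (\<lambda>x. e i x * e j x))"
      by (subst avg_sum) (auto intro!: continuous_intros cont[OF eD] cont[OF eD[OF j]] simp: avg_cmult)
    also have "\<dots> = (\<Sum>i<m. if i = j then a j else 0)"
      by (intro sum.cong refl) (use e(2) j in auto)
    also have "\<dots> = a j" using j by simp
    finally have "avg (\<lambda>x. p x * e j x) = a j" .
    moreover have "avg (\<lambda>x. w x * e j x) = avg (\<lambda>x. b x * e j x - p x * e j x)"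
      by (simp add: w_def left_diff_distrib)
    moreover have "\<dots> = avg (\<lambda>x. b x * e j x) - avg (\<lambda>x. p x * e j x)"
      by (rule avg_diff) (intro continuous_intros cont bD pD eD[OF j])+
    ultimately show ?thesis by (simp add: a_def)
  qed
  define n where "n = avg (\<lambda>x. w x * w x)"
  have "n \<noteq> 0"
  proof
    assume "n = 0"
    then have z: "avg (\<lambda>x. w x * w x) = 0" unfolding n_def .
    have "b x = p x" for x using avg_square_eq_0[OF wD z, of x] by (simp add: w_def)
    then have "b = p" by (rule ext)
    with bB pS show False by metis
  qed
  moreover have "n \<ge> 0" unfolding n_def by (rule avg_nonneg) simp
  ultimately have n: "n > 0" by simp
  define f where "f i = (if i < m then e i else (\<lambda>x. inverse (sqrt n) * w x))" for i
  have wS: "w \<in> fun_vs.span (insert b B)"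
  proof -
    have "b - p \<in> fun_vs.span (insert b B)"
    proof (rule fun_vs.span_diff)
      show "b \<in> fun_vs.span (insert b B)" by (rule fun_vs.span_base) simp
      show "p \<in> fun_vs.span (insert b B)" using pS fun_vs.span_mono[of B "insert b B"] by blast
    qed
    then show ?thesis by (simp add: w_def fun_diff_def)
  qed
  have card: "card (insert b B) = Suc m" using insert.hyps by (simp add: m_def)
  have "f i \<in> fun_vs.span (insert b B)" if "i < Suc m" for i
  proof (cases "i < m")
    case True
    then show ?thesis using e(1)[OF True] fun_vs.span_mono[of B "insert b B"] by (auto simp: f_def)
  next
    case False
    then show ?thesis unfolding f_def using fun_vs.span_scale[OF wS] by simp
  qed
  moreover have "avg (\<lambda>x. f i x * f j x) = (if i = j then 1 else 0)" if ij: "i < Suc m" "j < Suc m" for i j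
  proof -
    consider "i < m" "j < m" | "i < m" "j = m" | "i = m" "j < m" | "i = m" "j = m" using ij unfolding less_Suc_eq by blast
    then show ?thesis
    proof cases
      case 1 then show ?thesis using e(2) by (simp add: f_def)
    next
      case 2
      then have "avg (\<lambda>x. f i x * f j x) = avg (\<lambda>x. inverse (sqrt n) * (w x * e i x))" by (simp add: f_def mult_ac)
      then show ?thesis using 2 we by (simp add: avg_cmult)
    next
      case 3
      then have "avg (\<lambda>x. f i x * f j x) = avg (\<lambda>x. inverse (sqrt n) * (w x * e j x))" by (simp add: f_def mult_ac)
      then show ?thesis using 3 we by (simp add: avg_cmult)
    next
      case 4
      then have "avg (\<lambda>x. f i x * f j x) = avg (\<lambda>x. (inverse (sqrt n) * inverse (sqrt n)) * (w x * w x))" by (simp add: f_def mult_ac)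
      also have "\<dots> = (inverse (sqrt n) * inverse (sqrt n)) * n" by (simp only: avg_cmult n_def)
      also have "\<dots> = 1" using n by (simp add: field_simps)
      finally show ?thesis using 4 by simp
    qed
  qed
  ultimately show ?case unfolding card by blast
qed

lemma weak_eigen_orthogonal:
  assumes "weak_eigen l e" "weak_eigen l' e'" "l \<noteq> l'"
  shows "avg (\<lambda>x. e x * e' x) = 0"
proof -
  have D: "e \<in> D" "e' \<in> D" using assms by (auto simp: weak_eigen_iff)
  have "l' * avg (\<lambda>x. e x * e' x) = avg (\<Gamma> e e')" using assms(2) D by (simp add: weak_eigen_iff)
  also have "\<Gamma> e e' = \<Gamma> e' e" using \<Gamma>_sym[OF D] by (simp add: fun_eq_iff)
  also have "avg \<dots> = l * avg (\<lambda>x. e' x * e x)" using assms(1) D by (simp add: weak_eigen_iff)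
  also have "(\<lambda>x. e' x * e x) = (\<lambda>x. e x * e' x)" by (simp add: mult.commute)
  finally show ?thesis using assms(3) by simp
qed

text \<open>All eigenspaces for the values \<open>lam 0, \<dots>, lam k\<close> are used completely, which gives at least \<open>k + 1\<close>
  functions and avoids choosing among equal eigenvalues.  Within an eigenspace orthogonality is obtained by orthonormalization, between different
  ones it is automatic.  The index set consists of pairs of an eigenvalue and a number.\<close>

lemma orthonormal_eigenfunctions:
  fixes lam :: "nat \<Rightarrow> real"
  assumes inc: "incseq lam"
    and spec: "\<And>\<mu>. finite {k. lam k = \<mu>} \<and> (\<exists>B. finite B \<and> fun_vs.independent B \<and> fun_vs.span B = E \<mu> \<and> card B = card {k. lam k = \<mu>})"
    and E: "\<And>\<mu> u. u \<in> E \<mu> \<Longrightarrow> weak_eigen \<mu> u"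
  obtains I :: "(real \<times> nat) set" and e where "finite I" "k + 1 \<le> card I" "orthonormal I e"
    "\<And>i. i \<in> I \<Longrightarrow> weak_eigen (fst i) (e i)" "\<And>i. i \<in> I \<Longrightarrow> 0 \<le> fst i" "\<And>i. i \<in> I \<Longrightarrow> fst i \<le> lam k" "(lam k, 0) \<in> I"
proof -
  define N where "N \<mu> = card {k. lam k = \<mu>}" for \<mu>
  have "\<exists>f :: nat \<Rightarrow> 'a \<Rightarrow> real. (\<forall>i<N \<mu>. f i \<in> E \<mu>) \<and> (\<forall>i<N \<mu>. \<forall>j<N \<mu>. avg (\<lambda>x. f i x * f j x) = (if i = j then 1 else 0))" for \<mu>
  proof -
    obtain B where B: "finite B" "fun_vs.independent B" "fun_vs.span B = E \<mu>" "card B = N \<mu>"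
      using spec[of \<mu>] unfolding N_def by blast
    have "B \<subseteq> D" using fun_vs.span_superset[of B] B(3) E by (auto simp: weak_eigen_def)
    from gram_schmidt[OF B(1,2) this] show ?thesis unfolding B(3,4) .
  qed
  then obtain f :: "real \<Rightarrow> nat \<Rightarrow> 'a \<Rightarrow> real" where f: "\<And>\<mu> i. i < N \<mu> \<Longrightarrow> f \<mu> i \<in> E \<mu>"
    "\<And>\<mu> i j. i < N \<mu> \<Longrightarrow> j < N \<mu> \<Longrightarrow> avg (\<lambda>x. f \<mu> i x * f \<mu> j x) = (if i = j then 1 else 0)"
    by metis
  define I where "I = (SIGMA \<mu>:lam ` {..k}. {..<N \<mu>})"
  define e where "e i = f (fst i) (snd i)" for i
  have N0: "N (lam j) > 0" for j
    unfolding N_def using spec[of "lam j"] by (auto simp: card_gt_0_iff)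
  have we: "weak_eigen (fst i) (e i)" if "i \<in> I" for i
    using that f(1) E by (auto simp: I_def e_def)
  have on: "orthonormal I e"
    unfolding orthonormal_def
  proof (intro ballI)
    fix i j assume ij: "i \<in> I" "j \<in> I"
    show "avg (\<lambda>x. e i x * e j x) = (if i = j then 1 else 0)"
    proof (cases "fst i = fst j")
      case True
      then show ?thesis using f(2)[of "snd i" "fst i" "snd j"] ij by (auto simp: I_def e_def prod_eq_iff)
    next
      case False
      then show ?thesis using weak_eigen_orthogonal[OF we[OF ij(1)] we[OF ij(2)]] by auto
    qed
  qed
  show ?thesis
  proof (rule that[of I e])
    show "finite I" by (simp add: I_def)
    show "k + 1 \<le> card I"
    proof -
      have "card I = (\<Sum>\<mu>\<in>lam ` {..k}. N \<mu>)" unfolding I_def by simp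
      also have "\<dots> = card (\<Union>\<mu>\<in>lam ` {..k}. {j. lam j = \<mu>})"
        unfolding N_def by (rule card_UN_disjoint[symmetric]) (use spec in auto)
      also have "\<dots> \<ge> card {..k}"
        by (rule card_mono) (use spec in auto)
      finally show ?thesis by simp
    qed
    show "0 \<le> fst i" if i: "i \<in> I" for i
    proof -
      have eD: "e i \<in> D" using we[OF i] by (simp add: weak_eigen_def)
      have "0 \<le> avg (\<Gamma> (e i) (e i))" by (rule avg_nonneg[OF \<Gamma>_nonneg[OF eD]])
      also have "\<dots> = fst i * avg (\<lambda>x. e i x * e i x)" using we[OF i] eD by (simp add: weak_eigen_iff)
      also have "avg (\<lambda>x. e i x * e i x) = 1" using on i by (simp add: orthonormal_def)
      finally show ?thesis by simp
    qed
    show "fst i \<le> lam k" if "i \<in> I" for i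
      using that inc by (auto simp: I_def dest: incseqD)
    show "(lam k, 0) \<in> I" using N0[of k] by (auto simp: I_def)
  qed (use we on in auto)
qed

end

section \<open>Continuously differentiable functions on open sets\<close>

text \<open>For open \<open>S\<close>.  The second condition is continuity of the derivative in each fixed direction, which in
  finite dimension is continuity in operator norm.\<close>

definition C1_on :: "'e::euclidean_space set \<Rightarrow> ('e \<Rightarrow> 'f::real_normed_vector) \<Rightarrow> bool" where
  "C1_on S f \<longleftrightarrow> (\<exists>f'. (\<forall>z\<in>S. (f has_derivative f' z) (at z)) \<and> (\<forall>v. continuous_on S (\<lambda>z. f' z v)))"

abbreviation fd :: "('e::real_normed_vector \<Rightarrow> 'f::real_normed_vector) \<Rightarrow> 'e \<Rightarrow> 'e \<Rightarrow> 'f" where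
  "fd f z \<equiv> frechet_derivative f (at z)"

lemma C1_onI: "(\<And>z. z \<in> S \<Longrightarrow> (f has_derivative f' z) (at z)) \<Longrightarrow> (\<And>v. continuous_on S (\<lambda>z. f' z v)) \<Longrightarrow> C1_on S f"
  unfolding C1_on_def by blast

lemma C1_onD:
  assumes "C1_on S f"
  shows "z \<in> S \<Longrightarrow> (f has_derivative fd f z) (at z)" and "continuous_on S (\<lambda>z. fd f z v)"
proof -
  obtain f' where f': "\<And>z. z \<in> S \<Longrightarrow> (f has_derivative f' z) (at z)" "\<And>v. continuous_on S (\<lambda>z. f' z v)"
    using assms by (auto simp: C1_on_def)
  have eq: "fd f z = f' z" if "z \<in> S" for z using frechet_derivative_at[OF f'(1)[OF that]] by simp
  show "z \<in> S \<Longrightarrow> (f has_derivative fd f z) (at z)" using f'(1) eq by simp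
  show "continuous_on S (\<lambda>z. fd f z v)" using f'(2)[of v] eq by (simp cong: continuous_on_cong)
qed

lemma C1_on_imp_continuous_on: "C1_on S f \<Longrightarrow> continuous_on S f"
  using C1_onD(1)[of S f] by (meson continuous_at_imp_continuous_on has_derivative_continuous)

lemma C1_on_differentiable: "C1_on S f \<Longrightarrow> z \<in> S \<Longrightarrow> f differentiable at z"
  using C1_onD(1) differentiable_def by blast

lemma C1_on_subset: "C1_on T f \<Longrightarrow> S \<subseteq> T \<Longrightarrow> C1_on S f"
  unfolding C1_on_def using continuous_on_subset by blast

lemma C1_on_cong_open:
  assumes "open S" "\<And>z. z \<in> S \<Longrightarrow> f z = g z" "C1_on S f" shows "C1_on S g"
proof (rule C1_onI[where f' = "fd f"])
  fix z assume "z \<in> S"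
  then show "(g has_derivative fd f z) (at z)"
    using has_derivative_transform_within_open[OF C1_onD(1)[OF assms(3)] assms(1)] assms(2) by blast
qed (rule C1_onD(2)[OF assms(3)])

lemma C1_on_Un:
  assumes "open S" "open T" "C1_on S f" "C1_on T f" shows "C1_on (S \<union> T) f"
proof (rule C1_onI[where f' = "fd f"])
  fix z assume "z \<in> S \<union> T"
  then show "(f has_derivative fd f z) (at z)" using C1_onD(1)[OF assms(3)] C1_onD(1)[OF assms(4)] by blast
qed (rule continuous_on_open_Un[OF assms(1,2) C1_onD(2)[OF assms(3)] C1_onD(2)[OF assms(4)]])

lemma Ck_on_imp_continuous_on: "Ck_on k S f \<Longrightarrow> continuous_on S f"
  by (cases k) (auto intro!: continuous_at_imp_continuous_on differentiable_imp_continuous_within)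

lemma Ck_on_imp_C1_on:
  assumes "Ck_on (Suc k) S f" shows "C1_on S f"
proof (rule C1_onI[where f' = "fd f"])
  have d: "\<And>z. z \<in> S \<Longrightarrow> f differentiable (at z)" and c: "\<And>b. b \<in> Basis \<Longrightarrow> continuous_on S (\<lambda>z. fd f z b)"
    using assms by (simp, intro Ck_on_imp_continuous_on[of k], simp)
  show der: "(f has_derivative fd f z) (at z)" if "z \<in> S" for z
    using d[OF that] by (simp add: frechet_derivative_works)
  fix v
  have "fd f z v = (\<Sum>b\<in>Basis. (v \<bullet> b) *\<^sub>R fd f z b)" if "z \<in> S" for z
  proof -
    have lin: "linear (fd f z)" using der[OF that] has_derivative_linear by blast
    have "fd f z v = fd f z (\<Sum>b\<in>Basis. (v \<bullet> b) *\<^sub>R b)" by (simp add: euclidean_representation)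
    also have "\<dots> = (\<Sum>b\<in>Basis. (v \<bullet> b) *\<^sub>R fd f z b)"
      by (simp add: linear_sum[OF lin] linear_cmul[OF lin])
    finally show ?thesis .
  qed
  moreover have "continuous_on S (\<lambda>z. \<Sum>b\<in>Basis. (v \<bullet> b) *\<^sub>R fd f z b)"
    by (intro continuous_intros c)
  ultimately show "continuous_on S (\<lambda>z. fd f z v)" by (simp cong: continuous_on_cong)
qed

lemma smooth_on_imp_C1_on: "smooth_on S f \<Longrightarrow> C1_on S f"
  by (meson smooth_on_def Ck_on_imp_C1_on)

lemma smooth_on_fd: "smooth_on S f \<Longrightarrow> b \<in> Basis \<Longrightarrow> smooth_on S (\<lambda>z. fd f z b)"
  unfolding smooth_on_def by (metis Ck_on.simps(2))

lemma C1_on_const [simp]: "C1_on S (\<lambda>z. c)"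
  by (rule C1_onI[where f' = "\<lambda>z v. 0"]) auto

lemma C1_on_add: "C1_on S f \<Longrightarrow> C1_on S g \<Longrightarrow> C1_on S (\<lambda>z. f z + g z)"
  by (rule C1_onI[where f' = "\<lambda>z v. fd f z v + fd g z v"])
     (auto intro!: has_derivative_add C1_onD(1) continuous_on_add C1_onD(2))

lemma C1_on_mult:
  fixes f g :: "'e::euclidean_space \<Rightarrow> 'b::real_normed_algebra"
  assumes f: "C1_on S f" and g: "C1_on S g" shows "C1_on S (\<lambda>z. f z * g z)"
proof (rule C1_onI[where f' = "\<lambda>z v. f z * fd g z v + fd f z v * g z"])
  show "((\<lambda>z. f z * g z) has_derivative (\<lambda>v. f z * fd g z v + fd f z v * g z)) (at z)" if "z \<in> S" for z
    by (rule has_derivative_mult[OF C1_onD(1)[OF f that] C1_onD(1)[OF g that]])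
qed (intro continuous_on_add continuous_on_mult C1_onD(2)[OF f] C1_onD(2)[OF g] C1_on_imp_continuous_on[OF f] C1_on_imp_continuous_on[OF g])

lemma C1_on_sum: "(\<And>i. i \<in> I \<Longrightarrow> C1_on S (f i)) \<Longrightarrow> C1_on S (\<lambda>z. \<Sum>i\<in>I. f i z)"
  by (induction I rule: infinite_finite_induct) (auto intro!: C1_on_add)

lemma C1_on_prod:
  fixes f :: "'i \<Rightarrow> 'e::euclidean_space \<Rightarrow> 'b::{real_normed_algebra,comm_ring_1}"
  shows "(\<And>i. i \<in> I \<Longrightarrow> C1_on S (f i)) \<Longrightarrow> C1_on S (\<lambda>z. \<Prod>i\<in>I. f i z)"
  by (induction I rule: infinite_finite_induct) (auto intro!: C1_on_mult)

lemma C1_on_bounded_linear: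
  assumes "bounded_linear h" "C1_on S f" shows "C1_on S (\<lambda>z. h (f z))"
proof (rule C1_onI[where f' = "\<lambda>z v. h (fd f z v)"])
  show "((\<lambda>z. h (f z)) has_derivative (\<lambda>v. h (fd f z v))) (at z)" if "z \<in> S" for z
    by (rule bounded_linear.has_derivative[OF assms(1) C1_onD(1)[OF assms(2) that]])
qed (rule bounded_linear.continuous_on[OF assms(1) C1_onD(2)[OF assms(2)]])

lemma C1_on_compose:
  fixes f :: "'e::euclidean_space \<Rightarrow> 'g::euclidean_space" and h :: "'g \<Rightarrow> 'f::real_normed_vector"
  assumes f: "C1_on S f" and h: "C1_on T h" and sub: "f ` S \<subseteq> T"
  shows "C1_on S (\<lambda>z. h (f z))"
proof (rule C1_onI[where f' = "\<lambda>z v. fd h (f z) (fd f z v)"])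
  fix z assume z: "z \<in> S"
  have "(h has_derivative fd h (f z)) (at (f z))" using C1_onD(1)[OF h] sub z by auto
  from diff_chain_at[OF C1_onD(1)[OF f z] this]
  show "((\<lambda>z. h (f z)) has_derivative (\<lambda>v. fd h (f z) (fd f z v))) (at z)" by (simp add: o_def)
next
  fix v
  have "fd h (f z) (fd f z v) = (\<Sum>b\<in>Basis. (fd f z v \<bullet> b) *\<^sub>R fd h (f z) b)" if "z \<in> S" for z
  proof -
    have lin: "linear (fd h (f z))" using C1_onD(1)[OF h, of "f z"] sub that has_derivative_linear by blast
    have "fd h (f z) (fd f z v) = fd h (f z) (\<Sum>b\<in>Basis. (fd f z v \<bullet> b) *\<^sub>R b)" by (simp add: euclidean_representation)
    also have "\<dots> = (\<Sum>b\<in>Basis. (fd f z v \<bullet> b) *\<^sub>R fd h (f z) b)"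
      by (simp add: linear_sum[OF lin] linear_cmul[OF lin])
    finally show ?thesis .
  qed
  moreover have "continuous_on S (\<lambda>z. \<Sum>b\<in>Basis. (fd f z v \<bullet> b) *\<^sub>R fd h (f z) b)"
    by (intro continuous_intros C1_onD(2)[OF f] continuous_on_compose2[OF C1_onD(2)[OF h] C1_on_imp_continuous_on[OF f]] sub)
  ultimately show "continuous_on S (\<lambda>z. fd h (f z) (fd f z v))" by (simp cong: continuous_on_cong)
qed

lemma C1_on_real_chain:
  assumes f: "C1_on S f" and h: "\<And>s. (h has_real_derivative h' s) (at s)" and c: "continuous_on UNIV h'"
  shows "C1_on S (\<lambda>z. h (f z))"
proof (rule C1_on_compose[OF f, of UNIV])
  show "C1_on UNIV h"
    by (rule C1_onI[where f' = "\<lambda>z v. h' z * v"])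
       (use h c in \<open>auto simp: has_field_derivative_def intro!: continuous_intros\<close>)
qed auto

lemma C1_on_inverse:
  fixes f :: "'e::euclidean_space \<Rightarrow> 'b::real_normed_field"
  assumes f: "C1_on S f" and nz: "\<And>z. z \<in> S \<Longrightarrow> f z \<noteq> 0"
  shows "C1_on S (\<lambda>z. inverse (f z))"
proof (rule C1_onI[where f' = "\<lambda>z v. - (inverse (f z) * fd f z v * inverse (f z))"])
  show "((\<lambda>z. inverse (f z)) has_derivative (\<lambda>v. - (inverse (f z) * fd f z v * inverse (f z)))) (at z)" if "z \<in> S" for z
    by (rule Deriv.has_derivative_inverse[OF nz[OF that] C1_onD(1)[OF f that]])
qed (use nz in \<open>auto intro!: C1_onD(2)[OF f] continuous_intros C1_on_imp_continuous_on[OF f]\<close>)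

lemma integral_translate:
  fixes g :: "'e::euclidean_space \<Rightarrow> 'b::{banach,second_countable_topology}"
  assumes "g \<in> borel_measurable borel"
  shows "(\<integral>z. g (z + a) \<partial>lborel) = (\<integral>z. g z \<partial>lborel)"
proof -
  have "(\<integral>z. g z \<partial>lborel) = (\<integral>z. g z \<partial>(distr lborel borel ((+) a)))" by (simp add: lborel_distr_plus)
  also have "\<dots> = (\<integral>z. g (a + z) \<partial>lborel)" using assms by (intro integral_distr) auto
  finally show ?thesis by (simp add: add.commute)
qed

text \<open>By translation invariance the integral of every difference quotient of \<open>g\<close> vanishes, and the difference
  quotients converge boundedly with supports in a fixed compact set.\<close>

lemma integral_directional_derivative_0:
  fixes g :: "'e::euclidean_space \<Rightarrow> 'b::{banach,second_countable_topology}"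
  assumes g: "C1_on UNIV g" and K: "compact K" "\<And>z. z \<notin> K \<Longrightarrow> g z = 0"
  shows "(\<integral>z. fd g z v \<partial>lborel) = 0"
proof -
  have der: "(g has_derivative fd g z) (at z)" for z using C1_onD(1)[OF g] by simp
  have cg: "continuous_on UNIV g" by (rule C1_on_imp_continuous_on[OF g])
  have cd: "continuous_on UNIV (\<lambda>z. fd g z v)" by (rule C1_onD(2)[OF g])
  have d0: "fd g z = (\<lambda>v. 0)" if "z \<notin> K" for z
  proof -
    have "((\<lambda>z. 0) has_derivative (\<lambda>v. 0)) (at z)" by simp
    then have "(g has_derivative (\<lambda>v. 0)) (at z)"
      by (rule has_derivative_transform_within_open[of _ _ _ _ "- K"])
         (use K that compact_imp_closed in auto)
    then show ?thesis by (rule frechet_derivative_at[symmetric])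
  qed
  have "compact ((\<lambda>z. fd g z v) ` K)" by (rule compact_continuous_image[OF continuous_on_subset[OF cd]]) (use K in auto)
  then obtain B where B: "\<And>z. z \<in> K \<Longrightarrow> norm (fd g z v) \<le> B"
    using compact_imp_bounded by (force simp: bounded_iff)
  define B' where "B' = max B 0"
  have B': "norm (fd g z v) \<le> B'" for z using B[of z] d0[of z] by (cases "z \<in> K") (auto simp: B'_def)
  \<comment> \<open>contains the supports of all difference quotients with increments up to 1\<close>
  define K' where "K' = (\<lambda>(z,t). z - t *\<^sub>R v) ` (K \<times> {0..1::real})"
  have K': "compact K'" unfolding K'_def
    by (rule compact_continuous_image) (auto intro!: compact_Times K continuous_intros simp: case_prod_unfold)
  define h where "h n = 1 / real (Suc n)" for n
  have h: "h n > 0" "h n \<le> 1" for n by (auto simp: h_def)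
  have h0: "h \<longlonglongrightarrow> 0" unfolding h_def using LIMSEQ_inverse_real_of_nat by (simp add: inverse_eq_divide)
  define q where "q n z = (1 / h n) *\<^sub>R (g (z + h n *\<^sub>R v) - g z)" for n z
  have line: "((\<lambda>t. g (z + t *\<^sub>R v)) has_derivative (\<lambda>r. r *\<^sub>R fd g (z + t *\<^sub>R v) v)) (at t within A)" for z t A
  proof -
    have "((\<lambda>t. z + t *\<^sub>R v) has_derivative (\<lambda>r. r *\<^sub>R v)) (at t)" by (auto intro!: derivative_eq_intros)
    from diff_chain_at[OF this der] have "((\<lambda>t. g (z + t *\<^sub>R v)) has_derivative (\<lambda>r. fd g (z + t *\<^sub>R v) (r *\<^sub>R v))) (at t)"
      by (simp add: o_def)
    then show ?thesis using linear_cmul[OF has_derivative_linear[OF der]] by (simp add: has_derivative_at_withinI)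
  qed
  have bd: "norm (q n z) \<le> B'" for n z
  proof -
    have "norm (g (z + h n *\<^sub>R v) - g (z + 0 *\<^sub>R v)) \<le> B' * norm (h n - 0)"
    proof (rule differentiable_bound[of "{0..h n}", OF _ line])
      fix t show "onorm (\<lambda>r. r *\<^sub>R fd g (z + t *\<^sub>R v) v) \<le> B'"
      proof (rule onorm_le)
        fix r show "norm (r *\<^sub>R fd g (z + t *\<^sub>R v) v) \<le> B' * norm r"
          using mult_right_mono[OF B', of "\<bar>r\<bar>"] by (simp add: mult.commute)
      qed
    qed (use h in \<open>auto simp: less_imp_le\<close>)
    then have "norm (g (z + h n *\<^sub>R v) - g z) / h n \<le> B'" using h(1)[of n] by (simp add: divide_le_eq)
    moreover have "norm (q n z) = norm (g (z + h n *\<^sub>R v) - g z) / h n" using h(1)[of n] by (simp add: q_def)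
    ultimately show ?thesis by simp
  qed
  have supp: "q n z = 0" if "z \<notin> K'" for n z
  proof -
    have "z \<notin> K"
    proof
      assume "z \<in> K" then have "z - 0 *\<^sub>R v \<in> K'" unfolding K'_def by force
      with that show False by simp
    qed
    moreover have "z + h n *\<^sub>R v \<notin> K"
    proof
      assume "z + h n *\<^sub>R v \<in> K" then have "(z + h n *\<^sub>R v) - h n *\<^sub>R v \<in> K'" unfolding K'_def using h(1,2)[of n]
        by (intro image_eqI[of _ _ "(z + h n *\<^sub>R v, h n)"]) auto
      with that show False by simp
    qed
    ultimately show ?thesis using K(2) by (simp add: q_def)
  qed
  have lim: "(\<lambda>n. q n z) \<longlonglongrightarrow> fd g z v" for z
  proof -
    have "((\<lambda>t. norm (g (z + t *\<^sub>R v) - g z - t *\<^sub>R fd g z v) / norm t) \<longlongrightarrow> 0) (at 0)"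
      using line[of z 0 UNIV] unfolding has_derivative_at by simp
    moreover have "filterlim h (at 0) sequentially"
      using h0 h by (auto simp: filterlim_at less_imp_neq[symmetric])
    ultimately have "(\<lambda>n. norm (g (z + h n *\<^sub>R v) - g z - h n *\<^sub>R fd g z v) / norm (h n)) \<longlonglongrightarrow> 0"
      by (rule filterlim_compose)
    also have "(\<lambda>n. norm (g (z + h n *\<^sub>R v) - g z - h n *\<^sub>R fd g z v) / norm (h n)) = (\<lambda>n. norm (q n z - fd g z v))"
    proof
      fix n
      have "g (z + h n *\<^sub>R v) - g z - h n *\<^sub>R fd g z v = h n *\<^sub>R (q n z - fd g z v)"
        using h(1)[of n] by (simp add: q_def scaleR_diff_right)
      then show "norm (g (z + h n *\<^sub>R v) - g z - h n *\<^sub>R fd g z v) / norm (h n) = norm (q n z - fd g z v)"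
        using h(1)[of n] by simp
    qed
    finally show ?thesis by (simp add: LIM_zero_iff tendsto_norm_zero_iff)
  qed
  have meas: "q n \<in> borel_measurable lborel" for n
  proof -
    have "continuous_on UNIV (\<lambda>z. g (z + h n *\<^sub>R v))"
      by (rule continuous_on_compose2[OF cg]) (auto intro!: continuous_intros)
    then have "continuous_on UNIV (q n)" unfolding q_def by (intro continuous_intros cg)
    then show ?thesis by (simp add: borel_measurable_continuous_onI)
  qed
  have "(\<lambda>n. \<integral>z. q n z \<partial>lborel) \<longlonglongrightarrow> (\<integral>z. fd g z v \<partial>lborel)"
  proof (rule integral_dominated_convergence[where w = "\<lambda>z. indicator K' z *\<^sub>R B'"])
    show "(\<lambda>z. fd g z v) \<in> borel_measurable lborel" using cd by (auto intro: borel_measurable_continuous_onI)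
    show "integrable lborel (\<lambda>z. indicator K' z *\<^sub>R B')" by (rule borel_integrable_compact[OF K']) auto
    show "AE z in lborel. norm (q n z) \<le> indicator K' z *\<^sub>R B'" for n
      using bd[of n] supp[of _ n] by (auto simp: indicator_def)
  qed (use meas lim in auto)
  moreover have "(\<integral>z. q n z \<partial>lborel) = 0" for n
  proof -
    have gi: "integrable lborel g"
    proof -
      have "integrable lborel (\<lambda>z. indicator K z *\<^sub>R g z)" by (rule borel_integrable_compact[OF K(1) continuous_on_subset[OF cg]]) auto
      moreover have "(\<lambda>z. indicator K z *\<^sub>R g z) = g" using K(2) by (auto simp: indicator_def fun_eq_iff)
      ultimately show ?thesis by simp
    qed
    have gm: "g \<in> borel_measurable borel" using cg by (rule borel_measurable_continuous_onI)
    have gi': "integrable lborel (\<lambda>z. g (z + h n *\<^sub>R v))"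
      using integrable_distr[of "(+) (h n *\<^sub>R v)" lborel borel g] gi by (simp add: lborel_distr_plus add.commute)
    show ?thesis unfolding q_def using gi gi' integral_translate[OF gm] by simp
  qed
  ultimately show ?thesis by (simp add: LIMSEQ_const_iff)
qed

section \<open>The derivative of the determinant\<close>

text \<open>In the Leibniz formula a permutation other than the identity moves at least two indices, so that after
  differentiating one factor another factor is an off-diagonal entry of the identity matrix.\<close>

lemma has_derivative_det_at_id:
  fixes N :: "'e::real_normed_vector \<Rightarrow> 'a::real_normed_field^'n^'n"
  assumes N: "\<And>i j. ((\<lambda>z. N z $ i $ j) has_derivative (\<lambda>v. N' v $ i $ j)) (at z within S)" and id: "N z = mat 1"
  shows "((\<lambda>z. det (N z)) has_derivative (\<lambda>v. trace (N' v))) (at z within S)"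
proof -
  have "((\<lambda>z. det (N z)) has_derivative (\<lambda>v. \<Sum>p | p permutes (UNIV::'n set). of_int (sign p) *
     (\<Sum>i\<in>UNIV. N' v $ i $ p i * (\<Prod>j\<in>UNIV - {i}. N z $ j $ p j)))) (at z within S)"
    unfolding det_def by (intro has_derivative_sum has_derivative_mult_right has_derivative_prod N)
  also have "(\<lambda>v. \<Sum>p | p permutes (UNIV::'n set). of_int (sign p) *
     (\<Sum>i\<in>UNIV. N' v $ i $ p i * (\<Prod>j\<in>UNIV - {i}. N z $ j $ p j))) = (\<lambda>v. trace (N' v))"
  proof
    fix v
    have "(\<Sum>p | p permutes (UNIV::'n set). of_int (sign p) * (\<Sum>i\<in>UNIV. N' v $ i $ p i * (\<Prod>j\<in>UNIV - {i}. N z $ j $ p j)))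
       = (\<Sum>p | p permutes (UNIV::'n set). if p = id then trace (N' v) else 0)"
    proof (intro sum.cong refl)
      fix p assume p: "p \<in> {p. p permutes (UNIV::'n set)}"
      show "of_int (sign p) * (\<Sum>i\<in>UNIV. N' v $ i $ p i * (\<Prod>j\<in>UNIV - {i}. N z $ j $ p j)) = (if p = id then trace (N' v) else 0)"
      proof (cases "p = id")
        case True then show ?thesis by (simp add: id mat_def trace_def sign_id)
      next
        case False
        then obtain a where a: "p a \<noteq> a" by (auto simp: fun_eq_iff)
        have pa: "p (p a) \<noteq> p a" using p a permutes_inj[of p UNIV] by (auto dest: injD)
        have "(\<Prod>j\<in>UNIV - {i}. N z $ j $ p j) = 0" for i
        proof (cases "i = a")
          case True
          then show ?thesis using a pa by (intro prod_zero) (auto simp: id mat_def intro!: bexI[of _ "p a"])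
        next
          case False
          then show ?thesis using a by (intro prod_zero) (auto simp: id mat_def intro!: bexI[of _ "a"])
        qed
        then show ?thesis using False by (simp only: mult_zero_right sum.neutral_const if_False)
      qed
    qed
    also have "\<dots> = trace (N' v)" by (simp add: permutes_id finite_permutations)
    finally show "(\<Sum>p | p permutes (UNIV::'n set). of_int (sign p) * (\<Sum>i\<in>UNIV. N' v $ i $ p i * (\<Prod>j\<in>UNIV - {i}. N z $ j $ p j))) = trace (N' v)" .
  qed
  finally show ?thesis .
qed

text \<open>Jacobi's formula, reduced to the identity matrix by \<open>G w = G z ** (M ** G w)\<close>.\<close>

lemma has_derivative_det:
  fixes G :: "'e::real_normed_vector \<Rightarrow> 'a::real_normed_field^'n^'n"
  assumes G: "\<And>i j. ((\<lambda>z. G z $ i $ j) has_derivative (\<lambda>v. G' v $ i $ j)) (at z within S)" and inv: "M ** G z = mat 1"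
  shows "((\<lambda>z. det (G z)) has_derivative (\<lambda>v. det (G z) * trace (M ** G' v))) (at z within S)"
proof -
  have inv': "G z ** M = mat 1" using inv matrix_left_right_inverse by blast
  have "((\<lambda>z. det (M ** G z)) has_derivative (\<lambda>v. trace (M ** G' v))) (at z within S)"
    by (rule has_derivative_det_at_id[where N = "\<lambda>w. M ** G w", OF _ inv])
       (auto simp: matrix_matrix_mult_def intro!: has_derivative_sum has_derivative_mult_right G)
  then have "((\<lambda>w. det (G z) * det (M ** G w)) has_derivative (\<lambda>v. det (G z) * trace (M ** G' v))) (at z within S)"
    by (rule has_derivative_mult_right)
  moreover have "det (G z) * det (M ** G w) = det (G w)" for w
    by (simp flip: det_mul add: matrix_mul_assoc inv')
  ultimately show ?thesis by simp
qed

section \<open>Change of variables under maps with complex-linear derivative\<close>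

lemma linear_matrix_vector_complex: "linear ((*v) (A :: complex^'n^'m))"
  by (rule linearI) (auto simp: matrix_vector_mult_def vec_eq_iff algebra_simps sum.distrib scaleR_sum_right)

text \<open>The matrix of the real-linear map given by \<open>A\<close> in the orthonormal basis \<open>b\<close> of the underlying real
  Euclidean space.\<close>

definition realify :: "('m::finite \<Rightarrow> complex^'n) \<Rightarrow> complex^'n^'n \<Rightarrow> real^'m^'m" where
  "realify b A = (\<chi> i j. (A *v b j) \<bullet> b i)"

context
  fixes b :: "'m::finite \<Rightarrow> complex^'n::finite"
  assumes b: "bij_betw b UNIV Basis"
begin

lemma b_inner: "b i \<bullet> b j = (if i = j then 1 else 0)"
proof -
  have "b i \<in> Basis" "b j \<in> Basis" "b i = b j \<longleftrightarrow> i = j"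
    using b by (auto simp: bij_betw_def inj_eq)
  then show ?thesis by (simp add: inner_Basis)
qed

lemma b_representation: "(\<Sum>i\<in>UNIV. (x \<bullet> b i) *\<^sub>R b i) = x"
  using sum.reindex_bij_betw[OF b, of "\<lambda>c. (x \<bullet> c) *\<^sub>R c"] by (simp add: euclidean_representation)

lemma realify_mult: "realify b (A ** B) = realify b A ** realify b B"
proof -
  have "((A ** B) *v b j) \<bullet> b i = (\<Sum>k\<in>UNIV. ((A *v b k) \<bullet> b i) * ((B *v b j) \<bullet> b k))" for i j
  proof -
    have "(A ** B) *v b j = A *v (B *v b j)" by (simp add: matrix_vector_mul_assoc)
    also have "B *v b j = (\<Sum>k\<in>UNIV. ((B *v b j) \<bullet> b k) *\<^sub>R b k)" by (rule b_representation[symmetric])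
    also have "A *v \<dots> = (\<Sum>k\<in>UNIV. ((B *v b j) \<bullet> b k) *\<^sub>R (A *v b k))"
      by (simp add: linear_sum[OF linear_matrix_vector_complex] linear_cmul[OF linear_matrix_vector_complex])
    finally show ?thesis by (simp add: inner_sum_left mult.commute)
  qed
  then show ?thesis by (simp add: realify_def matrix_matrix_mult_def vec_eq_iff)
qed

lemma realify_id: "realify b (mat 1) = mat 1"
  by (simp add: realify_def vec_eq_iff b_inner) (simp add: mat_def)

lemma trace_realify: "trace (realify b A) = 2 * Re (trace A)"
proof -
  have "trace (realify b A) = (\<Sum>c\<in>Basis. (A *v c) \<bullet> c)"
    using sum.reindex_bij_betw[OF b, of "\<lambda>c. (A *v c) \<bullet> c"] by (simp add: trace_def realify_def)
  also have "\<dots> = (\<Sum>i\<in>UNIV. \<Sum>c\<in>(\<Union>u\<in>Basis. {axis i u}). (A *v c) \<bullet> c)"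
    unfolding Basis_vec_def by (rule sum.UNION_disjoint) (auto simp: axis_eq_axis nonzero_Basis)
  also have "\<dots> = (\<Sum>i\<in>UNIV. 2 * Re (A $ i $ i))"
  proof (rule sum.cong[OF refl])
    fix i :: 'n
    have "(\<Union>u\<in>Basis. {axis i u}) = {axis i (1::complex), axis i \<i>}" by (auto simp: Basis_complex_def)
    moreover have "axis i (1::complex) \<noteq> axis i \<i>" by (simp add: axis_eq_axis complex_eq_iff)
    moreover have "(A *v axis i u) $ i = A $ i $ i * u" for u :: complex
      by (simp add: matrix_vector_mult_def axis_def if_distrib cong: if_cong)
    ultimately show "(\<Sum>c\<in>(\<Union>u\<in>Basis. {axis i u}). (A *v c) \<bullet> c) = 2 * Re (A $ i $ i)"
      by (simp add: inner_axis inner_complex_def)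
  qed
  also have "\<dots> = 2 * Re (trace A)" by (simp add: trace_def sum_distrib_left)
  finally show ?thesis .
qed

text \<open>Both sides are multiplicative in \<open>A\<close>, and by Jacobi's formula their logarithmic derivatives along a path of
  invertible matrices agree, since the real trace is twice the real part of the complex trace.  Hence
  their quotient \<open>h\<close> is constant along the complex line through \<open>1\<close> and \<open>A\<close>, with the zeros of the
  determinant removed: these are countably many, so that what remains is connected.\<close>

lemma det_realify:
  fixes A :: "complex^'n^'n"
  assumes A: "det A \<noteq> 0"
  shows "det (realify b A) = (cmod (det A))\<^sup>2"
proof -
  define \<delta> where "\<delta> i j = (if i = j then 1 else 0 :: complex)" for i j :: 'n
  define P where "P \<zeta> = (\<chi> i j. \<delta> i j + \<zeta> * (A $ i $ j - \<delta> i j))" for \<zeta>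
  define P' where "P' \<zeta> = (\<chi> i j. \<zeta> * (A $ i $ j - \<delta> i j))" for \<zeta>
  define p where "p \<zeta> = det (P \<zeta>)" for \<zeta>
  define Z where "Z = {\<zeta>. p \<zeta> = 0}"
  have P0: "P 0 = mat 1" by (simp add: P_def \<delta>_def mat_def)
  have P1: "P 1 = A" by (simp add: P_def vec_eq_iff)
  have hol: "p holomorphic_on UNIV" unfolding p_def P_def det_def by (simp, intro holomorphic_intros)
  have "countable Z"
  proof (cases "p constant_on UNIV")
    case True
    then have "p \<zeta> = p 0" for \<zeta> unfolding constant_on_def by (metis UNIV_I)
    then have "p \<zeta> \<noteq> 0" for \<zeta> by (simp add: p_def P0)
    then show ?thesis by (simp add: Z_def)
  next
    case False
    have "fsigma (UNIV :: complex set)" by (rule fsigma_UNIV)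
    from holomorphic_countable_zeros[OF hol open_UNIV connected_UNIV this False] show ?thesis by (simp add: Z_def)
  qed
  then have conn: "connected (- Z)"
    by (intro path_connected_imp_connected path_connected_complement_countable) auto
  have "closed Z" unfolding Z_def
    by (intro closed_Collect_eq holomorphic_on_imp_continuous_on hol continuous_on_const)
  then have op: "open (- Z)" by (simp add: open_Compl)
  define h where "h \<zeta> = det (realify b (P \<zeta>)) / (p \<zeta> \<bullet> p \<zeta>)" for \<zeta>
  have "(h has_derivative (\<lambda>v. 0)) (at \<zeta>)" if "\<zeta> \<in> - Z" for \<zeta>
  proof -
    have p0: "p \<zeta> \<noteq> 0" using that by (simp add: Z_def)
    then obtain M where M: "M ** P \<zeta> = mat 1"
      using invertible_det_nz invertible_left_inverse unfolding p_def by blast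
    have dP: "((\<lambda>\<zeta>. P \<zeta> $ i $ j) has_derivative (\<lambda>v. P' v $ i $ j)) (at \<zeta>)" for i j
      by (auto simp: P_def P'_def intro!: derivative_eq_intros)
    have dp: "(p has_derivative (\<lambda>v. p \<zeta> * trace (M ** P' v))) (at \<zeta>)"
      unfolding p_def by (rule has_derivative_det[where G = P, OF dP M])
    have dr: "((\<lambda>\<zeta>. det (realify b (P \<zeta>))) has_derivative
        (\<lambda>v. det (realify b (P \<zeta>)) * trace (realify b M ** realify b (P' v)))) (at \<zeta>)"
    proof (rule has_derivative_det[where G = "\<lambda>\<zeta>. realify b (P \<zeta>)"])
      show "realify b M ** realify b (P \<zeta>) = mat 1" by (simp flip: realify_mult add: M realify_id)
      show "((\<lambda>\<zeta>. realify b (P \<zeta>) $ i $ j) has_derivative (\<lambda>v. realify b (P' v) $ i $ j)) (at \<zeta>)" for i j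
        unfolding realify_def inner_vec_def matrix_vector_mult_def vec_lambda_beta
        by (intro has_derivative_sum has_derivative_inner_left has_derivative_mult_left dP)
    qed
    have dp2: "((\<lambda>\<zeta>. p \<zeta> \<bullet> p \<zeta>) has_derivative (\<lambda>v. p \<zeta> \<bullet> (p \<zeta> * trace (M ** P' v)) + (p \<zeta> * trace (M ** P' v)) \<bullet> p \<zeta>)) (at \<zeta>)"
      by (rule has_derivative_inner[OF dp dp])
    have pn: "p \<zeta> \<bullet> p \<zeta> \<noteq> 0" using p0 by simp
    have in1: "p \<zeta> \<bullet> (p \<zeta> * t) = (p \<zeta> \<bullet> p \<zeta>) * Re t" for t
      by (simp add: inner_complex_def algebra_simps)
    have in2: "(p \<zeta> * t) \<bullet> p \<zeta> = (p \<zeta> \<bullet> p \<zeta>) * Re t" for t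
      by (simp add: inner_complex_def algebra_simps)
    show ?thesis unfolding h_def
      by (rule has_derivative_eq_rhs[OF has_derivative_divide'[OF dr dp2 pn]])
         (auto simp: fun_eq_iff in1 in2 trace_realify simp flip: realify_mult)
  qed
  then have "h 0 = h 1"
    by (rule has_derivative_zero_unique_connected[OF op conn]) (use A in \<open>auto simp: Z_def p_def P0 P1\<close>)
  moreover have "h 0 = 1" by (simp add: h_def p_def P0 realify_id)
  ultimately have "det (realify b A) / (det A \<bullet> det A) = 1"
    unfolding h_def p_def P1 by metis
  then have "det (realify b A) = det A \<bullet> det A" by (metis divide_eq_1_iff)
  then show ?thesis by (simp add: power2_norm_eq_inner)
qed

end

text \<open>The index type \<open>'n bit0\<close> has \<open>2 * CARD('n)\<close> elements and is well-ordered, as the change of variables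
  theorem for \<open>real^'m\<close> demands of its index type.\<close>

lemma exists_real_coordinates:
  obtains b :: "'n bit0 \<Rightarrow> complex^'n::finite" where "bij_betw b UNIV Basis"
proof -
  have "card (UNIV :: 'n bit0 set) = card (Basis :: (complex^'n) set)" by simp
  then show ?thesis using that finite_same_card_bij[of "UNIV :: 'n bit0 set" "Basis :: (complex^'n) set"] by auto
qed

lemma distr_lborel_coordinates:
  fixes b :: "'m::finite \<Rightarrow> complex^'n::finite"
  assumes b: "bij_betw b UNIV Basis"
  shows "distr lborel borel (\<lambda>z. \<chi> i. z \<bullet> b i) = (lborel :: (real^'m) measure)"
proof (rule lborel_eqI[symmetric])
  fix l u :: "real^'m"
  assume lu: "\<And>c. c \<in> Basis \<Longrightarrow> l \<bullet> c \<le> u \<bullet> c"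
  define T' where "T' y = (\<Sum>i\<in>UNIV. (y $ i) *\<^sub>R b i)" for y :: "real^'m"
  have T'b: "T' y \<bullet> b i = y $ i" for y i
    by (simp add: T'_def inner_sum_left b_inner[OF b] if_distrib cong: if_cong)
  have bb: "(\<forall>c\<in>Basis. Q c) \<longleftrightarrow> (\<forall>i. Q (b i))" for Q using b by (force simp: bij_betw_def)
  have ax: "(\<forall>c\<in>Basis. Q c) \<longleftrightarrow> (\<forall>i. Q (axis i (1::real)))" for Q :: "real^'m \<Rightarrow> bool"
    by (auto simp: Basis_vec_def)
  have le: "l $ i \<le> u $ i" for i using lu[of "axis i 1"] by (simp add: inner_axis axis_in_Basis_iff)
  have cont: "continuous_on UNIV (\<lambda>z. \<chi> i. z \<bullet> b i)" by (intro continuous_intros)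
  then have meas: "(\<lambda>z. \<chi> i. z \<bullet> b i) \<in> measurable lborel borel" by (simp add: borel_measurable_continuous_onI)
  have "(\<lambda>z. \<chi> i. z \<bullet> b i) -` box l u = box (T' l) (T' u)"
    by (auto simp: box_def bb ax inner_axis T'b)
  then have "emeasure (distr lborel borel (\<lambda>z. \<chi> i. z \<bullet> b i)) (box l u) = emeasure lborel (box (T' l) (T' u))"
    by (subst emeasure_distr[OF meas]) auto
  also have "\<dots> = ennreal (\<Prod>c\<in>Basis. (T' u - T' l) \<bullet> c)"
  proof (rule emeasure_lborel_box)
    fix c :: "complex^'n" assume "c \<in> Basis"
    then obtain i where "c = b i" using b by (auto simp: bij_betw_def)
    then show "T' l \<bullet> c \<le> T' u \<bullet> c" using le T'b by simp
  qed
  also have "(\<Prod>c\<in>Basis. (T' u - T' l) \<bullet> c) = (\<Prod>i\<in>UNIV. u $ i - l $ i)"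
    using prod.reindex_bij_betw[OF b, of "\<lambda>c. (T' u - T' l) \<bullet> c"] by (simp add: T'b inner_diff_left)
  also have "\<dots> = (\<Prod>c\<in>Basis. (u - l) \<bullet> c)"
  proof -
    have "bij_betw (\<lambda>i. axis i (1::real)) (UNIV :: 'm set) Basis"
      by (auto simp: bij_betw_def inj_on_def Basis_vec_def axis_eq_axis)
    from prod.reindex_bij_betw[OF this, of "\<lambda>c. (u - l) \<bullet> c"] show ?thesis by (simp add: inner_axis)
  qed
  finally show "emeasure (distr lborel borel (\<lambda>z. \<chi> i. z \<bullet> b i)) (box l u) = ennreal (\<Prod>c\<in>Basis. (u - l) \<bullet> c)" .
qed simp

text \<open>The change of variables theorem transported from \<open>real^('n bit0)\<close>; the real Jacobian determinant is
  computed by \<open>det_realify\<close>.  The integral may be infinite.\<close>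

lemma emeasure_image_complex:
  fixes f :: "complex^'n::finite \<Rightarrow> complex^'n"
  assumes A: "A \<in> sets borel" and fA: "f ` A \<in> sets borel"
    and der: "\<And>z. z \<in> A \<Longrightarrow> (f has_derivative (*v) (J z)) (at z)"
    and inj: "inj_on f A" and nz: "\<And>z. z \<in> A \<Longrightarrow> det (J z) \<noteq> 0"
    and meas: "(\<lambda>z. indicator A z * (cmod (det (J z)))\<^sup>2 :: real) \<in> borel_measurable borel"
  shows "emeasure lborel (f ` A) = (\<integral>\<^sup>+ z. ennreal (indicator A z * (cmod (det (J z)))\<^sup>2) \<partial>lborel)"
proof -
  obtain b :: "'n bit0 \<Rightarrow> complex^'n" where b: "bij_betw b UNIV Basis" by (rule exists_real_coordinates)
  define T where "T z = (\<chi> i. z \<bullet> b i)" for z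
  define T' where "T' y = (\<Sum>i\<in>UNIV. (y $ i) *\<^sub>R b i)" for y :: "real^'n bit0"
  have T'T: "T' (T z) = z" for z by (simp add: T'_def T_def b_representation[OF b])
  have TT': "T (T' y) = y" for y
    by (simp add: T'_def T_def vec_eq_iff inner_sum_left b_inner[OF b] if_distrib cong: if_cong)
  have lT: "linear T" by (rule linearI) (auto simp: T_def vec_eq_iff inner_add_left)
  have lT': "linear T'" by (rule linearI) (auto simp: T'_def algebra_simps sum.distrib scaleR_sum_right)
  have blT: "bounded_linear T" "bounded_linear T'" using lT lT' by (simp_all add: linear_conv_bounded_linear)
  have mT: "T \<in> measurable lborel borel" "T' \<in> measurable lborel borel"
    using linear_continuous_on[OF blT(1), of UNIV] linear_continuous_on[OF blT(2), of UNIV]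
    by (simp_all add: borel_measurable_continuous_onI)
  have dT: "lborel = distr lborel borel T" using distr_lborel_coordinates[OF b] unfolding T_def[abs_def] by simp
  define g where "g z = indicator A z * (cmod (det (J z)))\<^sup>2" for z :: "complex^'n"
  have g[measurable]: "g \<in> borel_measurable borel" using meas by (simp add: g_def[abs_def])
  have g0: "g z \<ge> 0" for z by (simp add: g_def)
  define S where "S = T ` A"
  have SA: "y \<in> S \<longleftrightarrow> T' y \<in> A" for y unfolding S_def using T'T TT' by (metis image_iff)
  have Sb: "S \<in> sets borel"
  proof -
    have "S = T' -` A \<inter> space lborel" using SA by auto
    then show ?thesis using measurable_sets[OF mT(2) A] by simp
  qed
  define F where "F y = T (f (T' y))" for y
  have FS: "F ` S = T ` f ` A" unfolding F_def S_def by (simp add: image_image T'T)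
  have FSb: "F ` S \<in> sets borel"
  proof -
    have "F ` S = T' -` (f ` A) \<inter> space lborel" unfolding FS using T'T TT' by (auto simp: image_iff) metis
    then show ?thesis using measurable_sets[OF mT(2) fA] by simp
  qed
  have em: "emeasure lborel (F ` S) = emeasure lborel (f ` A)"
  proof -
    have "emeasure lborel (F ` S) = emeasure lborel (T -` (F ` S) \<inter> space lborel)"
      by (subst dT, rule emeasure_distr[OF mT(1)]) (use FSb in simp)
    also have "T -` (F ` S) \<inter> space lborel = f ` A" unfolding FS using T'T by (auto simp: image_iff) metis
    finally show ?thesis .
  qed
  define G where "G y = g (T' y)" for y
  have Gm: "G \<in> borel_measurable borel" unfolding G_def[abs_def] using mT(2) by simp
  have nn: "(\<integral>\<^sup>+ y. ennreal (G y) \<partial>lborel) = (\<integral>\<^sup>+ z. ennreal (g z) \<partial>lborel)"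
  proof -
    have "(\<integral>\<^sup>+ y. ennreal (G y) \<partial>lborel) = (\<integral>\<^sup>+ y. ennreal (G y) \<partial>distr lborel borel T)" using dT by simp
    also have "\<dots> = (\<integral>\<^sup>+ z. ennreal (G (T z)) \<partial>lborel)" by (rule nn_integral_distr[OF mT(1)]) (use Gm in simp)
    finally show ?thesis by (simp add: G_def T'T)
  qed
  define F' where "F' y = (\<lambda>v. T (J (T' y) *v T' v))" for y
  have derF: "(F has_derivative F' y) (at y within S)" if "y \<in> S" for y
  proof -
    have "(f has_derivative (*v) (J (T' y))) (at (T' y))" using der that SA by simp
    then have "((\<lambda>y. f (T' y)) has_derivative (\<lambda>v. J (T' y) *v T' v)) (at y)"
      using diff_chain_at[OF bounded_linear_imp_has_derivative[OF blT(2)]] by (simp add: o_def)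
    from bounded_linear.has_derivative[OF blT(1) this]
    show ?thesis unfolding F_def[abs_def] F'_def by (rule has_derivative_at_withinI)
  qed
  have detF: "\<bar>det (matrix (F' y))\<bar> = G y" if "y \<in> S" for y
  proof -
    have Tax: "T' (axis j 1) = b j" for j
      by (simp add: T'_def axis_def if_distrib[of "\<lambda>r. r *\<^sub>R _"] cong: if_cong)
    then have "matrix (F' y) = realify b (J (T' y))"
      unfolding matrix_def realify_def F'_def T_def Tax by simp
    then show ?thesis using det_realify[OF b nz] that by (simp add: G_def g_def SA)
  qed
  have G_res: "G = (\<lambda>y. if y \<in> S then \<bar>det (matrix (F' y))\<bar> else 0)"
    using detF by (auto simp: fun_eq_iff G_def g_def SA)
  have injF: "inj_on F S"
  proof (rule inj_onI)
    fix x y assume xy: "x \<in> S" "y \<in> S" "F x = F y"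
    then have "f (T' x) = f (T' y)" unfolding F_def by (metis T'T)
    then have "T' x = T' y" using inj xy(1,2) by (auto simp: SA dest: inj_onD)
    then show "x = y" by (metis TT')
  qed
  have hmi: "F ` S \<in> lmeasurable \<and> measure lebesgue (F ` S) = m \<longleftrightarrow> (G has_integral m) UNIV" for m
    using has_measure_differentiable_image[OF _ derF injF, of m] Sb unfolding G_res has_integral_restrict_UNIV by simp
  have el: "emeasure lebesgue (F ` S) = emeasure lborel (F ` S)" using FSb by (simp add: emeasure_completion)
  have "emeasure lborel (F ` S) = (\<integral>\<^sup>+ y. ennreal (G y) \<partial>lborel)"
  proof (cases "(\<integral>\<^sup>+ y. ennreal (G y) \<partial>lborel) = \<infinity>")
    case False
    then obtain r where r: "(\<integral>\<^sup>+ y. ennreal (G y) \<partial>lborel) = ennreal r" "r \<ge> 0"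
      by (metis ennreal_cases infinity_ennreal_def)
    have "(G has_integral r) UNIV" by (rule nn_integral_has_integral[OF Gm _ r]) (simp add: G_def g0)
    then have "F ` S \<in> lmeasurable \<and> measure lebesgue (F ` S) = r" by (simp add: hmi)
    then show ?thesis using el r by (metis emeasure_eq_measure2)
  next
    case True
    have "emeasure lborel (F ` S) = \<infinity>"
    proof (rule ccontr)
      assume "emeasure lborel (F ` S) \<noteq> \<infinity>"
      then have "F ` S \<in> lmeasurable" using FSb el by (auto intro!: fmeasurableI simp: less_top)
      then have "(G has_integral measure lebesgue (F ` S)) UNIV" using hmi by blast
      then have "(\<integral>\<^sup>+ y. ennreal (G y) \<partial>lborel) = measure lebesgue (F ` S)"
        by (intro nn_integral_has_integral_lborel[OF Gm]) (simp_all add: G_def g0)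
      then show False using True by simp
    qed
    then show ?thesis using True by simp
  qed
  then show ?thesis using em nn by (simp add: g_def)
qed

text \<open>The formula for the measure of images says that \<open>f\<close> maps the measure with density
  \<open>\<bar>det J\<bar>\<^sup>2\<close> on \<open>A\<close> to Lebesgue measure on the image of \<open>A\<close>.\<close>

lemma nn_integral_image_complex:
  fixes f :: "complex^'n::finite \<Rightarrow> complex^'n" and \<rho> :: "complex^'n \<Rightarrow> ennreal"
  assumes S: "open S" and C1: "C1_on S f" and J: "\<And>z. z \<in> S \<Longrightarrow> fd f z = (*v) (J z)"
    and inj: "inj_on f S" and nz: "\<And>z. z \<in> S \<Longrightarrow> det (J z) \<noteq> 0"
    and img: "\<And>B. B \<in> sets borel \<Longrightarrow> B \<subseteq> S \<Longrightarrow> f ` B \<in> sets borel"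
    and A: "A \<in> sets borel" "A \<subseteq> S" and \<rho>: "(\<lambda>z. indicator (f ` A) z * \<rho> z) \<in> borel_measurable borel"
  shows "(\<integral>\<^sup>+ z\<in>f ` A. \<rho> z \<partial>lborel) = (\<integral>\<^sup>+ z\<in>A. \<rho> (f z) * ennreal ((cmod (det (J z)))\<^sup>2) \<partial>lborel)"
proof -
  have entry: "continuous_on S (\<lambda>z. J z $ i $ j)" for i j
  proof -
    have "continuous_on S (\<lambda>z. fd f z (axis j 1) $ i)" by (intro continuous_intros C1_onD(2)[OF C1])
    moreover have "fd f z (axis j 1) $ i = J z $ i $ j" if "z \<in> S" for z
      by (simp add: J[OF that] matrix_vector_mult_def axis_def if_distrib cong: if_cong)
    ultimately show ?thesis by (simp cong: continuous_on_cong)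
  qed
  have cd: "continuous_on S (\<lambda>z. (cmod (det (J z)))\<^sup>2)"
    unfolding det_def by (intro continuous_intros entry)
  have cf: "continuous_on S f" by (rule C1_on_imp_continuous_on[OF C1])
  have m: "(\<lambda>z. indicator B z * (cmod (det (J z)))\<^sup>2 :: real) \<in> borel_measurable borel" if "B \<in> sets borel" "B \<subseteq> S" for B
    using borel_measurable_continuous_on_indicator[OF that(1) continuous_on_subset[OF cd that(2)]]
    by (simp add: real_scaleR_def)
  define w where "w z = ennreal (indicator A z * (cmod (det (J z)))\<^sup>2)" for z
  have wm[measurable]: "w \<in> borel_measurable borel" unfolding w_def using m[OF A] by simp
  define f' where "f' z = (if z \<in> A then f z else 0)" for z
  have f'm[measurable]: "f' \<in> measurable borel borel"
  proof -
    have "f' = (\<lambda>z. indicator A z *\<^sub>R f z)" by (auto simp: f'_def fun_eq_iff)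
    then show ?thesis using borel_measurable_continuous_on_indicator[OF A(1) continuous_on_subset[OF cf A(2)]] by simp
  qed
  have fA: "f ` A \<in> sets borel" by (rule img[OF A])
  have eq: "distr (density lborel w) borel f' = density lborel (indicator (f ` A))"
  proof (rule measure_eqI)
    fix B assume "B \<in> sets (distr (density lborel w) borel f')"
    then have B[measurable]: "B \<in> sets borel" by simp
    define A' where "A' = A \<inter> f' -` B"
    have A': "A' \<in> sets borel" "A' \<subseteq> S" "A' \<subseteq> A"
      using A measurable_sets[OF f'm B] by (auto simp: A'_def)
    have "emeasure (distr (density lborel w) borel f') B = emeasure (density lborel w) (f' -` B)"
      by (subst emeasure_distr) auto
    also have "\<dots> = (\<integral>\<^sup>+ z. w z * indicator (f' -` B) z \<partial>lborel)"
      using measurable_sets[OF f'm B] by (subst emeasure_density) auto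
    also have "\<dots> = (\<integral>\<^sup>+ z. ennreal (indicator A' z * (cmod (det (J z)))\<^sup>2) \<partial>lborel)"
      by (intro nn_integral_cong) (auto simp: w_def A'_def indicator_def)
    also have "\<dots> = emeasure lborel (f ` A')"
      by (rule emeasure_image_complex[symmetric])
         (use A' img[OF A'(1,2)] inj_on_subset[OF inj A'(2)] m[OF A'(1,2)] nz J C1_onD(1)[OF C1] in \<open>auto simp: subset_iff\<close>)
    also have "f ` A' = f ` A \<inter> B" by (auto simp: A'_def f'_def)
    also have "emeasure lborel (f ` A \<inter> B) = emeasure (density lborel (indicator (f ` A))) B"
      using fA by (subst emeasure_density) (auto simp flip: indicator_inter_arith)
    finally show "emeasure (distr (density lborel w) borel f') B = emeasure (density lborel (indicator (f ` A))) B" .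
  qed simp
  have "(\<integral>\<^sup>+ z\<in>f ` A. \<rho> z \<partial>lborel) = (\<integral>\<^sup>+ z. indicator (f ` A) z * (indicator (f ` A) z * \<rho> z) \<partial>lborel)"
    by (intro nn_integral_cong) (auto simp: indicator_def)
  also have "\<dots> = (\<integral>\<^sup>+ z. indicator (f ` A) z * \<rho> z \<partial>density lborel (indicator (f ` A)))"
    using fA \<rho> by (subst nn_integral_density) auto
  also have "\<dots> = (\<integral>\<^sup>+ z. indicator (f ` A) (f' z) * \<rho> (f' z) \<partial>density lborel w)"
    using \<rho> by (subst eq[symmetric], subst nn_integral_distr) auto
  also have "\<dots> = (\<integral>\<^sup>+ z. w z * (indicator (f ` A) (f' z) * \<rho> (f' z)) \<partial>lborel)"
    using measurable_compose[OF f'm \<rho>] by (subst nn_integral_density) auto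
  also have "\<dots> = (\<integral>\<^sup>+ z\<in>A. \<rho> (f z) * ennreal ((cmod (det (J z)))\<^sup>2) \<partial>lborel)"
    by (intro nn_integral_cong) (auto simp: w_def f'_def indicator_def mult.commute)
  finally show ?thesis .
qed

section \<open>Positive definite Hermitian matrices\<close>

text \<open>Keeps \<open>transpose A *v x\<close> from being rewritten to \<open>x v* A\<close>.\<close>

declare transpose_matrix_vector [simp del]

text \<open>For fixed \<open>\<sigma>\<close> the substitution \<open>\<tau> \<mapsto> \<tau> \<circ> inv \<sigma>\<close> turns the inner sum into the determinant.\<close>

lemma wedge_coeff_const: "wedge_coeff (\<lambda>_. G) = fact CARD('n) * det (G :: complex^'n::finite^'n)"
proof -
  have "(\<Sum>\<tau> | \<tau> permutes (UNIV :: 'n set). of_int (sign \<sigma> * sign \<tau>) * (\<Prod>i\<in>UNIV. G $ \<sigma> i $ \<tau> i)) = det G"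
    if s: "\<sigma> permutes (UNIV :: 'n set)" for \<sigma>
  proof -
    have pi: "inv \<sigma> permutes UNIV" by (rule permutes_inv[OF s])
    have "det G = (\<Sum>\<tau> | \<tau> permutes (UNIV :: 'n set). of_int (sign (\<tau> \<circ> inv \<sigma>)) * (\<Prod>i\<in>UNIV. G $ i $ (\<tau> \<circ> inv \<sigma>) i))"
      unfolding det_def by (rule sum_permutations_compose_right[OF pi])
    also have "\<dots> = (\<Sum>\<tau> | \<tau> permutes (UNIV :: 'n set). of_int (sign \<sigma> * sign \<tau>) * (\<Prod>i\<in>UNIV. G $ \<sigma> i $ \<tau> i))"
    proof (rule sum.cong[OF refl])
      fix \<tau> assume "\<tau> \<in> {\<tau>. \<tau> permutes (UNIV :: 'n set)}"
      then have t: "\<tau> permutes UNIV" by simp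
      have "permutation \<sigma>" "permutation \<tau>" using s t by (auto simp: permutation_permutes intro!: exI[of _ UNIV])
      then have "sign (\<tau> \<circ> inv \<sigma>) = sign \<sigma> * sign \<tau>"
        by (simp add: sign_compose permutation_inverse sign_inverse)
      moreover have "(\<Prod>i\<in>UNIV. G $ i $ (\<tau> \<circ> inv \<sigma>) i) = (\<Prod>i\<in>UNIV. G $ \<sigma> i $ \<tau> i)"
      proof -
        have "(\<Prod>i\<in>UNIV. G $ i $ (\<tau> \<circ> inv \<sigma>) i) = (\<Prod>i\<in>UNIV. G $ \<sigma> i $ (\<tau> \<circ> inv \<sigma>) (\<sigma> i))"
          using prod.permute[OF s, of "\<lambda>i. G $ i $ (\<tau> \<circ> inv \<sigma>) i"] by (simp add: o_def)
        then show ?thesis using permutes_inverses[OF s] by simp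
      qed
      ultimately show "of_int (sign (\<tau> \<circ> inv \<sigma>)) * (\<Prod>i\<in>UNIV. G $ i $ (\<tau> \<circ> inv \<sigma>) i) =
          of_int (sign \<sigma> * sign \<tau>) * (\<Prod>i\<in>UNIV. G $ \<sigma> i $ \<tau> i)" by simp
    qed
    finally show ?thesis by simp
  qed
  then have "wedge_coeff (\<lambda>_. G) = of_nat (card {\<sigma>. \<sigma> permutes (UNIV :: 'n set)}) * det G"
    unfolding wedge_coeff_def by simp
  then show ?thesis by (simp add: card_permutations[of "UNIV :: 'n set" "CARD('n)"])
qed

definition herm_pd :: "complex^'n^'n::finite \<Rightarrow> bool" where
  "herm_pd G \<longleftrightarrow> (\<forall>j k. G $ k $ j = cnj (G $ j $ k)) \<and> (\<forall>v. v \<noteq> 0 \<longrightarrow> Re (hform G v v) > 0)"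

lemma Re_mult_cnj: "Re (x * cnj x) = (cmod x)\<^sup>2"
  unfolding cmod_power2 by (simp add: power2_eq_square)

lemma herm_pd_sym: "herm_pd G \<Longrightarrow> cnj (G $ j $ k) = G $ k $ j"
  unfolding herm_pd_def by metis

lemma herm_pd_pos: "herm_pd G \<Longrightarrow> v \<noteq> 0 \<Longrightarrow> Re (hform G v v) > 0"
  unfolding herm_pd_def by blast

definition conj_mat :: "complex^'n^'m \<Rightarrow> complex^'n^'m" where "conj_mat A = (\<chi> i j. cnj (A $ i $ j))"

lemma det_conj_mat: "det (conj_mat A) = cnj (det A)"
  by (simp add: det_def conj_mat_def)

lemma conj_mat_mult: "conj_mat (A ** B) = conj_mat A ** conj_mat B"
  by (simp add: conj_mat_def matrix_matrix_mult_def vec_eq_iff)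

lemma herm_pd_conj_mat: "herm_pd G \<Longrightarrow> transpose G = conj_mat G"
  by (simp add: herm_pd_sym transpose_def conj_mat_def vec_eq_iff)

lemma det_herm_pd_nz:
  assumes "herm_pd G" shows "det G \<noteq> 0"
proof
  assume "det G = 0"
  then have "\<not> invertible (transpose G)" by (simp add: invertible_det_nz det_transpose)
  then obtain v where v: "transpose G *v v = 0" "v \<noteq> 0"
    unfolding invertible_left_inverse matrix_left_invertible_ker by blast
  have "hform G v v = (\<Sum>k\<in>UNIV. (transpose G *v v) $ k * cnj (v $ k))"
    unfolding hform_def by (subst sum.swap) (simp add: transpose_def matrix_vector_mult_def sum_distrib_right)
  then have "hform G v v = 0" by (simp add: v)
  then show False using herm_pd_pos[OF assms v(2)] by simp
qed

text \<open>Reality comes from \<open>transpose G = conj G\<close>.  For positivity, \<open>G\<close> is joined to the identity by a segment of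
  positive definite matrices, on which the determinant is real and does not vanish.\<close>

lemma det_herm_pd:
  fixes G :: "complex^'n::finite^'n"
  assumes G: "herm_pd G" shows "Im (det G) = 0" and "Re (det G) > 0"
proof -
  have im: "Im (det H) = 0" if "herm_pd H" for H :: "complex^'n^'n"
  proof -
    have "cnj (det H) = det H" using herm_pd_conj_mat[OF that] det_conj_mat[of H] det_transpose[of H] by simp
    then show ?thesis by (simp add: complex_eq_iff)
  qed
  show "Im (det G) = 0" by (rule im[OF G])
  define H where "H t = (\<chi> i j. (1 - complex_of_real t) * (if i = j then 1 else 0) + of_real t * G $ i $ j)" for t
  have pd: "herm_pd (H t)" if "t \<in> {0..1}" for t
  proof -
    have **: "hform (H t) v v = (1 - of_real t) * (\<Sum>j\<in>UNIV. v $ j * cnj (v $ j)) + of_real t * hform G v v" for v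
    proof -
      have "hform (H t) v v = (\<Sum>j\<in>UNIV. \<Sum>k\<in>UNIV. (if j = k then (1 - of_real t) * (v $ j * cnj (v $ k)) else 0)
          + of_real t * (G $ j $ k * v $ j * cnj (v $ k)))"
        unfolding hform_def H_def by (intro sum.cong refl) (simp add: algebra_simps)
      then show ?thesis by (simp add: sum.distrib sum_distrib_left hform_def)
    qed
    have *: "Re (\<Sum>j\<in>UNIV. v $ j * cnj (v $ j)) > 0" if nz: "v \<noteq> 0" for v :: "complex^'n"
    proof -
      have "Re (\<Sum>j\<in>UNIV. v $ j * cnj (v $ j)) = (\<Sum>j\<in>UNIV. (cmod (v $ j))\<^sup>2)"
        by (simp only: Re_sum Re_mult_cnj)
      moreover obtain i where "v $ i \<noteq> 0" using nz by (auto simp: vec_eq_iff)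
      moreover have "(\<Sum>j\<in>UNIV. (cmod (v $ j))\<^sup>2) > 0"
        by (rule sum_pos2[of UNIV i]) (use \<open>v $ i \<noteq> 0\<close> in auto)
      ultimately show ?thesis by (simp only:)
    qed
    have "Re (hform (H t) v v) > 0" if v: "v \<noteq> 0" for v
    proof -
      define n where "n = (\<Sum>j\<in>UNIV. v $ j * cnj (v $ j))"
      have n: "Re n > 0" unfolding n_def using * v by blast
      have "hform (H t) v v = complex_of_real (1 - t) * n + of_real t * hform G v v"
        unfolding n_def using ** by simp
      then have eq: "Re (hform (H t) v v) = (1 - t) * Re n + t * Re (hform G v v)" by simp
      show ?thesis
      proof (cases "t = 0")
        case True then show ?thesis using n eq by simp
      next
        case False
        then have "t * Re (hform G v v) > 0" "(1 - t) * Re n \<ge> 0"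
          using \<open>t \<in> {0..1}\<close> n herm_pd_pos[OF G v] by (auto intro: mult_nonneg_nonneg mult_pos_pos)
        then show ?thesis using eq by linarith
      qed
    qed
    moreover have "H t $ k $ j = cnj (H t $ j $ k)" for j k
      by (auto simp: H_def herm_pd_sym[OF G])
    ultimately show ?thesis unfolding herm_pd_def by blast
  qed
  have cont: "continuous_on {0..1} (\<lambda>t. Re (det (H t)))"
    unfolding H_def det_def by (simp, intro continuous_intros)
  have nz: "Re (det (H t)) \<noteq> 0" if "t \<in> {0..1}" for t
    using det_herm_pd_nz[OF pd[OF that]] im[OF pd[OF that]] by (auto simp: complex_eq_iff)
  have H0: "H 0 = mat 1" by (simp add: H_def mat_def vec_eq_iff)
  have H1: "H 1 = G" by (simp add: H_def vec_eq_iff)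
  show "Re (det G) > 0"
  proof (rule ccontr)
    assume "\<not> Re (det G) > 0"
    then have "Re (det (H 1)) \<le> 0" "0 \<le> Re (det (H 0))" by (simp_all add: H0 H1)
    then obtain t where "0 \<le> t" "t \<le> 1" "Re (det (H t)) = 0"
      using IVT2'[of "\<lambda>t. Re (det (H t))" 1 0 0] cont by auto
    then show False using nz[of t] by simp
  qed
qed

lemma wedge_density_const: "wedge_density (\<lambda>_. G) = 2 ^ CARD('n) * fact CARD('n) * Re (det (G :: complex^'n::finite^'n))"
proof -
  have "Re (fact CARD('n) * det G) = fact CARD('n) * Re (det G)"
    by (metis Re_complex_of_real of_real_fact complex_Re_fact complex_Im_fact times_complex.simps(1) mult_zero_left diff_zero)
  then show ?thesis by (simp add: wedge_density_def wedge_coeff_const)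
qed

lemma wedge_density_pos: "herm_pd G \<Longrightarrow> wedge_density (\<lambda>_. G) > 0"
  by (simp add: wedge_density_const det_herm_pd)

lemma hform_axis: "hform G (axis j 1) (axis k 1) = G $ j $ k"
proof -
  have "(\<Sum>b\<in>UNIV. G $ a $ b * axis j 1 $ a * cnj (axis k 1 $ b)) = (if a = j then G $ a $ k else 0)" for a
    by (simp add: axis_def if_distrib cong: if_cong)
  then show ?thesis by (simp add: hform_def)
qed

text \<open>The transformation rule of the coefficient matrices of a (1,1)-form under a linear map.\<close>

lemma hform_pullback:
  fixes G H J :: "complex^'n::finite^'n"
  assumes "\<And>v w. hform G v w = hform H (J *v v) (J *v w)"
  shows "G = transpose J ** H ** conj_mat J"
proof -
  have col: "(J *v axis j 1) $ a = J $ a $ j" for a j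
    by (simp add: matrix_vector_mult_def axis_def if_distrib cong: if_cong)
  have "G $ j $ k = (transpose J ** H ** conj_mat J) $ j $ k" for j k
  proof -
    have "G $ j $ k = (\<Sum>a\<in>UNIV. \<Sum>b\<in>UNIV. H $ a $ b * J $ a $ j * cnj (J $ b $ k))"
      using assms[of "axis j 1" "axis k 1"] unfolding hform_axis unfolding hform_def col .
    also have "\<dots> = (transpose J ** H ** conj_mat J) $ j $ k"
      unfolding matrix_matrix_mult_def transpose_def conj_mat_def vec_lambda_beta sum_distrib_right
      by (subst sum.swap) (intro sum.cong refl, simp only: mult_ac)
    finally show ?thesis .
  qed
  then show ?thesis by (simp add: vec_eq_iff)
qed

lemma matrix_inv_nz:
  fixes G :: "complex^'n^'n"
  assumes "det G \<noteq> 0" shows "matrix_inv G ** G = mat 1" "G ** matrix_inv G = mat 1"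
proof -
  have "\<exists>A. G ** A = mat 1 \<and> A ** G = mat 1"
    using assms by (simp add: invertible_det_nz[symmetric] invertible_def)
  from someI_ex[OF this] show "matrix_inv G ** G = mat 1" "G ** matrix_inv G = mat 1"
    by (simp_all add: matrix_inv_def)
qed

lemma matrix_inv_eq: "(A :: complex^'n^'n) ** B = mat 1 \<Longrightarrow> matrix_inv B = A"
proof -
  assume AB: "A ** B = mat 1"
  then have "det A * det B = 1" by (metis det_I det_mul)
  then have "det B \<noteq> 0" by auto
  then have "A ** (B ** matrix_inv B) = A" by (simp add: matrix_inv_nz)
  then have "(A ** B) ** matrix_inv B = A" by (simp only: matrix_mul_assoc)
  then show ?thesis by (simp add: AB)
qed

lemma matrix_inv_pullback:
  fixes G H J :: "complex^'n::finite^'n"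
  assumes G: "G = transpose J ** H ** conj_mat J" and nz: "det G \<noteq> 0"
  shows "matrix_inv H = conj_mat J ** matrix_inv G ** transpose J"
proof (rule matrix_inv_eq)
  have "matrix_inv G ** (transpose J ** H ** conj_mat J) = mat 1" using matrix_inv_nz(1)[OF nz] G by simp
  then have "(matrix_inv G ** transpose J ** H) ** conj_mat J = mat 1" by (simp add: matrix_mul_assoc)
  then have "conj_mat J ** (matrix_inv G ** transpose J ** H) = mat 1" using matrix_left_right_inverse by blast
  then show "conj_mat J ** matrix_inv G ** transpose J ** H = mat 1" by (simp add: matrix_mul_assoc)
qed

text \<open>With \<open>M = matrix_inv G\<close> this is the Hermitian product on (1,0)-covectors dual to \<open>hform G\<close>.\<close>

definition gram :: "complex^'n^'n::finite \<Rightarrow> complex^'n \<Rightarrow> complex^'n \<Rightarrow> complex" where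
  "gram M a b = (\<Sum>j\<in>UNIV. \<Sum>k\<in>UNIV. M $ k $ j * a $ j * cnj (b $ k))"

lemma gram_alt: "gram M a b = (\<Sum>k\<in>UNIV. (M *v a) $ k * cnj (b $ k))"
  unfolding gram_def by (subst sum.swap) (simp add: matrix_vector_mult_def sum_distrib_right)

lemma sum_mult_cnj_adjoint:
  "(\<Sum>k\<in>UNIV. (A *v x) $ k * cnj (b $ k)) = (\<Sum>k\<in>UNIV. x $ k * cnj ((transpose (conj_mat A) *v b) $ k))"
  unfolding matrix_vector_mult_def transpose_def conj_mat_def vec_lambda_beta sum_distrib_right cnj_sum sum_distrib_left
  by (subst sum.swap) (simp add: mult_ac)

lemma transpose_conj_mat: "transpose (conj_mat A) = conj_mat (transpose A)" by (simp add: transpose_def conj_mat_def)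

lemma conj_mat_conj_mat [simp]: "conj_mat (conj_mat A) = A" by (simp add: conj_mat_def vec_eq_iff)

lemma gram_pullback:
  fixes G H J :: "complex^'n::finite^'n"
  assumes "G = transpose J ** H ** conj_mat J" and "det G \<noteq> 0"
  shows "gram (matrix_inv H) a b = gram (matrix_inv G) (transpose J *v a) (transpose J *v b)"
proof -
  have "gram (matrix_inv H) a b = (\<Sum>k\<in>UNIV. (conj_mat J *v (matrix_inv G *v (transpose J *v a))) $ k * cnj (b $ k))"
    unfolding gram_alt matrix_inv_pullback[OF assms] by (simp add: matrix_vector_mul_assoc matrix_mul_assoc)
  also have "\<dots> = (\<Sum>k\<in>UNIV. (matrix_inv G *v (transpose J *v a)) $ k * cnj ((transpose J *v b) $ k))"
    by (subst sum_mult_cnj_adjoint) simp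
  finally show ?thesis by (simp add: gram_alt)
qed

text \<open>The trace of a (1,1)-form with respect to a metric is independent of the coordinates.\<close>

lemma trace_pullback:
  fixes G H J :: "complex^'n::finite^'n"
  assumes "G = transpose J ** H ** conj_mat J" and "det G \<noteq> 0" and "A = transpose J ** B ** conj_mat J"
  shows "trace (matrix_inv H ** B) = trace (matrix_inv G ** A)"
proof -
  have "trace (matrix_inv H ** B) = trace (conj_mat J ** (matrix_inv G ** transpose J ** B))"
    unfolding matrix_inv_pullback[OF assms(1,2)] by (simp add: matrix_mul_assoc)
  also have "\<dots> = trace ((matrix_inv G ** transpose J ** B) ** conj_mat J)" by (rule trace_mul_sym)
  also have "\<dots> = trace (matrix_inv G ** A)" by (simp add: assms(3) matrix_mul_assoc)
  finally show ?thesis .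
qed

text \<open>With \<open>a = G *v y\<close> the left side is the value of \<open>hform G\<close> at the complex conjugate of \<open>y\<close>.\<close>

lemma gram_self_nonneg:
  assumes G: "herm_pd G" shows "Re (gram (matrix_inv G) a a) \<ge> 0"
proof -
  define y where "y = matrix_inv G *v a"
  have a: "a = G *v y" unfolding y_def using matrix_inv_nz(2)[OF det_herm_pd_nz[OF G]]
    by (simp add: matrix_vector_mul_assoc)
  define y' where "y' = (\<chi> i. cnj (y $ i))"
  have "gram (matrix_inv G) a a = (\<Sum>k\<in>UNIV. y $ k * cnj ((G *v y) $ k))"
    by (simp only: gram_alt y_def[symmetric] a[symmetric])
  also have "\<dots> = (\<Sum>k\<in>UNIV. \<Sum>l\<in>UNIV. y $ k * (G $ l $ k * cnj (y $ l)))"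
    by (simp add: matrix_vector_mult_def sum_distrib_left herm_pd_sym[OF G])
  also have "\<dots> = hform G y' y'"
    unfolding hform_def y'_def by (subst sum.swap) (simp add: mult_ac)
  finally have eq: "gram (matrix_inv G) a a = hform G y' y'" .
  show ?thesis
  proof (cases "y' = 0")
    case True then show ?thesis unfolding eq by (simp add: hform_def)
  next
    case False then show ?thesis unfolding eq using herm_pd_pos[OF G] by (simp add: less_imp_le)
  qed
qed

lemma gram_sym:
  assumes G: "herm_pd G" shows "Re (gram (matrix_inv G) a b) = Re (gram (matrix_inv G) b a)"
proof -
  let ?M = "matrix_inv G"
  have "conj_mat (transpose ?M) ** conj_mat (transpose G) = conj_mat (transpose (G ** ?M))"
    by (simp add: conj_mat_mult[symmetric] matrix_transpose_mul)
  also have "\<dots> = mat 1" using matrix_inv_nz(2)[OF det_herm_pd_nz[OF G]]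
    by (simp add: transpose_mat) (simp add: conj_mat_def mat_def vec_eq_iff)
  also have "conj_mat (transpose G) = G" using herm_pd_conj_mat[OF G] by simp
  finally have M: "?M = conj_mat (transpose ?M)" by (rule matrix_inv_eq)
  have "gram ?M a b = (\<Sum>k\<in>UNIV. a $ k * cnj ((transpose (conj_mat ?M) *v b) $ k))"
    unfolding gram_alt by (rule sum_mult_cnj_adjoint)
  also have "transpose (conj_mat ?M) = ?M" using M by (simp add: transpose_conj_mat)
  also have "(\<Sum>k\<in>UNIV. a $ k * cnj ((?M *v b) $ k)) = cnj (gram ?M b a)" by (simp add: gram_alt mult.commute)
  finally show ?thesis by simp
qed

lemma C1_on_det:
  fixes G :: "'e::euclidean_space \<Rightarrow> complex^'n::finite^'n"
  shows "(\<And>i j. C1_on S (\<lambda>z. G z $ i $ j)) \<Longrightarrow> C1_on S (\<lambda>z. det (G z))"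
  unfolding det_def by (intro C1_on_sum C1_on_mult C1_on_prod C1_on_const)

lemma matrix_inv_cramer:
  fixes G :: "complex^'n::finite^'n"
  assumes "det G \<noteq> 0"
  shows "matrix_inv G $ k $ j = det (\<chi> i l. if l = k then (if i = j then 1 else 0) else G $ i $ l) * inverse (det G)"
proof -
  have "G *v (matrix_inv G *v axis j 1) = axis j 1"
    by (simp add: matrix_vector_mul_assoc matrix_inv_nz(2)[OF assms])
  then have "matrix_inv G *v axis j 1 = (\<chi> k. det (\<chi> i l. if l = k then axis j 1 $ i else G $ i $ l) / det G)"
    using cramer[OF assms] by blast
  moreover have "(matrix_inv G *v axis j 1) $ k = matrix_inv G $ k $ j"
    by (simp add: matrix_vector_mult_def axis_def if_distrib cong: if_cong)
  ultimately show ?thesis by (simp add: axis_def field_simps eq_commute[of j] cong: if_cong)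
qed

lemma C1_on_matrix_inv:
  fixes G :: "'e::euclidean_space \<Rightarrow> complex^'n::finite^'n"
  assumes op: "open S" and G: "\<And>i j. C1_on S (\<lambda>z. G z $ i $ j)" and nz: "\<And>z. z \<in> S \<Longrightarrow> det (G z) \<noteq> 0"
  shows "C1_on S (\<lambda>z. matrix_inv (G z) $ k $ j)"
proof (rule C1_on_cong_open[OF op])
  show "det (\<chi> i l. if l = k then (if i = j then 1 else 0) else G z $ i $ l) * inverse (det (G z)) = matrix_inv (G z) $ k $ j"
    if "z \<in> S" for z using matrix_inv_cramer[OF nz[OF that]] by simp
  show "C1_on S (\<lambda>z. det (\<chi> i l. if l = k then (if i = j then 1 else 0) else G z $ i $ l) * inverse (det (G z)))"
  proof (intro C1_on_mult C1_on_inverse C1_on_det G nz)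
    fix i l show "C1_on S (\<lambda>z. (\<chi> i l. if l = k then (if i = j then 1 else 0) else G z $ i $ l) $ i $ l)"
      using G by (cases "l = k") auto
  qed
qed

section \<open>Wirtinger derivatives\<close>

text \<open>The decomposition of a real-linear map into its complex-linear part \<open>holo_part\<close> and its complex-antilinear part
  \<open>antiholo_part\<close>.  Their coefficients for a derivative are the Wirtinger derivatives.\<close>

definition holo_part :: "(complex^'n \<Rightarrow> complex) \<Rightarrow> complex^'n \<Rightarrow> complex" where
  "holo_part l v = (l v - \<i> * l (\<i> *s v)) / 2"

definition antiholo_part :: "(complex^'n \<Rightarrow> complex) \<Rightarrow> complex^'n \<Rightarrow> complex" where
  "antiholo_part l v = (l v + \<i> * l (\<i> *s v)) / 2"

lemma ii_axis: "\<i> *s axis j (1::complex) = axis j \<i>"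
  by (simp add: vec_eq_iff axis_def)

lemma dz_eq_holo_part: "dz j f z = holo_part (fd f z) (axis j 1)"
  by (simp add: dz_def holo_part_def ii_axis)

lemma dzbar_eq_antiholo_part: "dzbar j f z = antiholo_part (fd f z) (axis j 1)"
  by (simp add: dzbar_def antiholo_part_def ii_axis)

lemma complex_vec_expand: "v = (\<Sum>j\<in>UNIV. Re (v $ j) *\<^sub>R axis j 1 + Im (v $ j) *\<^sub>R (\<i> *s axis j (1::complex)))"
proof -
  have "(\<Sum>j\<in>UNIV. Re (v $ j) *\<^sub>R axis j 1 + Im (v $ j) *\<^sub>R (\<i> *s axis j (1::complex))) $ i = v $ i" for i
  proof -
    have "(\<Sum>j\<in>UNIV. Re (v $ j) *\<^sub>R axis j 1 + Im (v $ j) *\<^sub>R (\<i> *s axis j (1::complex))) $ i =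
        (\<Sum>j\<in>UNIV. if j = i then v $ i else 0)"
      unfolding sum_component by (intro sum.cong refl) (auto simp: axis_def complex_eq_iff)
    then show ?thesis by simp
  qed
  then show ?thesis by (simp add: vec_eq_iff)
qed

lemma ii_ii: "\<i> *s (\<i> *s v) = - (v :: complex^'n)"
  by (simp add: vec_eq_iff)

lemma scale_ii: "\<i> *s (r *\<^sub>R v) = r *\<^sub>R (\<i> *s (v :: complex^'n))"
  by (simp add: vec_eq_iff)

lemma holo_part_expand:
  assumes l: "linear l" shows "holo_part l v = (\<Sum>j\<in>UNIV. v $ j * holo_part l (axis j 1))"
proof -
  have lin: "linear (holo_part l)"
  proof (rule linearI)
    show "holo_part l (v + w) = holo_part l v + holo_part l w" for v w
      by (simp add: holo_part_def vector_add_ldistrib linear_add[OF l] field_simps)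
    show "holo_part l (r *\<^sub>R v) = r *\<^sub>R holo_part l v" for r v
      unfolding holo_part_def scale_ii linear_cmul[OF l] by (simp add: scaleR_conv_of_real[where 'a = complex] algebra_simps)
  qed
  have ii: "holo_part l (\<i> *s w) = \<i> * holo_part l w" for w
    by (simp add: holo_part_def ii_ii linear_neg[OF l] field_simps)
  have "holo_part l v = (\<Sum>j\<in>UNIV. Re (v $ j) *\<^sub>R holo_part l (axis j 1) + Im (v $ j) *\<^sub>R holo_part l (\<i> *s axis j 1))"
    by (subst complex_vec_expand) (simp add: linear_sum[OF lin] linear_add[OF lin] linear_cmul[OF lin])
  also have "\<dots> = (\<Sum>j\<in>UNIV. v $ j * holo_part l (axis j 1))"
    unfolding ii by (intro sum.cong refl) (simp add: scaleR_conv_of_real complex_eq_iff)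
  finally show ?thesis .
qed

lemma antiholo_part_expand:
  assumes l: "linear l" shows "antiholo_part l v = (\<Sum>j\<in>UNIV. cnj (v $ j) * antiholo_part l (axis j 1))"
proof -
  have lin: "linear (antiholo_part l)"
  proof (rule linearI)
    show "antiholo_part l (v + w) = antiholo_part l v + antiholo_part l w" for v w
      by (simp add: antiholo_part_def vector_add_ldistrib linear_add[OF l] field_simps)
    show "antiholo_part l (r *\<^sub>R v) = r *\<^sub>R antiholo_part l v" for r v
      unfolding antiholo_part_def scale_ii linear_cmul[OF l] by (simp add: scaleR_conv_of_real[where 'a = complex] algebra_simps)
  qed
  have ii: "antiholo_part l (\<i> *s w) = - \<i> * antiholo_part l w" for w
    by (simp add: antiholo_part_def ii_ii linear_neg[OF l] field_simps)
  have "antiholo_part l v = (\<Sum>j\<in>UNIV. Re (v $ j) *\<^sub>R antiholo_part l (axis j 1) + Im (v $ j) *\<^sub>R antiholo_part l (\<i> *s axis j 1))"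
    by (subst complex_vec_expand) (simp add: linear_sum[OF lin] linear_add[OF lin] linear_cmul[OF lin])
  also have "\<dots> = (\<Sum>j\<in>UNIV. cnj (v $ j) * antiholo_part l (axis j 1))"
    unfolding ii by (intro sum.cong refl) (simp add: scaleR_conv_of_real complex_eq_iff)
  finally show ?thesis .
qed

lemma mv_ii: "(J :: complex^'n^'m) *v (\<i> *s v) = \<i> *s (J *v v)"
  by (simp add: vec_eq_iff matrix_vector_mult_def sum_distrib_left mult_ac)

lemma holo_part_compose: "holo_part (\<lambda>v. l (J *v v)) v = holo_part l (J *v v)"
  by (simp add: holo_part_def mv_ii)

lemma antiholo_part_compose: "antiholo_part (\<lambda>v. l (J *v v)) v = antiholo_part l (J *v v)"
  by (simp add: antiholo_part_def mv_ii)

lemma mv_axis: "((J :: complex^'n^'m) *v axis k 1) $ b = J $ b $ k"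
  by (simp add: matrix_vector_mult_def axis_def if_distrib cong: if_cong)

lemma dz_chain:
  assumes f: "(f has_derivative (*v) J) (at z)" and U: "U differentiable at (f z)"
  shows "dz j (\<lambda>w. U (f w)) z = (\<Sum>a\<in>UNIV. J $ a $ j * dz a U (f z))"
    and "dzbar j (\<lambda>w. U (f w)) z = (\<Sum>a\<in>UNIV. cnj (J $ a $ j) * dzbar a U (f z))"
proof -
  have dU: "(U has_derivative fd U (f z)) (at (f z))" using U by (simp add: frechet_derivative_works)
  have lin: "linear (fd U (f z))" using dU has_derivative_linear by blast
  have "((\<lambda>w. U (f w)) has_derivative (\<lambda>v. fd U (f z) (J *v v))) (at z)"
    using diff_chain_at[OF f dU] by (simp add: o_def)
  then have eq: "fd (\<lambda>w. U (f w)) z = (\<lambda>v. fd U (f z) (J *v v))" by (rule frechet_derivative_at[symmetric])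
  show "dz j (\<lambda>w. U (f w)) z = (\<Sum>a\<in>UNIV. J $ a $ j * dz a U (f z))"
    unfolding dz_eq_holo_part eq holo_part_compose by (subst holo_part_expand[OF lin]) (simp only: mv_axis)
  show "dzbar j (\<lambda>w. U (f w)) z = (\<Sum>a\<in>UNIV. cnj (J $ a $ j) * dzbar a U (f z))"
    unfolding dzbar_eq_antiholo_part eq antiholo_part_compose by (subst antiholo_part_expand[OF lin]) (simp only: mv_axis)
qed

lemma dz_has_derivative:
  "(f has_derivative f') (at z) \<Longrightarrow> dz j f z = (f' (axis j 1) - \<i> * f' (axis j \<i>)) / 2"
  unfolding dz_def using frechet_derivative_at[of f f' z] by simp

lemma dz_mult:
  assumes "f differentiable at z" "g differentiable at z"
  shows "dz j (\<lambda>z. f z * g z) z = f z * dz j g z + dz j f z * g z"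
proof -
  have "((\<lambda>z. f z * g z) has_derivative (\<lambda>v. f z * fd g z v + fd f z v * g z)) (at z)"
    using assms unfolding frechet_derivative_works by (rule has_derivative_mult)
  from dz_has_derivative[OF this, of j] show ?thesis
    unfolding dz_def[of j f] dz_def[of j g]
    by (simp add: diff_divide_distrib add_divide_distrib ring_distribs mult.left_commute mult.commute)
qed

lemma dz_cong:
  assumes "open S" "z \<in> S" "\<And>w. w \<in> S \<Longrightarrow> f w = g w" "f differentiable at z"
  shows "dz j f z = dz j g z"
proof -
  have "(f has_derivative fd f z) (at z)" using assms(4) by (simp add: frechet_derivative_works)
  then have "(g has_derivative fd f z) (at z)" using has_derivative_transform_within_open assms(1-3) by blast
  then have "fd g z = fd f z" by (rule frechet_derivative_at[symmetric])
  then show ?thesis by (simp add: dz_def)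
qed

lemma continuous_on_dz: "C1_on S f \<Longrightarrow> continuous_on S (dz j f)"
  unfolding dz_def[abs_def] by (intro continuous_intros C1_onD(2)) auto

lemma C1_on_of_real: "C1_on S f \<Longrightarrow> C1_on S (\<lambda>z. complex_of_real (f z))"
  by (rule C1_on_bounded_linear[OF bounded_linear_of_real])

lemma fd_of_real:
  assumes "u differentiable at z" shows "fd (\<lambda>z. complex_of_real (u z)) z v = of_real (fd u z v)"
proof -
  have "((\<lambda>z. complex_of_real (u z)) has_derivative (\<lambda>v. of_real (fd u z v))) (at z)"
    using assms unfolding frechet_derivative_works by (rule bounded_linear.has_derivative[OF bounded_linear_of_real])
  from frechet_derivative_at[OF this] show ?thesis by metis
qed

lemma cnj_dzbar_of_real:
  assumes "u differentiable at z"
  shows "dzbar j (\<lambda>z. complex_of_real (u z)) z = cnj (dz j (\<lambda>z. complex_of_real (u z)) z)"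
  by (simp add: dz_def dzbar_def fd_of_real[OF assms])

section \<open>Integration by parts and the Kaehler identity\<close>

lemma C1_on_extend_0:
  fixes f :: "'e::euclidean_space \<Rightarrow> 'f::real_normed_vector"
  assumes S: "open S" and f: "C1_on S f" and K: "compact K" "\<And>z. z \<in> S \<Longrightarrow> z \<notin> K \<Longrightarrow> f z = 0" and KS: "K \<subseteq> S"
  shows "C1_on UNIV (\<lambda>z. if z \<in> S then f z else 0)"
proof -
  have "C1_on (S \<union> - K) (\<lambda>z. if z \<in> S then f z else 0)"
  proof (rule C1_on_Un[OF S])
    show op: "open (- K)" using K(1) compact_imp_closed by blast
    show "C1_on S (\<lambda>z. if z \<in> S then f z else 0)" by (rule C1_on_cong_open[OF S _ f]) auto
    show "C1_on (- K) (\<lambda>z. if z \<in> S then f z else 0)"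
      by (rule C1_on_cong_open[OF op, of "\<lambda>z. 0"]) (use K(2) in auto)
  qed
  moreover have "S \<union> - K = UNIV" using KS by auto
  ultimately show ?thesis by simp
qed

lemma fd_outside_0:
  assumes "compact K" "\<And>z. z \<notin> K \<Longrightarrow> g z = 0" "z \<notin> K"
  shows "fd g z = (\<lambda>v. 0)"
proof -
  have "((\<lambda>z. 0) has_derivative (\<lambda>v. 0)) (at z)" by simp
  then have "(g has_derivative (\<lambda>v. 0)) (at z)"
    by (rule has_derivative_transform_within_open[of _ _ _ _ "- K"])
       (use assms compact_imp_closed in auto)
  then show ?thesis by (rule frechet_derivative_at[symmetric])
qed

lemma integrable_compact_support:
  fixes f :: "'e::euclidean_space \<Rightarrow> 'b::{banach,second_countable_topology}"
  assumes "compact K" "continuous_on K f" "\<And>z. z \<notin> K \<Longrightarrow> f z = 0"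
  shows "integrable lborel f"
proof -
  have "integrable lborel (\<lambda>z. indicator K z *\<^sub>R f z)" by (rule borel_integrable_compact[OF assms(1,2)])
  moreover have "(\<lambda>z. indicator K z *\<^sub>R f z) = f" using assms(3) by (auto simp: fun_eq_iff indicator_def)
  ultimately show ?thesis by simp
qed

lemma integral_dz_0:
  fixes g :: "complex^'n::finite \<Rightarrow> complex"
  assumes g: "C1_on UNIV g" and K: "compact K" "\<And>z. z \<notin> K \<Longrightarrow> g z = 0"
  shows "integrable lborel (dz j g)" "(\<integral>z. dz j g z \<partial>lborel) = 0"
proof -
  have i: "integrable lborel (\<lambda>z. fd g z v)" for v
  proof (rule integrable_compact_support[OF K(1)])
    show "continuous_on K (\<lambda>z. fd g z v)" by (rule continuous_on_subset[OF C1_onD(2)[OF g] subset_UNIV])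
    show "fd g z v = 0" if "z \<notin> K" for z using fd_outside_0[OF K that] by simp
  qed
  show "integrable lborel (dz j g)" unfolding dz_def[abs_def]
    by (intro integrable_divide Bochner_Integration.integrable_diff integrable_mult_right i)
  show "(\<integral>z. dz j g z \<partial>lborel) = 0" unfolding dz_def
    using i integral_directional_derivative_0[OF g K] by simp
qed

text \<open>The integral of the \<open>j\<close>-th Wirtinger derivative of \<open>f \<eta>\<close>, extended by 0, vanishes.\<close>

lemma integral_by_parts_dz:
  fixes f \<eta> :: "complex^'n::finite \<Rightarrow> complex"
  assumes S: "open S" and f: "C1_on S f" and \<eta>: "C1_on UNIV \<eta>"
    and K: "compact K" "K \<subseteq> S" "\<And>z. z \<notin> K \<Longrightarrow> \<eta> z = 0"
  shows "(LINT z:S|lborel. f z * dz j \<eta> z) = - (LINT z:S|lborel. dz j f z * \<eta> z)"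
    and "set_integrable lborel S (\<lambda>z. f z * dz j \<eta> z)" "set_integrable lborel S (\<lambda>z. dz j f z * \<eta> z)"
proof -
  define F where "F z = (if z \<in> S then f z * \<eta> z else 0)" for z
  have F1: "C1_on UNIV F" unfolding F_def
    by (rule C1_on_extend_0[OF S _ K(1) _ K(2)]) (use K(3) in \<open>auto intro!: C1_on_mult f C1_on_subset[OF \<eta> subset_UNIV]\<close>)
  have F0: "F z = 0" if "z \<notin> K" for z using K(3)[OF that] by (simp add: F_def)
  have dz0: "dz j \<eta> z = 0" if "z \<notin> K" for z using fd_outside_0[OF K(1) K(3) that] by (simp add: dz_def)
  have dzF0: "dz j F z = 0" if "z \<notin> K" for z using fd_outside_0[OF K(1) F0 that] by (simp add: dz_def)
  have eq: "dz j F z = indicator S z *\<^sub>R (f z * dz j \<eta> z) + indicator S z *\<^sub>R (dz j f z * \<eta> z)" for z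
  proof (cases "z \<in> S")
    case True
    have d: "f differentiable at z" "\<eta> differentiable at z" using C1_on_differentiable[OF f True] C1_on_differentiable[OF \<eta>] by auto
    have "dz j F z = dz j (\<lambda>z. f z * \<eta> z) z"
      by (rule dz_cong[OF S True]) (use C1_on_differentiable[OF F1] in \<open>auto simp: F_def\<close>)
    then show ?thesis using dz_mult[OF d, of j] True by simp
  next
    case False
    then show ?thesis using dzF0[of z] K(2) by auto
  qed
  have cf: "continuous_on K f" "continuous_on K (dz j f)"
    using C1_on_imp_continuous_on[OF f] continuous_on_dz[OF f] continuous_on_subset K(2) by blast+
  have ce: "continuous_on K \<eta>" "continuous_on K (dz j \<eta>)"
    using C1_on_imp_continuous_on[OF \<eta>] continuous_on_dz[OF \<eta>] continuous_on_subset by blast+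
  have ind: "continuous_on K (\<lambda>z. indicator S z *\<^sub>R h z)" if "continuous_on K h" for h :: "_ \<Rightarrow> complex"
    by (rule continuous_on_cong[THEN iffD1, OF refl _ that]) (use K(2) in auto)
  have i1: "integrable lborel (\<lambda>z. indicator S z *\<^sub>R (f z * dz j \<eta> z))"
    by (rule integrable_compact_support[OF K(1) ind]) (use cf ce dz0 in \<open>auto intro!: continuous_on_mult\<close>)
  have i2: "integrable lborel (\<lambda>z. indicator S z *\<^sub>R (dz j f z * \<eta> z))"
    by (rule integrable_compact_support[OF K(1) ind]) (use cf ce K(3) in \<open>auto intro!: continuous_on_mult\<close>)
  show "set_integrable lborel S (\<lambda>z. f z * dz j \<eta> z)" "set_integrable lborel S (\<lambda>z. dz j f z * \<eta> z)"
    using i1 i2 by (simp_all add: set_integrable_def)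
  have "0 = (\<integral>z. dz j F z \<partial>lborel)" using integral_dz_0(2)[OF F1 K(1) F0] by simp
  also have "\<dots> = (LINT z:S|lborel. f z * dz j \<eta> z) + (LINT z:S|lborel. dz j f z * \<eta> z)"
    unfolding eq set_lebesgue_integral_def using i1 i2 by simp
  finally show "(LINT z:S|lborel. f z * dz j \<eta> z) = - (LINT z:S|lborel. dz j f z * \<eta> z)"
    by (metis eq_neg_iff_add_eq_0)
qed

text \<open>By Jacobi's formula and \<open>\<partial>(M) = - M (\<partial>G) M\<close> for \<open>M = matrix_inv G\<close>, the \<open>j\<close>-th summand is
  \<open>det G * (\<Sum>a b. (M\<^sub>b\<^sub>a M\<^sub>k\<^sub>j - M\<^sub>k\<^sub>a M\<^sub>b\<^sub>j) \<partial>\<^sub>j G\<^sub>a\<^sub>b)\<close>.  The Kaehler condition makes \<open>\<partial>\<^sub>j G\<^sub>a\<^sub>b\<close> symmetric in \<open>j\<close> and \<open>a\<close>,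
  whereas the bracket is antisymmetric in them.\<close>

lemma kahler_divergence_0:
  fixes G :: "complex^'n::finite \<Rightarrow> complex^'n^'n"
  assumes S: "open S" and G: "\<And>a b. C1_on S (\<lambda>z. G z $ a $ b)" and nz: "\<And>z. z \<in> S \<Longrightarrow> det (G z) \<noteq> 0"
    and kahler: "\<And>z j k l. z \<in> S \<Longrightarrow> dz l (\<lambda>z. G z $ j $ k) z = dz j (\<lambda>z. G z $ l $ k) z"
    and z: "z \<in> S"
  shows "(\<Sum>j\<in>UNIV. dz j (\<lambda>z. det (G z) * matrix_inv (G z) $ k $ j) z) = 0"
proof -
  define M where "M = matrix_inv (G z)"
  define d where "d = det (G z)"
  define G' where "G' v = (\<chi> a b. fd (\<lambda>z. G z $ a $ b) z v)" for v
  define M' where "M' v = (\<chi> a b. fd (\<lambda>z. matrix_inv (G z) $ a $ b) z v)" for v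
  have MG: "M ** G z = mat 1" "G z ** M = mat 1" unfolding M_def using matrix_inv_nz[OF nz[OF z]] by auto
  have MC: "C1_on S (\<lambda>z. matrix_inv (G z) $ a $ b)" for a b by (rule C1_on_matrix_inv[OF S G nz])
  have dG: "((\<lambda>z. G z $ a $ b) has_derivative (\<lambda>v. G' v $ a $ b)) (at z)" for a b
    using C1_onD(1)[OF G z, of a b] by (simp add: G'_def)
  have dM: "((\<lambda>z. matrix_inv (G z) $ a $ b) has_derivative (\<lambda>v. M' v $ a $ b)) (at z)" for a b
    using C1_onD(1)[OF MC z, of a b] by (simp add: M'_def)
  have ddet: "((\<lambda>z. det (G z)) has_derivative (\<lambda>v. d * trace (M ** G' v))) (at z)"
    unfolding d_def by (rule has_derivative_det[where G = G, OF dG MG(1)])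
  have M'G: "M' v ** G z + M ** G' v = 0" for v
  proof -
    have "(M' v ** G z + M ** G' v) $ a $ c = 0" for a c
    proof -
      have "((\<lambda>w. \<Sum>b\<in>UNIV. matrix_inv (G w) $ a $ b * G w $ b $ c) has_derivative
          (\<lambda>v. \<Sum>b\<in>UNIV. matrix_inv (G z) $ a $ b * G' v $ b $ c + M' v $ a $ b * G z $ b $ c)) (at z)"
        by (intro has_derivative_sum has_derivative_mult dM dG)
      moreover have "((\<lambda>w. \<Sum>b\<in>UNIV. matrix_inv (G w) $ a $ b * G w $ b $ c) has_derivative (\<lambda>v. 0)) (at z)"
      proof (rule has_derivative_transform_within_open[OF _ S z])
        show "((\<lambda>w. (mat 1 :: complex^'n^'n) $ a $ c) has_derivative (\<lambda>v. 0)) (at z)" by simp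
        show "mat 1 $ a $ c = (\<Sum>b\<in>UNIV. matrix_inv (G w) $ a $ b * G w $ b $ c)" if "w \<in> S" for w
        proof -
          have "mat 1 $ a $ c = (matrix_inv (G w) ** G w) $ a $ c" by (simp only: matrix_inv_nz(1)[OF nz[OF that]])
          then show ?thesis unfolding matrix_matrix_mult_def vec_lambda_beta .
        qed
      qed
      ultimately have "(\<lambda>v. \<Sum>b\<in>UNIV. matrix_inv (G z) $ a $ b * G' v $ b $ c + M' v $ a $ b * G z $ b $ c) = (\<lambda>v. 0)"
        by (rule has_derivative_unique)
      from fun_cong[OF this, of v] show ?thesis
        by (simp add: matrix_matrix_mult_def M_def sum.distrib add.commute)
    qed
    then show ?thesis by (simp add: vec_eq_iff)
  qed
  have M'eq: "M' v = - (M ** G' v ** M)" for v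
  proof -
    have "M' v ** G z = - (M ** G' v)" using M'G[of v] by (simp add: eq_neg_iff_add_eq_0)
    then have "M' v ** G z ** M = - (M ** G' v) ** M" by simp
    also have "- (M ** G' v) ** M = - (M ** G' v ** M)"
      by (simp add: matrix_matrix_mult_def vec_eq_iff sum_negf)
    also have "M' v ** G z ** M = M' v" by (simp only: matrix_mul_assoc[symmetric] MG matrix_mul_rid)
    finally show ?thesis .
  qed
  define P where "P j a b = dz j (\<lambda>z. G z $ a $ b) z" for j a b
  have P: "P j a b = P a j b" for j a b unfolding P_def by (rule kahler[OF z])
  have PG: "P j a b = (G' (axis j 1) $ a $ b - \<i> * G' (axis j \<i>) $ a $ b) / 2" for j a b
    unfolding P_def by (rule dz_has_derivative[OF dG])
  have main: "dz j (\<lambda>z. det (G z) * matrix_inv (G z) $ k $ j) z =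
      d * (\<Sum>a\<in>UNIV. \<Sum>b\<in>UNIV. (M $ b $ a * M $ k $ j - M $ k $ a * M $ b $ j) * P j a b)" for j
  proof -
    define R where "R v = d * (\<Sum>a\<in>UNIV. \<Sum>b\<in>UNIV. (M $ b $ a * M $ k $ j - M $ k $ a * M $ b $ j) * G' v $ a $ b)" for v
    have tr: "trace (M ** G' v) = (\<Sum>a\<in>UNIV. \<Sum>b\<in>UNIV. M $ b $ a * G' v $ a $ b)" for v
      unfolding trace_def matrix_matrix_mult_def by (simp, rule sum.swap)
    have mm: "(M ** G' v ** M) $ k $ j = (\<Sum>a\<in>UNIV. \<Sum>b\<in>UNIV. M $ k $ a * M $ b $ j * G' v $ a $ b)" for v
      unfolding matrix_matrix_mult_def vec_lambda_beta sum_distrib_right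
      by (subst sum.swap) (intro sum.cong refl, simp only: mult_ac)
    have "((\<lambda>z. det (G z) * matrix_inv (G z) $ k $ j) has_derivative
        (\<lambda>v. det (G z) * M' v $ k $ j + d * trace (M ** G' v) * matrix_inv (G z) $ k $ j)) (at z)"
      by (rule has_derivative_mult[OF ddet dM])
    also have "(\<lambda>v. det (G z) * M' v $ k $ j + d * trace (M ** G' v) * matrix_inv (G z) $ k $ j) = R"
    proof
      fix v
      show "det (G z) * M' v $ k $ j + d * trace (M ** G' v) * matrix_inv (G z) $ k $ j = R v"
      proof -
        have "M' v $ k $ j = - (M ** G' v ** M) $ k $ j" by (simp add: M'eq)
        then have 1: "M' v $ k $ j = - (\<Sum>a\<in>UNIV. \<Sum>b\<in>UNIV. M $ k $ a * M $ b $ j * G' v $ a $ b)" by (simp only: mm)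
        have 2: "trace (M ** G' v) * M $ k $ j = (\<Sum>a\<in>UNIV. \<Sum>b\<in>UNIV. M $ b $ a * M $ k $ j * G' v $ a $ b)"
          unfolding tr sum_distrib_right by (intro sum.cong refl) (simp only: mult_ac)
        have "R v = d * ((\<Sum>a\<in>UNIV. \<Sum>b\<in>UNIV. M $ b $ a * M $ k $ j * G' v $ a $ b) -
            (\<Sum>a\<in>UNIV. \<Sum>b\<in>UNIV. M $ k $ a * M $ b $ j * G' v $ a $ b))"
          unfolding R_def by (simp only: left_diff_distrib sum_subtractf)
        then show ?thesis unfolding d_def[symmetric] M_def[symmetric] 1 2[symmetric] by (simp add: algebra_simps)
      qed
    qed
    finally have "dz j (\<lambda>z. det (G z) * matrix_inv (G z) $ k $ j) z = (R (axis j 1) - \<i> * R (axis j \<i>)) / 2"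
      by (rule dz_has_derivative)
    also have "\<dots> = d * (\<Sum>a\<in>UNIV. \<Sum>b\<in>UNIV. (M $ b $ a * M $ k $ j - M $ k $ a * M $ b $ j) * P j a b)"
    proof -
      define c where "c a b = M $ b $ a * M $ k $ j - M $ k $ a * M $ b $ j" for a b
      have "(\<Sum>a\<in>UNIV. \<Sum>b\<in>UNIV. c a b * P j a b) =
        (\<Sum>a\<in>UNIV. \<Sum>b\<in>UNIV. c a b * G' (axis j 1) $ a $ b / 2 - \<i> * (c a b * G' (axis j \<i>) $ a $ b) / 2)"
        unfolding PG by (intro sum.cong refl) (simp add: field_simps)
      also have "\<dots> = (\<Sum>a\<in>UNIV. \<Sum>b\<in>UNIV. c a b * G' (axis j 1) $ a $ b) / 2 - \<i> * (\<Sum>a\<in>UNIV. \<Sum>b\<in>UNIV. c a b * G' (axis j \<i>) $ a $ b) / 2"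
        by (simp only: sum_subtractf sum_divide_distrib sum_distrib_left)
      finally have e: "(\<Sum>a\<in>UNIV. \<Sum>b\<in>UNIV. c a b * P j a b) = (\<Sum>a\<in>UNIV. \<Sum>b\<in>UNIV. c a b * G' (axis j 1) $ a $ b) / 2 - \<i> * (\<Sum>a\<in>UNIV. \<Sum>b\<in>UNIV. c a b * G' (axis j \<i>) $ a $ b) / 2" .
      show ?thesis unfolding R_def c_def[symmetric] e
        by (simp add: diff_divide_distrib right_diff_distrib mult.left_commute)
    qed
    finally show ?thesis .
  qed
  have "(\<Sum>j\<in>UNIV. \<Sum>a\<in>UNIV. \<Sum>b\<in>UNIV. M $ k $ a * M $ b $ j * P j a b) =
      (\<Sum>a\<in>UNIV. \<Sum>j\<in>UNIV. \<Sum>b\<in>UNIV. M $ k $ a * M $ b $ j * P j a b)" by (rule sum.swap)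
  also have "\<dots> = (\<Sum>j\<in>UNIV. \<Sum>a\<in>UNIV. \<Sum>b\<in>UNIV. M $ b $ a * M $ k $ j * P j a b)"
    by (intro sum.cong refl) (subst P, simp only: mult_ac)
  finally have "(\<Sum>j\<in>UNIV. \<Sum>a\<in>UNIV. \<Sum>b\<in>UNIV. (M $ b $ a * M $ k $ j - M $ k $ a * M $ b $ j) * P j a b) = 0"
    by (simp add: left_diff_distrib sum_subtractf)
  then show ?thesis unfolding main by (simp flip: sum_distrib_left)
qed


lemma set_integral_double_sum:
  fixes h :: "'i \<Rightarrow> 'j \<Rightarrow> 'a \<Rightarrow> complex"
  assumes "finite I" "finite J" "\<And>i j. i \<in> I \<Longrightarrow> j \<in> J \<Longrightarrow> set_integrable M S (h i j)"
  shows "(LINT z:S|M. (\<Sum>i\<in>I. \<Sum>j\<in>J. h i j z)) = (\<Sum>i\<in>I. \<Sum>j\<in>J. (LINT z:S|M. h i j z))"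
proof -
  let ?h = "\<lambda>i j z. indicator S z *\<^sub>R h i j z"
  have i: "integrable M (?h i j)" if "i \<in> I" "j \<in> J" for i j
    using assms(3)[OF that] by (simp only: set_integrable_def)
  have "(\<integral>z. (\<Sum>i\<in>I. \<Sum>j\<in>J. ?h i j z) \<partial>M) = (\<Sum>i\<in>I. \<integral>z. (\<Sum>j\<in>J. ?h i j z) \<partial>M)"
    by (rule Bochner_Integration.integral_sum) (intro Bochner_Integration.integrable_sum i)
  also have "\<dots> = (\<Sum>i\<in>I. \<Sum>j\<in>J. \<integral>z. ?h i j z \<partial>M)"
    by (intro sum.cong[OF refl] Bochner_Integration.integral_sum i)
  finally show ?thesis by (simp only: set_lebesgue_integral_def scaleR_sum_right)
qed

text \<open>Integration by parts for each pair \<open>j\<close>, \<open>k\<close>; the terms in which the derivative falls on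
  \<open>det G * matrix_inv G\<close> cancel in the sum.\<close>

lemma integral_by_parts_laplace:
  fixes G :: "complex^'n::finite \<Rightarrow> complex^'n^'n" and V :: "'n \<Rightarrow> complex^'n \<Rightarrow> complex"
  assumes S: "open S" and G: "\<And>a b. C1_on S (\<lambda>z. G z $ a $ b)" and nz: "\<And>z. z \<in> S \<Longrightarrow> det (G z) \<noteq> 0"
    and kahler: "\<And>z j k l. z \<in> S \<Longrightarrow> dz l (\<lambda>z. G z $ j $ k) z = dz j (\<lambda>z. G z $ l $ k) z"
    and V: "\<And>k. C1_on S (V k)" and \<psi>: "C1_on UNIV \<psi>"
    and K: "compact K" "K \<subseteq> S" "\<And>z. z \<notin> K \<Longrightarrow> \<psi> z = 0"
  shows "(LINT z:S|lborel. (\<Sum>j\<in>UNIV. \<Sum>k\<in>UNIV. matrix_inv (G z) $ k $ j * dz j (V k) z) * \<psi> z * det (G z)) =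
     - (LINT z:S|lborel. (\<Sum>j\<in>UNIV. \<Sum>k\<in>UNIV. matrix_inv (G z) $ k $ j * dz j \<psi> z * V k z) * det (G z))"
proof -
  define A where "A k j z = det (G z) * matrix_inv (G z) $ k $ j" for k j z
  have A: "C1_on S (A k j)" for k j unfolding A_def[abs_def]
    by (intro C1_on_mult C1_on_det G C1_on_matrix_inv[OF S G nz])
  have AV: "C1_on S (\<lambda>z. A k j z * V k z)" for k j by (intro C1_on_mult A V)
  note ibp = integral_by_parts_dz[OF S AV \<psi> K]
  have meas: "S \<in> sets lborel" using S by simp
  have div: "(\<Sum>j\<in>UNIV. \<Sum>k\<in>UNIV. dz j (\<lambda>z. A k j z * V k z) z) = (\<Sum>j\<in>UNIV. \<Sum>k\<in>UNIV. A k j z * dz j (V k) z)"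
    if z: "z \<in> S" for z
  proof -
    have "(\<Sum>j\<in>UNIV. \<Sum>k\<in>UNIV. dz j (\<lambda>z. A k j z * V k z) z) =
      (\<Sum>j\<in>UNIV. \<Sum>k\<in>UNIV. A k j z * dz j (V k) z + dz j (A k j) z * V k z)"
      by (intro sum.cong refl dz_mult C1_on_differentiable[OF A z] C1_on_differentiable[OF V z])
    also have "\<dots> = (\<Sum>j\<in>UNIV. \<Sum>k\<in>UNIV. A k j z * dz j (V k) z) + (\<Sum>j\<in>UNIV. \<Sum>k\<in>UNIV. dz j (A k j) z * V k z)"
      by (simp add: sum.distrib)
    also have "(\<Sum>j\<in>UNIV. \<Sum>k\<in>UNIV. dz j (A k j) z * V k z) = (\<Sum>k\<in>UNIV. (\<Sum>j\<in>UNIV. dz j (A k j) z) * V k z)"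
      by (subst sum.swap) (simp add: sum_distrib_right)
    also have "\<dots> = 0"
      unfolding A_def[abs_def] using kahler_divergence_0[OF S G nz kahler z] by simp
    finally show ?thesis by simp
  qed
  have "(LINT z:S|lborel. (\<Sum>j\<in>UNIV. \<Sum>k\<in>UNIV. matrix_inv (G z) $ k $ j * dz j \<psi> z * V k z) * det (G z)) =
     (LINT z:S|lborel. (\<Sum>j\<in>UNIV. \<Sum>k\<in>UNIV. (A k j z * V k z) * dz j \<psi> z))"
    by (rule arg_cong[where f = "\<lambda>h. set_lebesgue_integral lborel S h"], rule ext)
       (simp add: A_def sum_distrib_right sum_distrib_left mult_ac)
  also have "\<dots> = (\<Sum>j\<in>UNIV. \<Sum>k\<in>UNIV. (LINT z:S|lborel. (A k j z * V k z) * dz j \<psi> z))"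
    by (rule set_integral_double_sum) (auto intro: ibp(2))
  also have "\<dots> = - (\<Sum>j\<in>UNIV. \<Sum>k\<in>UNIV. (LINT z:S|lborel. dz j (\<lambda>z. A k j z * V k z) z * \<psi> z))"
    by (simp add: ibp(1) sum_negf)
  also have "(\<Sum>j\<in>UNIV. \<Sum>k\<in>UNIV. (LINT z:S|lborel. dz j (\<lambda>z. A k j z * V k z) z * \<psi> z)) =
     (LINT z:S|lborel. (\<Sum>j\<in>UNIV. \<Sum>k\<in>UNIV. dz j (\<lambda>z. A k j z * V k z) z * \<psi> z))"
    by (rule set_integral_double_sum[symmetric]) (auto intro: ibp(3))
  also have "\<dots> = (LINT z:S|lborel. (\<Sum>j\<in>UNIV. \<Sum>k\<in>UNIV. matrix_inv (G z) $ k $ j * dz j (V k) z) * \<psi> z * det (G z))"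
  proof (rule set_lebesgue_integral_cong[OF meas], intro allI impI)
    fix z assume z: "z \<in> S"
    have "(\<Sum>j\<in>UNIV. \<Sum>k\<in>UNIV. dz j (\<lambda>z. A k j z * V k z) z * \<psi> z) =
      (\<Sum>j\<in>UNIV. \<Sum>k\<in>UNIV. A k j z * dz j (V k) z) * \<psi> z"
      unfolding div[OF z, symmetric] sum_distrib_right ..
    also have "\<dots> = (\<Sum>j\<in>UNIV. \<Sum>k\<in>UNIV. matrix_inv (G z) $ k $ j * dz j (V k) z) * \<psi> z * det (G z)"
      by (simp add: A_def sum_distrib_right sum_distrib_left mult_ac)
    finally show "(\<Sum>j\<in>UNIV. \<Sum>k\<in>UNIV. dz j (\<lambda>z. A k j z * V k z) z * \<psi> z) =
      (\<Sum>j\<in>UNIV. \<Sum>k\<in>UNIV. matrix_inv (G z) $ k $ j * dz j (V k) z) * \<psi> z * det (G z)" .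
  qed
  finally show ?thesis by simp
qed

section \<open>Holomorphic maps and the complex Hessian\<close>

lemma norm_smult_complex: "norm (c *s (v :: complex^'n)) = cmod c * norm v"
  by (simp add: norm_vec_def norm_mult L2_set_right_distrib)

lemma holomorphic_on_line:
  fixes f :: "complex^'n::finite \<Rightarrow> complex^'m::finite"
  assumes der: "\<And>z. z \<in> S \<Longrightarrow> (f has_derivative (*v) (J z)) (at z)" and z: "z + \<zeta> *s v \<in> S"
  shows "((\<lambda>\<zeta>. f (z + \<zeta> *s v) $ b) has_field_derivative (J (z + \<zeta> *s v) *v v) $ b) (at \<zeta>)"
proof -
  have lin: "linear (\<lambda>\<zeta>. \<zeta> *s v)" by (rule linearI) (auto simp: vec_eq_iff algebra_simps)
  then have "((\<lambda>\<zeta>. z + \<zeta> *s v) has_derivative (\<lambda>h. h *s v)) (at \<zeta>)"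
    by (intro has_derivative_eq_rhs[OF has_derivative_add[OF has_derivative_const bounded_linear_imp_has_derivative]])
       (auto simp: linear_conv_bounded_linear)
  from diff_chain_at[OF this der[OF z]]
  have "((\<lambda>\<zeta>. f (z + \<zeta> *s v)) has_derivative (\<lambda>h. J (z + \<zeta> *s v) *v (h *s v))) (at \<zeta>)" by (simp add: o_def)
  from bounded_linear.has_derivative[OF bounded_linear_vec_nth this, of b]
  have "((\<lambda>\<zeta>. f (z + \<zeta> *s v) $ b) has_derivative (\<lambda>h. (J (z + \<zeta> *s v) *v (h *s v)) $ b)) (at \<zeta>)" .
  moreover have "(\<lambda>h. (J (z + \<zeta> *s v) *v (h *s v)) $ b) = (*) ((J (z + \<zeta> *s v) *v v) $ b)"
    by (auto simp: matrix_vector_mult_def sum_distrib_left mult_ac fun_eq_iff)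
  ultimately show ?thesis by (simp add: has_field_derivative_def)
qed

text \<open>Complex differentiability at each point is enough for continuity of the derivative.  A directional
  derivative of \<open>f\<close> is the derivative of a holomorphic function of one variable, and by the Cauchy inequality
  it varies little if \<open>f\<close> varies little on a disc.\<close>

lemma C1_on_holomorphic:
  fixes f :: "complex^'n::finite \<Rightarrow> complex^'m::finite"
  assumes S: "open S" and der: "\<And>z. z \<in> S \<Longrightarrow> (f has_derivative (*v) (J z)) (at z)"
  shows "C1_on S f"
proof (rule C1_onI[where f' = "\<lambda>z. (*v) (J z)"])
  show "(f has_derivative (*v) (J z)) (at z)" if "z \<in> S" for z by (rule der[OF that])
  fix v :: "complex^'n"
  have cf: "continuous_on S f"
    using der by (meson continuous_at_imp_continuous_on has_derivative_continuous)
  have "continuous_on S (\<lambda>z. (J z *v v) $ b)" for b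
  proof (cases "v = 0")
    case True then show ?thesis by simp
  next
    case False
    show ?thesis
    proof (rule continuous_onI)
      fix z0 and \<epsilon> :: real assume z0: "z0 \<in> S" and e: "\<epsilon> > 0"
      obtain R where R: "R > 0" "cball z0 R \<subseteq> S" using S z0 open_contains_cball by blast
      define r where "r = R / (2 * norm v)"
      have r: "r > 0" "r * norm v = R / 2" using R False by (auto simp: r_def)
      have "uniformly_continuous_on (cball z0 R) f"
        by (rule compact_uniformly_continuous[OF continuous_on_subset[OF cf R(2)]]) simp
      then obtain \<delta> where d: "\<delta> > 0" "\<And>x y. x \<in> cball z0 R \<Longrightarrow> y \<in> cball z0 R \<Longrightarrow> dist y x < \<delta> \<Longrightarrow> dist (f y) (f x) < \<epsilon> * r"
        unfolding uniformly_continuous_on_def using e r(1) by (metis mult_pos_pos)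
      show "\<exists>d>0. \<forall>z\<in>S. dist z z0 < d \<longrightarrow> dist ((J z *v v) $ b) ((J z0 *v v) $ b) \<le> \<epsilon>"
      proof (intro exI[of _ "min \<delta> (R / 2)"] conjI ballI impI)
        fix z assume z: "z \<in> S" "dist z z0 < min \<delta> (R / 2)"
        have nv: "norm (\<zeta> *s v) \<le> R / 2" if "cmod \<zeta> \<le> r" for \<zeta>
          using mult_right_mono[OF that, of "norm v"] r(2) by (simp add: norm_smult_complex)
        have in1: "z0 + \<zeta> *s v \<in> cball z0 R" if "cmod \<zeta> \<le> r" for \<zeta>
          using nv[OF that] R(1) by (simp add: dist_norm)
        have in2: "z + \<zeta> *s v \<in> cball z0 R" if "cmod \<zeta> \<le> r" for \<zeta>
        proof -
          have "dist z0 (z + \<zeta> *s v) \<le> dist z z0 + norm (\<zeta> *s v)"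
            using norm_triangle_ineq[of "z - z0" "\<zeta> *s v"] by (simp add: dist_norm norm_minus_commute algebra_simps)
          then show ?thesis using nv[OF that] z(2) by simp
        qed
        define h where "h \<zeta> = f (z + \<zeta> *s v) $ b - f (z0 + \<zeta> *s v) $ b" for \<zeta>
        have hd: "(h has_field_derivative (J (z + \<zeta> *s v) *v v) $ b - (J (z0 + \<zeta> *s v) *v v) $ b) (at \<zeta>)"
          if "cmod \<zeta> \<le> r" for \<zeta>
          unfolding h_def[abs_def]
          by (intro DERIV_diff holomorphic_on_line[OF der]) (use in1[OF that] in2[OF that] R(2) in auto)
        have "h holomorphic_on ball 0 r"
          unfolding holomorphic_on_open[OF open_ball]
        proof
          fix \<zeta> :: complex assume "\<zeta> \<in> ball 0 r"
          then have "cmod \<zeta> \<le> r" by simp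
          from hd[OF this] show "\<exists>f'. (h has_field_derivative f') (at \<zeta>)" by blast
        qed
        moreover have "continuous_on (cball 0 r) h"
          using hd by (intro continuous_at_imp_continuous_on ballI) (auto intro: DERIV_isCont)
        moreover have "norm (h \<zeta>) \<le> \<epsilon> * r" if "norm (0 - \<zeta>) = r" for \<zeta>
        proof -
          have c: "cmod \<zeta> \<le> r" using that by simp
          have "dist (f (z + \<zeta> *s v)) (f (z0 + \<zeta> *s v)) < \<epsilon> * r"
            by (rule d(2)[OF in1[OF c] in2[OF c]]) (use z(2) in \<open>simp add: dist_norm\<close>)
          moreover have "norm (h \<zeta>) \<le> norm (f (z + \<zeta> *s v) - f (z0 + \<zeta> *s v))"
            unfolding h_def using Finite_Cartesian_Product.norm_nth_le[of "f (z + \<zeta> *s v) - f (z0 + \<zeta> *s v)" b] by simp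
          ultimately show ?thesis by (simp add: dist_norm)
        qed
        ultimately have "norm ((deriv ^^ 1) h 0) \<le> fact 1 * (\<epsilon> * r) / r ^ 1"
          by (intro Cauchy_inequality[OF _ _ r(1)])
        moreover have "deriv h 0 = (J z *v v) $ b - (J z0 *v v) $ b"
          using DERIV_imp_deriv[OF hd[of 0]] r(1) by simp
        ultimately show "dist ((J z *v v) $ b) ((J z0 *v v) $ b) \<le> \<epsilon>"
          using r(1) by (simp add: dist_norm)
      qed (use d R in auto)
    qed
  qed
  then show "continuous_on S (\<lambda>z. J z *v v)"
    using continuous_on_vec_lambda[of S "\<lambda>b z. (J z *v v) $ b"] by simp
qed

lemma hform_polarization:
  fixes A B :: "complex^'n::finite^'n"
  assumes "\<And>v. hform A v v = hform B v v" shows "A = B"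
proof -
  have add1: "hform C (x + y) w = hform C x w + hform C y w" for C :: "complex^'n^'n" and x y w
    by (simp add: hform_def algebra_simps sum.distrib)
  have add2: "hform C w (x + y) = hform C w x + hform C w y" for C :: "complex^'n^'n" and x y w
    by (simp add: hform_def algebra_simps sum.distrib)
  have sc1: "hform C (\<i> *s x) w = \<i> * hform C x w" for C :: "complex^'n^'n" and x w
    by (simp add: hform_def sum_distrib_left mult_ac)
  have sc2: "hform C w (\<i> *s x) = - \<i> * hform C w x" for C :: "complex^'n^'n" and x w
    by (simp add: hform_def sum_distrib_left mult_ac)
  have "A $ j $ k = B $ j $ k" for j k
  proof -
    let ?x = "axis j (1::complex)" and ?y = "axis k (1::complex)"
    have 1: "A $ j $ j = B $ j $ j" "A $ k $ k = B $ k $ k"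
      using assms[of ?x] assms[of ?y] by (simp_all add: hform_axis)
    have "A $ j $ k + A $ k $ j = B $ j $ k + B $ k $ j"
      using assms[of "?x + ?y"] 1 by (simp add: add1 add2 hform_axis algebra_simps)
    moreover have "\<i> * (A $ k $ j - A $ j $ k) = \<i> * (B $ k $ j - B $ j $ k)"
      using assms[of "?x + \<i> *s ?y"] 1 by (simp add: add1 add2 sc1 sc2 hform_axis algebra_simps)
    then have "A $ k $ j - A $ j $ k = B $ k $ j - B $ j $ k" by (simp only: mult_cancel_left) simp
    ultimately have "(A $ j $ k + A $ k $ j) - (A $ k $ j - A $ j $ k) = (B $ j $ k + B $ k $ j) - (B $ k $ j - B $ j $ k)" by (simp only:)
    then show ?thesis by simp
  qed
  then show ?thesis by (simp add: vec_eq_iff)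
qed

lemma hform_conj_transform: "hform (transpose J ** B ** conj_mat J) v w = hform B (J *v v) (J *v w)"
  for B J :: "complex^'n::finite^'n"
proof -
  have "hform B (J *v v) (J *v w) = (\<Sum>a\<in>UNIV. \<Sum>b\<in>UNIV. \<Sum>j\<in>UNIV. \<Sum>k\<in>UNIV. J $ a $ j * B $ a $ b * cnj (J $ b $ k) * v $ j * cnj (w $ k))"
    unfolding hform_def matrix_vector_mult_def vec_lambda_beta cnj_sum
    by (intro sum.cong refl) (simp add: sum_distrib_left sum_distrib_right mult_ac)
  also have "\<dots> = (\<Sum>j\<in>UNIV. \<Sum>k\<in>UNIV. \<Sum>b\<in>UNIV. \<Sum>a\<in>UNIV. J $ a $ j * B $ a $ b * cnj (J $ b $ k) * v $ j * cnj (w $ k))"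
  proof -
    have "(\<Sum>a\<in>UNIV. \<Sum>b\<in>UNIV. \<Sum>j\<in>UNIV. \<Sum>k\<in>UNIV. X a b j k) = (\<Sum>j\<in>UNIV. \<Sum>k\<in>UNIV. \<Sum>b\<in>UNIV. \<Sum>a\<in>UNIV. X a b j k)"
      for X :: "'n \<Rightarrow> 'n \<Rightarrow> 'n \<Rightarrow> 'n \<Rightarrow> complex"
    proof -
      have "(\<Sum>a\<in>UNIV. \<Sum>b\<in>UNIV. \<Sum>j\<in>UNIV. \<Sum>k\<in>UNIV. X a b j k) = (\<Sum>a\<in>UNIV. \<Sum>j\<in>UNIV. \<Sum>k\<in>UNIV. \<Sum>b\<in>UNIV. X a b j k)"
        by (rule sum.cong[OF refl], subst sum.swap, rule sum.cong[OF refl], rule sum.swap)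
      also have "\<dots> = (\<Sum>j\<in>UNIV. \<Sum>k\<in>UNIV. \<Sum>b\<in>UNIV. \<Sum>a\<in>UNIV. X a b j k)"
        by (subst sum.swap, rule sum.cong[OF refl], subst sum.swap, rule sum.cong[OF refl], rule sum.swap)
      finally show ?thesis .
    qed
    then show ?thesis .
  qed
  also have "\<dots> = hform (transpose J ** B ** conj_mat J) v w"
    unfolding hform_def matrix_matrix_mult_def transpose_def conj_mat_def vec_lambda_beta
    by (intro sum.cong refl) (simp add: sum_distrib_right)
  finally show ?thesis by simp
qed

text \<open>Second derivatives of \<open>f\<close> drop out because \<open>f\<close> is holomorphic.  By polarization it suffices to look at a
  complex line \<open>\<zeta> \<mapsto> z + \<zeta> v\<close>, where only the one-variable function \<open>\<zeta> \<mapsto> f (z + \<zeta> v)\<close> has to be twice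
  differentiable.\<close>

lemma hessian_chain:
  fixes f :: "complex^'n::finite \<Rightarrow> complex^'n" and U :: "complex^'n \<Rightarrow> complex"
  assumes S: "open S" and z: "z \<in> S" and der: "\<And>z. z \<in> S \<Longrightarrow> (f has_derivative (*v) (J z)) (at z)"
    and U: "\<And>z. z \<in> S \<Longrightarrow> U differentiable at (f z)"
    and U2: "\<And>k. dzbar k U differentiable at (f z)"
    and W2: "\<And>k. dzbar k (\<lambda>w. U (f w)) differentiable at z"
  shows "(\<chi> j k. dz j (dzbar k (\<lambda>w. U (f w))) z) =
    transpose (J z) ** (\<chi> j k. dz j (dzbar k U) (f z)) ** conj_mat (J z)"
proof (rule hform_polarization)
  fix v :: "complex^'n"
  define W where "W w = U (f w)" for w
  define V where "V k = dzbar k W" for k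
  define T where "T = {\<zeta>. z + \<zeta> *s v \<in> S}"
  have lin: "bounded_linear (\<lambda>\<zeta>. \<zeta> *s v)"
    by (simp add: linear_conv_bounded_linear[symmetric]) (rule linearI, auto simp: vec_eq_iff algebra_simps)
  have "continuous_on UNIV (\<lambda>\<zeta>. z + \<zeta> *s v)"
    by (intro continuous_intros linear_continuous_on lin)
  then have T: "open T" unfolding T_def using S by (simp add: open_vimage vimage_def[symmetric] continuous_on_open_vimage)
  have T0: "0 \<in> T" using z by (simp add: T_def)
  have line: "((\<lambda>\<zeta>. z + \<zeta> *s v) has_derivative (\<lambda>h. h *s v)) (at \<zeta>)" for \<zeta>
    by (rule has_derivative_eq_rhs[OF has_derivative_add[OF has_derivative_const bounded_linear_imp_has_derivative[OF lin]]]) simp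
  define g where "g b \<zeta> = (J (z + \<zeta> *s v) *v v) $ b" for b \<zeta>
  have gd: "((\<lambda>\<zeta>. f (z + \<zeta> *s v) $ b) has_field_derivative g b \<zeta>) (at \<zeta>)" if "\<zeta> \<in> T" for b \<zeta>
    unfolding g_def by (rule holomorphic_on_line[OF der]) (use that in \<open>auto simp: T_def\<close>)
  have "g b field_differentiable at 0" for b
  proof -
    have hol: "(\<lambda>\<zeta>. f (z + \<zeta> *s v) $ b) holomorphic_on T"
      unfolding holomorphic_on_open[OF T] using gd by blast
    have "deriv (\<lambda>\<zeta>. f (z + \<zeta> *s v) $ b) holomorphic_on T" by (rule holomorphic_deriv[OF hol T])
    then have "g b holomorphic_on T"
      by (rule holomorphic_transform) (use DERIV_imp_deriv[OF gd] in auto)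
    then show ?thesis using T T0 holomorphic_on_imp_differentiable_at by blast
  qed
  then obtain g' where g': "\<And>b. (g b has_field_derivative g' b) (at 0)" unfolding field_differentiable_def by metis
  \<comment> \<open>the antiholomorphic derivative in \<open>\<zeta>\<close> of \<open>U (f (z + \<zeta> v))\<close>, computed in two ways\<close>
  have key: "(\<Sum>k\<in>UNIV. cnj (v $ k) * V k (z + \<zeta> *s v)) = (\<Sum>b\<in>UNIV. cnj (g b \<zeta>) * dzbar b U (f (z + \<zeta> *s v)))"
    if "\<zeta> \<in> T" for \<zeta>
  proof -
    let ?w = "z + \<zeta> *s v"
    have w: "?w \<in> S" using that by (simp add: T_def)
    have "(\<Sum>k\<in>UNIV. cnj (v $ k) * V k ?w) = (\<Sum>k\<in>UNIV. \<Sum>b\<in>UNIV. cnj (v $ k) * (cnj (J ?w $ b $ k) * dzbar b U (f ?w)))"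
      unfolding V_def W_def[abs_def] dz_chain(2)[OF der[OF w] U[OF w]] sum_distrib_left ..
    also have "\<dots> = (\<Sum>b\<in>UNIV. cnj (g b \<zeta>) * dzbar b U (f ?w))"
      unfolding g_def matrix_vector_mult_def vec_lambda_beta cnj_sum sum_distrib_right
      by (subst sum.swap) (simp add: mult_ac)
    finally show ?thesis .
  qed
  have dV: "(V k has_derivative fd (V k) z) (at z)" for k
    using W2[of k] unfolding V_def W_def[abs_def] frechet_derivative_works .
  have dU: "(dzbar b U has_derivative fd (dzbar b U) (f z)) (at (f z))" for b
    using U2[of b] unfolding frechet_derivative_works .
  have linV: "linear (fd (V k) z)" for k using dV has_derivative_linear by blast
  have linU: "linear (fd (dzbar b U) (f z))" for b using dU has_derivative_linear by blast
  have dA: "((\<lambda>\<zeta>. \<Sum>k\<in>UNIV. cnj (v $ k) * V k (z + \<zeta> *s v)) has_derivative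
      (\<lambda>h. \<Sum>k\<in>UNIV. cnj (v $ k) * fd (V k) z (h *s v))) (at 0)"
  proof (intro has_derivative_sum has_derivative_mult_right)
    fix k
    show "((\<lambda>\<zeta>. V k (z + \<zeta> *s v)) has_derivative (\<lambda>h. fd (V k) z (h *s v))) (at 0)"
      using diff_chain_at[OF line[of 0], of "V k" "fd (V k) z"] dV[of k] by (simp add: o_def)
  qed
  have df: "((\<lambda>\<zeta>. f (z + \<zeta> *s v)) has_derivative (\<lambda>h. J z *v (h *s v))) (at 0)"
    using diff_chain_at[OF line[of 0], of f "(*v) (J z)"] der[OF z] by (simp add: o_def)
  have dB: "((\<lambda>\<zeta>. \<Sum>b\<in>UNIV. cnj (g b \<zeta>) * dzbar b U (f (z + \<zeta> *s v))) has_derivative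
      (\<lambda>h. \<Sum>b\<in>UNIV. cnj (g b 0) * fd (dzbar b U) (f z) (J z *v (h *s v)) + cnj (g' b * h) * dzbar b U (f z))) (at 0)"
  proof (intro has_derivative_sum)
    fix b
    have 1: "((\<lambda>\<zeta>. cnj (g b \<zeta>)) has_derivative (\<lambda>h. cnj (g' b * h))) (at 0)"
      by (rule bounded_linear.has_derivative[OF bounded_linear_cnj]) (use g'[of b] in \<open>simp add: has_field_derivative_def\<close>)
    have 2: "((\<lambda>\<zeta>. dzbar b U (f (z + \<zeta> *s v))) has_derivative (\<lambda>h. fd (dzbar b U) (f z) (J z *v (h *s v)))) (at 0)"
      using diff_chain_at[OF df, of "dzbar b U" "fd (dzbar b U) (f z)"] dU[of b] by (simp add: o_def)
    show "((\<lambda>\<zeta>. cnj (g b \<zeta>) * dzbar b U (f (z + \<zeta> *s v))) has_derivative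
      (\<lambda>h. cnj (g b 0) * fd (dzbar b U) (f z) (J z *v (h *s v)) + cnj (g' b * h) * dzbar b U (f z))) (at 0)"
      using has_derivative_mult[OF 1 2] by simp
  qed
  have "((\<lambda>\<zeta>. \<Sum>b\<in>UNIV. cnj (g b \<zeta>) * dzbar b U (f (z + \<zeta> *s v))) has_derivative
      (\<lambda>h. \<Sum>k\<in>UNIV. cnj (v $ k) * fd (V k) z (h *s v))) (at 0)"
    by (rule has_derivative_transform_within_open[OF dA T T0 key])
  then have eq: "(\<Sum>k\<in>UNIV. cnj (v $ k) * fd (V k) z (h *s v)) =
      (\<Sum>b\<in>UNIV. cnj (g b 0) * fd (dzbar b U) (f z) (J z *v (h *s v)) + cnj (g' b * h) * dzbar b U (f z))" for h
    using has_derivative_unique[OF _ dB] by (metis (no_types, lifting))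
  define R where "R h = (\<Sum>k\<in>UNIV. cnj (v $ k) * fd (V k) z (h *s v))" for h
  have "(R 1 - \<i> * R \<i>) / 2 = (\<Sum>k\<in>UNIV. cnj (v $ k) * holo_part (fd (V k) z) v)"
  proof -
    have "cnj (v $ k) * holo_part (fd (V k) z) v = cnj (v $ k) * fd (V k) z (1 *s v) / 2 - \<i> * (cnj (v $ k) * fd (V k) z (\<i> *s v)) / 2" for k
      by (simp add: holo_part_def field_simps)
    then show ?thesis unfolding R_def
      by (simp only: sum_subtractf sum_divide_distrib sum_distrib_left diff_divide_distrib)
  qed
  also have "\<dots> = (\<Sum>k\<in>UNIV. \<Sum>j\<in>UNIV. cnj (v $ k) * (v $ j * dz j (V k) z))"
    unfolding holo_part_expand[OF linV, of _ v] dz_eq_holo_part[symmetric] sum_distrib_left ..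
  also have "\<dots> = hform (\<chi> j k. dz j (V k) z) v v"
    unfolding hform_def by (subst sum.swap) (simp add: mult_ac)
  finally have L: "(R 1 - \<i> * R \<i>) / 2 = hform (\<chi> j k. dz j (V k) z) v v" .
  have g0: "g b 0 = (J z *v v) $ b" for b by (simp add: g_def)
  \<comment> \<open>the terms with \<open>g'\<close> cancel, being complex-antilinear in the increment\<close>
  have "(R 1 - \<i> * R \<i>) / 2 = (\<Sum>b\<in>UNIV. cnj (g b 0) * holo_part (fd (dzbar b U) (f z)) (J z *v v))"
  proof -
    have "cnj (g b 0) * holo_part (fd (dzbar b U) (f z)) (J z *v v) =
       (cnj (g b 0) * fd (dzbar b U) (f z) (J z *v (1 *s v)) + cnj (g' b * 1) * dzbar b U (f z)) / 2
        - \<i> * (cnj (g b 0) * fd (dzbar b U) (f z) (J z *v (\<i> *s v)) + cnj (g' b * \<i>) * dzbar b U (f z)) / 2" for b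
      by (simp add: holo_part_def mv_ii field_simps)
    then show ?thesis unfolding R_def eq
      by (simp only: sum_subtractf sum_divide_distrib sum_distrib_left diff_divide_distrib)
  qed
  also have "\<dots> = (\<Sum>b\<in>UNIV. \<Sum>a\<in>UNIV. cnj (g b 0) * ((J z *v v) $ a * dz a (dzbar b U) (f z)))"
    unfolding holo_part_expand[OF linU, of _ "J z *v v"] dz_eq_holo_part[symmetric] sum_distrib_left ..
  also have "\<dots> = hform (\<chi> j k. dz j (dzbar k U) (f z)) (J z *v v) (J z *v v)"
    unfolding hform_def g0 by (subst sum.swap) (simp add: mult_ac)
  finally have "(R 1 - \<i> * R \<i>) / 2 = hform (\<chi> j k. dz j (dzbar k U) (f z)) (J z *v v) (J z *v v)" .
  then show "hform (\<chi> j k. dz j (dzbar k (\<lambda>w. U (f w))) z) v v =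
      hform (transpose (J z) ** (\<chi> j k. dz j (dzbar k U) (f z)) ** conj_mat (J z)) v v"
    unfolding hform_conj_transform L[symmetric] using L by (simp add: V_def W_def[abs_def])
qed

section \<open>Compact complex manifolds and the volume measure\<close>

locale cplx_manifold =
  fixes \<A> :: "('a::t2_space, 'n::finite) chart set"
  assumes compact_X: "compact (UNIV :: 'a set)" and atlas: "complex_atlas \<A>"
begin

definition Jac :: "('a, 'n) chart \<Rightarrow> ('a, 'n) chart \<Rightarrow> complex^'n \<Rightarrow> complex^'n^'n" where
  "Jac c d z = (SOME J. (trans_map c d has_derivative (*v) J) (at z))"

definition overlap :: "('a, 'n) chart \<Rightarrow> ('a, 'n) chart \<Rightarrow> (complex^'n) set" where
  "overlap c d = crd c ` (dom_ch c \<inter> dom_ch d)"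

lemma chart_at: "chart_at \<A> x \<in> \<A>" "x \<in> dom_ch (chart_at \<A> x)"
proof -
  have "x \<in> (\<Union>c\<in>\<A>. dom_ch c)" using atlas by (simp only: complex_atlas_def UNIV_I)
  then have "\<exists>c. c \<in> \<A> \<and> x \<in> dom_ch c" by blast
  from someI_ex[OF this] show "chart_at \<A> x \<in> \<A>" "x \<in> dom_ch (chart_at \<A> x)"
    by (simp_all add: chart_at_def)
qed

context fixes c assumes c: "c \<in> \<A>" begin

lemma open_dom: "open (dom_ch c)" and open_img: "open (img_ch c)"
  using atlas c by (auto simp: complex_atlas_def)

lemma homeo: "homeomorphism (dom_ch c) (img_ch c) (crd c) (pt c)"
  using atlas c by (auto simp: complex_atlas_def)

lemma pt_crd [simp]: "x \<in> dom_ch c \<Longrightarrow> pt c (crd c x) = x"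
  and crd_pt [simp]: "z \<in> img_ch c \<Longrightarrow> crd c (pt c z) = z"
  and crd_in: "x \<in> dom_ch c \<Longrightarrow> crd c x \<in> img_ch c"
  and pt_in: "z \<in> img_ch c \<Longrightarrow> pt c z \<in> dom_ch c"
  and cont_crd: "continuous_on (dom_ch c) (crd c)"
  and cont_pt: "continuous_on (img_ch c) (pt c)"
  using homeo by (auto simp: homeomorphism_def)

lemma crd_image: "B \<subseteq> dom_ch c \<Longrightarrow> crd c ` B = img_ch c \<inter> pt c -` B"
  using pt_crd crd_pt crd_in by (force simp: image_iff)

lemma pt_image: "E \<subseteq> img_ch c \<Longrightarrow> pt c ` E = dom_ch c \<inter> crd c -` E"
  using pt_crd crd_pt pt_in by (force simp: image_iff)

lemma mem_overlap: "z \<in> overlap c d \<longleftrightarrow> z \<in> img_ch c \<and> pt c z \<in> dom_ch d"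
  unfolding overlap_def using pt_crd crd_pt crd_in pt_in by (force simp: image_iff)

lemma borel_crd_image:
  assumes "B \<in> sets borel" "B \<subseteq> dom_ch c" shows "crd c ` B \<in> sets borel"
proof -
  have "pt c \<in> measurable (restrict_space borel (img_ch c)) borel"
    by (rule borel_measurable_continuous_on_restrict[OF cont_pt])
  from measurable_sets[OF this assms(1)] have "pt c -` B \<inter> img_ch c \<in> sets (restrict_space borel (img_ch c))"
    by (simp add: space_restrict_space)
  then have "pt c -` B \<inter> img_ch c \<in> sets borel"
    using open_img by (simp add: sets_restrict_space_iff)
  then show ?thesis unfolding crd_image[OF assms(2)] by (simp add: Int_commute)
qed

lemma open_crd_image: "open B \<Longrightarrow> B \<subseteq> dom_ch c \<Longrightarrow> open (crd c ` B)"
  using crd_image continuous_open_preimage[OF cont_pt open_img] by simp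

lemma open_pt_image: "open E \<Longrightarrow> E \<subseteq> img_ch c \<Longrightarrow> open (pt c ` E)"
  using pt_image continuous_open_preimage[OF cont_crd open_dom] by simp

lemma open_overlap: assumes "d \<in> \<A>" shows "open (overlap c d)"
proof -
  have "open (dom_ch d)" using atlas assms by (auto simp: complex_atlas_def)
  then show ?thesis unfolding overlap_def using open_crd_image[of "dom_ch c \<inter> dom_ch d"] open_dom by auto
qed

lemma Jac: assumes "d \<in> \<A>" "z \<in> overlap c d" shows "(trans_map c d has_derivative (*v) (Jac c d z)) (at z)"
proof -
  have "\<exists>J. (trans_map c d has_derivative (*v) J) (at z)"
    using atlas c assms by (auto simp: complex_atlas_def holomorphic_map_on_def overlap_def)
  from someI_ex[OF this] show ?thesis by (simp add: Jac_def)
qed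

lemma C1_trans: "d \<in> \<A> \<Longrightarrow> C1_on (overlap c d) (trans_map c d)"
  by (rule C1_on_holomorphic[OF open_overlap Jac])

lemma tangent_map_eq:
  assumes "d \<in> \<A>" "x \<in> dom_ch c \<inter> dom_ch d" shows "tangent_map c d x = (*v) (Jac c d (crd c x))"
proof -
  have "crd c x \<in> overlap c d" using assms by (auto simp: overlap_def)
  from frechet_derivative_at[OF Jac[OF assms(1) this]] show ?thesis by (simp add: tangent_map_def)
qed

end

lemma trans_in: "c \<in> \<A> \<Longrightarrow> d \<in> \<A> \<Longrightarrow> z \<in> overlap c d \<Longrightarrow> trans_map c d z \<in> overlap d c"
  by (auto simp: mem_overlap trans_map_def crd_in pt_in)

lemma trans_inverse: "c \<in> \<A> \<Longrightarrow> d \<in> \<A> \<Longrightarrow> z \<in> overlap c d \<Longrightarrow> trans_map d c (trans_map c d z) = z"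
  by (auto simp: mem_overlap trans_map_def)

lemma Jac_inverse:
  assumes "c \<in> \<A>" "d \<in> \<A>" "z \<in> overlap c d"
  shows "Jac d c (trans_map c d z) ** Jac c d z = mat 1"
proof -
  let ?A = "Jac d c (trans_map c d z) ** Jac c d z"
  have "((\<lambda>z. trans_map d c (trans_map c d z)) has_derivative (*v) ?A) (at z)"
    using diff_chain_at[OF Jac[OF assms] Jac[OF assms(2,1) trans_in[OF assms]]]
    by (simp add: o_def matrix_vector_mul_assoc)
  moreover have "((\<lambda>z. trans_map d c (trans_map c d z)) has_derivative (\<lambda>v. v)) (at z)"
    by (rule has_derivative_transform_within_open[OF has_derivative_ident open_overlap[OF assms(1,2)] assms(3)])
       (simp add: trans_inverse[OF assms(1,2)])
  ultimately have "(*v) ?A = (\<lambda>v. v)" by (rule has_derivative_unique)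
  then have "?A *v axis k 1 = axis k 1" for k by (simp only: fun_eq_iff)
  then have "(?A *v axis k 1) $ b = axis k 1 $ b" for k b by simp
  then have "?A $ b $ k = (mat 1 :: complex^'n^'n) $ b $ k" for b k
    unfolding mv_axis by (simp add: axis_def mat_def)
  then show ?thesis by (simp add: vec_eq_iff)
qed

lemma det_Jac: assumes "c \<in> \<A>" "d \<in> \<A>" "z \<in> overlap c d" shows "det (Jac c d z) \<noteq> 0"
  using arg_cong[OF Jac_inverse[OF assms], of det] by (auto simp: det_mul)

lemma inj_on_trans: "c \<in> \<A> \<Longrightarrow> d \<in> \<A> \<Longrightarrow> inj_on (trans_map c d) (overlap c d)"
  by (metis inj_onI trans_inverse)

lemma trans_image: "c \<in> \<A> \<Longrightarrow> d \<in> \<A> \<Longrightarrow> B \<subseteq> dom_ch c \<inter> dom_ch d \<Longrightarrow> trans_map c d ` (crd c ` B) = crd d ` B"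
  by (force simp: trans_map_def image_iff)

text \<open>Coordinate balls whose closures are compact subsets of chart images serve twice: to see that the volume is
  finite, and to build a partition of unity.\<close>

lemma finite_ball_cover:
  obtains F :: "'a set" and r :: "'a \<Rightarrow> real" where "finite F" "\<And>x. r x > 0"
    "\<And>x. cball (crd (chart_at \<A> x) x) (r x) \<subseteq> img_ch (chart_at \<A> x)"
    "(\<Union>x\<in>F. pt (chart_at \<A> x) ` ball (crd (chart_at \<A> x) x) (r x)) = UNIV"
proof -
  have "\<exists>r>0. cball (crd (chart_at \<A> x) x) r \<subseteq> img_ch (chart_at \<A> x)" for x
    using open_img[OF chart_at(1)] crd_in[OF chart_at(1) chart_at(2)] open_contains_cball by blast
  then obtain r where r: "\<And>x. r x > 0" "\<And>x. cball (crd (chart_at \<A> x) x) (r x) \<subseteq> img_ch (chart_at \<A> x)"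
    by metis
  define U where "U x = pt (chart_at \<A> x) ` ball (crd (chart_at \<A> x) x) (r x)" for x
  have sub: "ball (crd (chart_at \<A> x) x) (r x) \<subseteq> img_ch (chart_at \<A> x)" for x
    using r(2)[of x] ball_subset_cball by blast
  have opU: "open (U x)" for x unfolding U_def by (rule open_pt_image[OF chart_at(1) open_ball sub])
  have xU: "x \<in> U x" for x
    unfolding U_def using pt_crd[OF chart_at(1) chart_at(2)] r(1) by (metis centre_in_ball imageI)
  obtain F where "finite F" "UNIV \<subseteq> (\<Union>x\<in>F. U x)"
    by (rule compactE_image[OF compact_X, of UNIV U]) (use opU xU in auto)
  then show ?thesis using that[of F r] r unfolding U_def by blast
qed

end

locale kahler_manifold = cplx_manifold \<A> for \<A> :: "('a::t2_space, 'n::finite) chart set" +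
  fixes \<omega> :: "('a, 'n) form11"
  assumes kahler: "kahler_metric \<A> \<omega>"
begin

lemma herm_pd_metric: "c \<in> \<A> \<Longrightarrow> x \<in> dom_ch c \<Longrightarrow> herm_pd (\<omega> c x)"
  using kahler unfolding kahler_metric_def herm_pd_def by blast

lemma metric_pullback:
  assumes "c \<in> \<A>" "d \<in> \<A>" "x \<in> dom_ch c \<inter> dom_ch d"
  shows "\<omega> c x = transpose (Jac c d (crd c x)) ** \<omega> d x ** conj_mat (Jac c d (crd c x))"
proof (rule hform_pullback)
  fix v w
  show "hform (\<omega> c x) v w = hform (\<omega> d x) (Jac c d (crd c x) *v v) (Jac c d (crd c x) *v w)"
    using kahler assms tangent_map_eq[OF assms] unfolding kahler_metric_def by metis
qed

lemma C1_metric: "c \<in> \<A> \<Longrightarrow> C1_on (img_ch c) (\<lambda>z. \<omega> c (pt c z) $ j $ k)"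
  using kahler unfolding kahler_metric_def by (blast intro: smooth_on_imp_C1_on)

lemma det_metric_nz: "c \<in> \<A> \<Longrightarrow> x \<in> dom_ch c \<Longrightarrow> det (\<omega> c x) \<noteq> 0"
  by (rule det_herm_pd_nz[OF herm_pd_metric])

definition dens :: "('a, 'n) chart \<Rightarrow> complex^'n \<Rightarrow> real" where
  "dens c z = wedge_density (\<lambda>_. \<omega> c (pt c z))"

lemma dens_eq: "dens c z = 2 ^ CARD('n) * fact CARD('n) * Re (det (\<omega> c (pt c z)))"
  by (simp add: dens_def wedge_density_const)

lemma dens_pos: "c \<in> \<A> \<Longrightarrow> z \<in> img_ch c \<Longrightarrow> dens c z > 0"
  unfolding dens_def by (intro wedge_density_pos herm_pd_metric pt_in)

lemma continuous_dens: assumes "c \<in> \<A>" shows "continuous_on (img_ch c) (dens c)"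
proof -
  have "continuous_on (img_ch c) (\<lambda>z. det (\<omega> c (pt c z)))"
    by (intro C1_on_imp_continuous_on C1_on_det C1_metric assms)
  then show ?thesis unfolding dens_eq[abs_def] by (intro continuous_intros)
qed

text \<open>The determinant of \<open>transpose J ** G ** conj J\<close> is \<open>\<bar>det J\<bar>\<^sup>2 det G\<close>.\<close>

lemma dens_trans:
  assumes "c \<in> \<A>" "d \<in> \<A>" "z \<in> overlap c d"
  shows "dens c z = dens d (trans_map c d z) * (cmod (det (Jac c d z)))\<^sup>2"
proof -
  let ?J = "Jac c d z"
  have z: "z \<in> img_ch c" "pt c z \<in> dom_ch d" using assms(3) mem_overlap[OF assms(1)] by auto
  then have x: "pt c z \<in> dom_ch c \<inter> dom_ch d" using pt_in[OF assms(1)] by auto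
  have pt': "pt d (trans_map c d z) = pt c z" using z(2) assms(2) by (simp add: trans_map_def)
  have "\<omega> c (pt c z) = transpose ?J ** \<omega> d (pt c z) ** conj_mat ?J"
    using metric_pullback[OF assms(1,2) x] z assms(1) by simp
  then have "det (\<omega> c (pt c z)) = det ?J * cnj (det ?J) * det (\<omega> d (pt c z))"
    by (simp add: det_mul det_transpose det_conj_mat)
  also have "det ?J * cnj (det ?J) = complex_of_real ((cmod (det ?J))\<^sup>2)" by (rule complex_norm_square[symmetric])
  finally have "Re (det (\<omega> c (pt c z))) = (cmod (det ?J))\<^sup>2 * Re (det (\<omega> d (pt c z)))" by simp
  then show ?thesis unfolding dens_eq pt' by simp
qed

lemma borel_dens [measurable]:
  assumes "c \<in> \<A>" "A \<in> sets borel" "A \<subseteq> img_ch c"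
  shows "(\<lambda>z. ennreal (dens c z) * indicator A z) \<in> borel_measurable borel"
proof -
  have "(\<lambda>z. indicator A z *\<^sub>R dens c z) \<in> borel_measurable borel"
    by (rule borel_measurable_continuous_on_indicator[OF assms(2) continuous_on_subset[OF continuous_dens[OF assms(1)] assms(3)]])
  then have "(\<lambda>z. ennreal (indicator A z *\<^sub>R dens c z)) \<in> borel_measurable borel" by simp
  moreover have "(\<lambda>z. ennreal (indicator A z *\<^sub>R dens c z)) = (\<lambda>z. ennreal (dens c z) * indicator A z)"
    by (auto simp: fun_eq_iff indicator_def)
  ultimately show ?thesis by simp
qed

text \<open>The inverse chart, extended by a constant value to a Borel map on the whole space.\<close>

definition pt0 :: "('a, 'n) chart \<Rightarrow> complex^'n \<Rightarrow> 'a" where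
  "pt0 c z = (if z \<in> img_ch c then pt c z else undefined)"

lemma measurable_pt0: assumes "c \<in> \<A>" shows "pt0 c \<in> measurable borel borel"
proof (rule measurableI)
  fix B :: "'a set" assume B: "B \<in> sets borel"
  have "pt0 c -` B = crd c ` (dom_ch c \<inter> B) \<union> (if undefined \<in> B then - img_ch c else {})"
    using crd_image[OF assms, of "dom_ch c \<inter> B"] pt_in[OF assms] by (auto simp: pt0_def split: if_splits)
  moreover have "crd c ` (dom_ch c \<inter> B) \<in> sets borel"
    using B open_dom[OF assms] by (intro borel_crd_image[OF assms]) auto
  ultimately show "pt0 c -` B \<inter> space borel \<in> sets borel" using open_img[OF assms] by auto
qed simp

text \<open>The part of the volume measure that lives on the domain of one chart.\<close>

definition chart_measure :: "('a, 'n) chart \<Rightarrow> 'a measure" where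
  "chart_measure c = distr (density lborel (\<lambda>z. ennreal (dens c z) * indicator (img_ch c) z)) borel (pt0 c)"

lemma sets_chart_measure [simp]: "sets (chart_measure c) = sets borel"
  by (simp add: chart_measure_def)

lemma emeasure_chart_measure:
  assumes c: "c \<in> \<A>" and B: "B \<in> sets borel"
  shows "emeasure (chart_measure c) B = (\<integral>\<^sup>+ z\<in>crd c ` (dom_ch c \<inter> B). ennreal (dens c z) \<partial>lborel)"
proof -
  have m: "(\<lambda>z. ennreal (dens c z) * indicator (img_ch c) z) \<in> borel_measurable borel"
    by (rule borel_dens[OF c]) (use open_img[OF c] in auto)
  have pB: "pt0 c -` B \<in> sets borel" using measurable_sets[OF measurable_pt0[OF c] B] by simp
  have "emeasure (chart_measure c) B = emeasure (density lborel (\<lambda>z. ennreal (dens c z) * indicator (img_ch c) z)) (pt0 c -` B)"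
    unfolding chart_measure_def using measurable_pt0[OF c] B by (subst emeasure_distr) auto
  also have "\<dots> = (\<integral>\<^sup>+ z. (ennreal (dens c z) * indicator (img_ch c) z) * indicator (pt0 c -` B) z \<partial>lborel)"
    using m pB by (intro emeasure_density) auto
  also have "\<dots> = (\<integral>\<^sup>+ z\<in>crd c ` (dom_ch c \<inter> B). ennreal (dens c z) \<partial>lborel)"
    using crd_image[OF c, of "dom_ch c \<inter> B"] pt_in[OF c]
    by (intro nn_integral_cong) (auto simp: indicator_def pt0_def)
  finally show ?thesis .
qed

text \<open>The chart measures agree on overlaps, by the change of variables formula and \<open>dens_trans\<close>.\<close>

lemma emeasure_chart_measure_eq:
  assumes "c \<in> \<A>" "d \<in> \<A>" "A \<in> sets borel" "A \<subseteq> dom_ch c \<inter> dom_ch d"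
  shows "emeasure (chart_measure c) A = emeasure (chart_measure d) A"
proof -
  let ?f = "trans_map c d"
  have im: "?f ` (crd c ` A) = crd d ` A" by (rule trans_image[OF assms(1,2,4)])
  have sub: "crd c ` A \<subseteq> overlap c d" using assms(4) by (auto simp: overlap_def)
  have cA: "crd c ` A \<in> sets borel" "crd d ` A \<in> sets borel" using borel_crd_image assms by auto
  have "(\<integral>\<^sup>+ z\<in>?f ` (crd c ` A). ennreal (dens d z) \<partial>lborel) =
     (\<integral>\<^sup>+ z\<in>crd c ` A. ennreal (dens d (?f z)) * ennreal ((cmod (det (Jac c d z)))\<^sup>2) \<partial>lborel)"
  proof (rule nn_integral_image_complex[OF open_overlap[OF assms(1,2)] C1_trans[OF assms(1,2)] _ inj_on_trans[OF assms(1,2)] det_Jac[OF assms(1,2)]])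
    show "fd ?f z = (*v) (Jac c d z)" if "z \<in> overlap c d" for z
      using frechet_derivative_at[OF Jac[OF assms(1,2) that]] by simp
    show "?f ` B \<in> sets borel" if "B \<in> sets borel" "B \<subseteq> overlap c d" for B
    proof -
      have p: "crd c (pt c z) = z" "pt c z \<in> dom_ch c \<inter> dom_ch d" if "z \<in> B" for z
        using that \<open>B \<subseteq> overlap c d\<close> mem_overlap[OF assms(1), of z d] crd_pt[OF assms(1)] pt_in[OF assms(1)] by auto
      have "crd c ` (pt c ` B) = B" by (simp add: image_image p(1) cong: image_cong)
      moreover have pB: "pt c ` B \<subseteq> dom_ch c \<inter> dom_ch d" using p(2) by blast
      ultimately have "?f ` B = crd d ` (pt c ` B)" using trans_image[OF assms(1,2) pB] by simp
      moreover have "pt c ` B \<in> sets borel"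
      proof -
        have Bi: "B \<subseteq> img_ch c" using that(2) mem_overlap[OF assms(1), of _ d] by blast
        have "crd c \<in> measurable (restrict_space borel (dom_ch c)) borel"
          by (rule borel_measurable_continuous_on_restrict[OF cont_crd[OF assms(1)]])
        from measurable_sets[OF this that(1)] have "crd c -` B \<inter> dom_ch c \<in> sets borel"
          using open_dom[OF assms(1)] by (simp add: space_restrict_space sets_restrict_space_iff)
        then show ?thesis unfolding pt_image[OF assms(1) Bi] by (simp add: Int_commute)
      qed
      ultimately show ?thesis using borel_crd_image[OF assms(2)] pB by auto
    qed
    show "(\<lambda>z. indicator (?f ` (crd c ` A)) z * ennreal (dens d z)) \<in> borel_measurable borel"
      unfolding im using borel_dens[OF assms(2) cA(2)] crd_in[OF assms(2)] assms(4) by (auto simp: mult.commute)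
  qed (use cA sub in auto)
  also have "\<dots> = (\<integral>\<^sup>+ z\<in>crd c ` A. ennreal (dens c z) \<partial>lborel)"
  proof (rule nn_integral_cong)
    fix z
    have "ennreal (dens d (?f z)) * ennreal ((cmod (det (Jac c d z)))\<^sup>2) = ennreal (dens c z)" if "z \<in> crd c ` A"
    proof -
      have z: "z \<in> overlap c d" using that sub by auto
      have "dens d (?f z) > 0" using dens_pos[OF assms(2)] trans_in[OF assms(1,2) z] mem_overlap[OF assms(2)] by blast
      then show ?thesis unfolding dens_trans[OF assms(1,2) z] by (simp add: ennreal_mult)
    qed
    then show "ennreal (dens d (?f z)) * ennreal ((cmod (det (Jac c d z)))\<^sup>2) * indicator (crd c ` A) z = ennreal (dens c z) * indicator (crd c ` A) z"
      by (auto simp: indicator_def)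
  qed
  finally show ?thesis unfolding emeasure_chart_measure[OF assms(1,3)] emeasure_chart_measure[OF assms(2,3)] im
    using assms(4) by (simp add: Int_absorb1)
qed

definition is_volume :: "'a measure \<Rightarrow> bool" where
  "is_volume \<mu> \<longleftrightarrow> sets \<mu> = sets borel \<and>
     (\<forall>c\<in>\<A>. \<forall>A\<in>sets borel. A \<subseteq> dom_ch c \<longrightarrow> emeasure \<mu> A = emeasure (chart_measure c) A)"

lemma finite_chart_partition:
  obtains N :: nat and C :: "nat \<Rightarrow> ('a, 'n) chart" and B :: "nat \<Rightarrow> 'a set" where
    "\<And>i. C i \<in> \<A>" "\<And>i. B i \<in> sets borel" "\<And>i. B i \<subseteq> dom_ch (C i)" "disjoint_family_on B {..<N}" "(\<Union>i<N. B i) = UNIV"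
    "\<And>i. emeasure (chart_measure (C i)) (B i) < \<infinity>"
proof -
  obtain F :: "'a set" and r where F: "finite F" "\<And>x. r x > 0"
    "\<And>x. cball (crd (chart_at \<A> x) x) (r x) \<subseteq> img_ch (chart_at \<A> x)"
    "(\<Union>x\<in>F. pt (chart_at \<A> x) ` ball (crd (chart_at \<A> x) x) (r x)) = UNIV"
    by (rule finite_ball_cover) (rule that)
  obtain e :: "nat \<Rightarrow> 'a" and N where e: "F = e ` {..<N}"
    using finite_imp_nat_seg_image_inj_on[OF F(1)] unfolding lessThan_def[symmetric] by blast
  define C where "C i = chart_at \<A> (e i)" for i
  define U where "U i = pt (C i) ` ball (crd (C i) (e i)) (r (e i))" for i
  define B where "B i = U i - (\<Union>j<i. U j)" for i
  have C: "C i \<in> \<A>" for i by (simp add: C_def chart_at)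
  have sub: "ball (crd (C i) (e i)) (r (e i)) \<subseteq> img_ch (C i)" for i
    using F(3)[of "e i"] ball_subset_cball unfolding C_def by blast
  have opU: "open (U i)" for i unfolding U_def by (rule open_pt_image[OF C open_ball sub])
  have Ud: "U i \<subseteq> dom_ch (C i)" for i unfolding U_def using sub pt_in[OF C] by blast
  have UN: "(\<Union>i<N. U i) = UNIV" using F(4) unfolding e U_def C_def by auto
  show ?thesis
  proof (rule that[of C B N])
    show "C i \<in> \<A>" for i by (rule C)
    show "B i \<in> sets borel" for i unfolding B_def using opU by auto
    show Bd: "B i \<subseteq> dom_ch (C i)" for i using Ud by (auto simp: B_def)
    show "disjoint_family_on B {..<N}"
      unfolding disjoint_family_on_def B_def by (auto, metis lessThan_iff linorder_neqE_nat)
    show "(\<Union>i<N. B i) = UNIV"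
    proof -
      have "x \<in> (\<Union>i<N. B i)" for x
      proof -
        obtain i where i: "i < N" "x \<in> U i" using UN by blast
        define m where "m = (LEAST i. x \<in> U i)"
        have "x \<in> U m" "m \<le> i" unfolding m_def using i(2) by (auto intro: LeastI Least_le)
        moreover have "x \<notin> U j" if "j < m" for j using not_less_Least that unfolding m_def by blast
        ultimately show ?thesis using i(1) by (auto simp: B_def intro!: bexI[of _ m])
      qed
      then show ?thesis by blast
    qed
    show "emeasure (chart_measure (C i)) (B i) < \<infinity>" for i
    proof -
      let ?K = "cball (crd (C i) (e i)) (r (e i))"
      have KI: "?K \<subseteq> img_ch (C i)" using F(3)[of "e i"] by (simp add: C_def)
      have "emeasure (chart_measure (C i)) (B i) \<le> (\<integral>\<^sup>+ z. ennreal (indicator ?K z *\<^sub>R dens (C i) z) \<partial>lborel)"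
      proof -
        have "crd (C i) ` (dom_ch (C i) \<inter> B i) \<subseteq> ?K"
          using sub crd_pt[OF C] by (auto simp: B_def U_def subset_iff)
        then show ?thesis
          unfolding emeasure_chart_measure[OF C \<open>B i \<in> sets borel\<close>]
          by (intro nn_integral_mono) (auto simp: indicator_def)
      qed
      also have "\<dots> < \<infinity>"
      proof -
        have "integrable lborel (\<lambda>z. indicator ?K z *\<^sub>R dens (C i) z)"
          by (rule borel_integrable_compact[OF compact_cball continuous_on_subset[OF continuous_dens[OF C] KI]])
        moreover have "indicator ?K z *\<^sub>R dens (C i) z \<ge> 0" for z
          using dens_pos[OF C, of z i] KI by (auto simp: indicator_def less_imp_le)
        ultimately show ?thesis by (simp add: nn_integral_eq_integral ennreal_less_top)
      qed
      finally show ?thesis .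
    qed
  qed
qed

text \<open>Finitely many disjoint Borel sets, each inside a chart domain and of finite chart measure, cover the manifold.
  A measure with the required densities is determined by its values on subsets of these sets, and
  adding up the chart measures over them defines one.\<close>

lemma ex1_volume: "\<exists>!\<mu>. is_volume \<mu>" and volume_finite: "is_volume \<mu> \<Longrightarrow> emeasure \<mu> UNIV < \<infinity>"
proof -
  obtain N :: nat and C and B where
    C: "\<And>i. C i \<in> \<A>" and Bb: "\<And>i. B i \<in> sets borel" and Bd: "\<And>i. B i \<subseteq> dom_ch (C i)"
    and dis: "disjoint_family_on B {..<N}" and UN: "(\<Union>i<N. B i) = UNIV"
    and fin: "\<And>i. emeasure (chart_measure (C i)) (B i) < \<infinity>"
    by (rule finite_chart_partition) (rule that)
  have split: "emeasure \<mu> A = (\<Sum>i<N. emeasure \<mu> (B i \<inter> A))" if "sets \<mu> = sets borel" "A \<in> sets borel" for \<mu> A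
  proof -
    have "disjoint_family_on (\<lambda>i. B i \<inter> A) {..<N}" using dis unfolding disjoint_family_on_def by blast
    then have "(\<Sum>i<N. emeasure \<mu> (B i \<inter> A)) = emeasure \<mu> (\<Union>i<N. B i \<inter> A)"
      by (intro sum_emeasure) (use that Bb in auto)
    also have "(\<Union>i<N. B i \<inter> A) = A" using UN by auto
    finally show ?thesis by simp
  qed
  have formula: "emeasure \<mu> A = (\<Sum>i<N. emeasure (chart_measure (C i)) (B i \<inter> A))"
    if "is_volume \<mu>" "A \<in> sets borel" for \<mu> A
  proof -
    have "emeasure \<mu> (B i \<inter> A) = emeasure (chart_measure (C i)) (B i \<inter> A)" for i
      using that Bb[of i] Bd[of i] C[of i] unfolding is_volume_def by blast
    then show ?thesis using split[of \<mu> A] that by (simp add: is_volume_def)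
  qed
  define e where "e A = (\<Sum>i<N. emeasure (chart_measure (C i)) (B i \<inter> A))" for A
  define \<mu> where "\<mu> = measure_of UNIV (sets borel) e"
  have sm: "sets \<mu> = sets borel" unfolding \<mu>_def using sets.sigma_sets_eq[of borel] by (simp add: sets_measure_of_conv)
  have em: "emeasure \<mu> A = e A" if "A \<in> sets borel" for A
  proof (rule emeasure_measure_of[OF \<mu>_def])
    show "positive (sets \<mu>) e" by (simp add: positive_def e_def)
    show "countably_additive (sets \<mu>) e"
    proof (rule countably_additiveI)
      fix A :: "nat \<Rightarrow> 'a set" assume A: "range A \<subseteq> sets \<mu>" "disjoint_family A"
      have "(\<Sum>n. e (A n)) = (\<Sum>i<N. \<Sum>n. emeasure (chart_measure (C i)) (B i \<inter> A n))"
        unfolding e_def by (rule suminf_sum) auto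
      also have "\<dots> = (\<Sum>i<N. emeasure (chart_measure (C i)) (\<Union>n. B i \<inter> A n))"
      proof (intro sum.cong refl suminf_emeasure)
        fix i
        show "disjoint_family (\<lambda>n. B i \<inter> A n)" using A(2) unfolding disjoint_family_on_def by blast
        show "range (\<lambda>n. B i \<inter> A n) \<subseteq> sets (chart_measure (C i))"
          using A(1) Bb[of i] sm by auto
      qed
      also have "\<dots> = e (\<Union>n. A n)" by (simp add: e_def)
      finally show "(\<Sum>n. e (A n)) = e (\<Union>n. A n)" .
    qed
  qed (use that sm in auto)
  have vol: "is_volume \<mu>"
    unfolding is_volume_def
  proof (intro conjI sm ballI impI)
    fix c A assume c: "c \<in> \<A>" and A: "A \<in> sets borel" "A \<subseteq> dom_ch c"
    have "emeasure (chart_measure (C i)) (B i \<inter> A) = emeasure (chart_measure c) (B i \<inter> A)" for i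
      using A Bb[of i] Bd[of i] by (intro emeasure_chart_measure_eq[OF C c]) auto
    then have "emeasure \<mu> A = (\<Sum>i<N. emeasure (chart_measure c) (B i \<inter> A))" using em[OF A(1)] by (simp add: e_def)
    also have "\<dots> = emeasure (chart_measure c) A" by (rule split[symmetric]) (use A in auto)
    finally show "emeasure \<mu> A = emeasure (chart_measure c) A" .
  qed
  show "\<exists>!\<mu>. is_volume \<mu>"
  proof (rule ex1I[of is_volume, OF vol])
    fix \<mu>' assume v: "is_volume \<mu>'"
    show "\<mu>' = \<mu>"
    proof (rule measure_eqI)
      show "sets \<mu>' = sets \<mu>" using v sm by (simp add: is_volume_def)
      fix A assume "A \<in> sets \<mu>'"
      then have "A \<in> sets borel" using v by (simp add: is_volume_def)
      then show "emeasure \<mu>' A = emeasure \<mu> A" using formula[OF v] em by (simp add: e_def)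
    qed
  qed
  show "emeasure \<mu> UNIV < \<infinity>" if "is_volume \<mu>" for \<mu>
    using formula[OF that, of UNIV] fin by (simp add: less_top)
qed

abbreviation vol :: "'a measure" where "vol \<equiv> top_power \<A> \<omega>"

lemma is_volume_top_power: "is_volume vol"
proof -
  have "(sets \<mu> = sets borel \<and>
     (\<forall>c\<in>\<A>. \<forall>A\<in>sets borel. A \<subseteq> dom_ch c \<longrightarrow>
        emeasure \<mu> A = (\<integral>\<^sup>+ z\<in>crd c ` A. ennreal (wedge_density (\<lambda>i. \<omega> c (pt c z))) \<partial>lborel))) = is_volume \<mu>" for \<mu>
    unfolding is_volume_def
    by (intro conj_cong ball_cong refl imp_cong) (simp add: emeasure_chart_measure Int_absorb1 dens_def)
  then have "vol = (THE \<mu>. is_volume \<mu>)" by (simp add: top_power_def wedge_measure_def)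
  then show ?thesis using theI'[OF ex1_volume] by simp
qed

lemma sets_vol [simp, measurable_cong]: "sets vol = sets borel"
  using is_volume_top_power by (simp add: is_volume_def)

lemma space_vol [simp]: "space vol = UNIV"
  using sets_eq_imp_space_eq[OF sets_vol] by simp

lemma emeasure_vol: "c \<in> \<A> \<Longrightarrow> A \<in> sets borel \<Longrightarrow> A \<subseteq> dom_ch c \<Longrightarrow> emeasure vol A = emeasure (chart_measure c) A"
  using is_volume_top_power by (simp add: is_volume_def)

lemma emeasure_vol_finite: "emeasure vol UNIV < \<infinity>"
  by (rule volume_finite[OF is_volume_top_power])

lemma emeasure_vol_open_pos:
  assumes "open U" "U \<noteq> {}" shows "emeasure vol U > 0"
proof -
  obtain x where x: "x \<in> U" using assms by auto
  define c where "c = chart_at \<A> x"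
  have c: "c \<in> \<A>" "x \<in> dom_ch c" using chart_at by (auto simp: c_def)
  define W where "W = dom_ch c \<inter> U"
  have W: "open W" "W \<subseteq> dom_ch c" "x \<in> W" using assms x c open_dom[OF c(1)] by (auto simp: W_def)
  have oW: "open (crd c ` W)" "crd c ` W \<noteq> {}" using open_crd_image[OF c(1) W(1,2)] W(3) by auto
  have "emeasure vol W = (\<integral>\<^sup>+ z\<in>crd c ` W. ennreal (dens c z) \<partial>lborel)"
    using W emeasure_vol[OF c(1), of W] by (simp add: emeasure_chart_measure[OF c(1)] Int_absorb1)
  also have "\<dots> \<noteq> 0"
  proof
    have m: "(\<lambda>z. ennreal (dens c z) * indicator (crd c ` W) z) \<in> borel_measurable lborel"
      using borel_dens[OF c(1), of "crd c ` W"] oW W(2) crd_in[OF c(1)] by auto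
    assume "(\<integral>\<^sup>+ z\<in>crd c ` W. ennreal (dens c z) \<partial>lborel) = 0"
    then have "AE z in lborel. ennreal (dens c z) * indicator (crd c ` W) z = 0"
      using nn_integral_0_iff_AE[OF m] by simp
    then have "AE z in lborel. z \<notin> crd c ` W"
    proof (rule AE_mp, intro AE_I2 impI notI)
      fix z assume "ennreal (dens c z) * indicator (crd c ` W) z = 0" "z \<in> crd c ` W"
      then show False using dens_pos[OF c(1), of z] W(2) crd_in[OF c(1)] by auto
    qed
    then have "emeasure lborel (crd c ` W) = 0" using oW(1) by (simp add: AE_iff_measurable[of "crd c ` W"])
    moreover obtain z \<epsilon> where "\<epsilon> > 0" "ball z \<epsilon> \<subseteq> crd c ` W" using oW open_contains_ball by blast
    ultimately have "emeasure lborel (ball z \<epsilon>) = 0"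
      using emeasure_mono[of "ball z \<epsilon>" "crd c ` W" lborel] oW(1) by simp
    then show False using content_ball_pos[OF \<open>\<epsilon> > 0\<close>, of z] by (simp add: measure_def)
  qed
  finally have "emeasure vol W > 0" by (simp add: zero_less_iff_neq_zero)
  also have "emeasure vol W \<le> emeasure vol U" by (rule emeasure_mono) (use assms in \<open>auto simp: W_def\<close>)
  finally show ?thesis .
qed

text \<open>Restricted to the domain of \<open>c\<close>, the volume measure is the image of the density under the inverse chart.\<close>

lemma integral_vol_chart:
  fixes h :: "'a \<Rightarrow> real"
  assumes c: "c \<in> \<A>" and h: "h \<in> borel_measurable borel" and supp: "\<And>x. x \<notin> dom_ch c \<Longrightarrow> h x = 0"
  shows "(\<integral>x. h x \<partial>vol) = (LINT z:img_ch c|lborel. dens c z * h (pt c z))"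
proof -
  have D[measurable]: "dom_ch c \<in> sets borel" using open_dom[OF c] by simp
  have eq: "density vol (\<lambda>x. ennreal (indicator (dom_ch c) x)) = chart_measure c"
  proof (rule measure_eqI)
    fix B assume "B \<in> sets (density vol (\<lambda>x. ennreal (indicator (dom_ch c) x)))"
    then have B[measurable]: "B \<in> sets borel" by simp
    have "emeasure (density vol (\<lambda>x. ennreal (indicator (dom_ch c) x))) B = (\<integral>\<^sup>+ x. ennreal (indicator (dom_ch c) x) * indicator B x \<partial>vol)"
      by (rule emeasure_density) auto
    also have "\<dots> = (\<integral>\<^sup>+ x. indicator (dom_ch c \<inter> B) x \<partial>vol)"
      by (rule nn_integral_cong) (simp add: indicator_def)
    also have "\<dots> = emeasure vol (dom_ch c \<inter> B)" by simp
    also have "\<dots> = emeasure (chart_measure c) (dom_ch c \<inter> B)" by (rule emeasure_vol[OF c]) auto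
    also have "\<dots> = emeasure (chart_measure c) B" by (simp add: emeasure_chart_measure[OF c] Int_assoc[symmetric])
    finally show "emeasure (density vol (\<lambda>x. ennreal (indicator (dom_ch c) x))) B = emeasure (chart_measure c) B" .
  qed simp
  have g: "(\<lambda>z. indicator (img_ch c) z * dens c z) \<in> borel_measurable lborel"
    using borel_measurable_continuous_on_indicator[OF _ continuous_dens[OF c]] open_img[OF c] by simp
  have g0: "0 \<le> indicator (img_ch c) z * dens c z" for z
    using dens_pos[OF c, of z] by (auto simp: indicator_def less_imp_le)
  have dl: "density lborel (\<lambda>z. ennreal (dens c z) * indicator (img_ch c) z) = density lborel (\<lambda>z. ennreal (indicator (img_ch c) z * dens c z))"
    by (rule arg_cong[where f = "density lborel"]) (auto simp: fun_eq_iff indicator_def)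
  have "(\<integral>x. h x \<partial>vol) = (\<integral>x. indicator (dom_ch c) x *\<^sub>R h x \<partial>vol)"
    by (rule Bochner_Integration.integral_cong[OF refl]) (use supp in \<open>auto simp: indicator_def\<close>)
  also have "\<dots> = (\<integral>x. h x \<partial>density vol (\<lambda>x. ennreal (indicator (dom_ch c) x)))"
    using h by (subst integral_density) auto
  also have "\<dots> = (\<integral>x. h x \<partial>chart_measure c)" by (simp only: eq)
  also have "\<dots> = (\<integral>z. h (pt0 c z) \<partial>density lborel (\<lambda>z. ennreal (indicator (img_ch c) z * dens c z)))"
    unfolding chart_measure_def dl using measurable_pt0[OF c] h by (subst integral_distr) auto
  also have "\<dots> = (\<integral>z. (indicator (img_ch c) z * dens c z) *\<^sub>R h (pt0 c z) \<partial>lborel)"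
    using measurable_compose[OF measurable_pt0[OF c] h] g g0 by (intro integral_density) auto
  also have "\<dots> = (LINT z:img_ch c|lborel. dens c z * h (pt c z))"
    unfolding set_lebesgue_integral_def
    by (rule Bochner_Integration.integral_cong[OF refl]) (auto simp: indicator_def pt0_def)
  finally show ?thesis .
qed

end

section \<open>Functions on the manifold and the weak eigenvalue equation\<close>

context cplx_manifold
begin

definition C1_fun :: "('a \<Rightarrow> real) set" where
  "C1_fun = {u. \<forall>c\<in>\<A>. C1_on (img_ch c) (\<lambda>z. u (pt c z))}"

text \<open>The (1,0)-part \<open>\<partial>u\<close> of the differential.\<close>

definition del_of :: "('a \<Rightarrow> real) \<Rightarrow> ('a, 'n) form10" where
  "del_of u c x = (\<chi> j. dz j (\<lambda>z. complex_of_real (u (pt c z))) (crd c x))"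

lemma C1_fun_D: "u \<in> C1_fun \<Longrightarrow> c \<in> \<A> \<Longrightarrow> C1_on (img_ch c) (\<lambda>z. u (pt c z))"
  by (simp add: C1_fun_def)

lemma continuous_from_charts:
  fixes u :: "'a \<Rightarrow> 'b::topological_space"
  assumes "\<And>c. c \<in> \<A> \<Longrightarrow> continuous_on (img_ch c) (\<lambda>z. u (pt c z))"
  shows "continuous_on UNIV u"
proof (rule continuous_at_imp_continuous_on, rule ballI)
  fix x
  let ?c = "chart_at \<A> x"
  note c = chart_at(1)[of x] chart_at(2)[of x]
  have "continuous_on (dom_ch ?c) (\<lambda>y. u (pt ?c (crd ?c y)))"
    by (rule continuous_on_compose2[OF assms[OF c(1)] cont_crd[OF c(1)]]) (use crd_in[OF c(1)] in blast)
  moreover have "u (pt ?c (crd ?c y)) = u y" if "y \<in> dom_ch ?c" for y using that pt_crd[OF c(1)] by simp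
  ultimately have "continuous_on (dom_ch ?c) u" by (simp cong: continuous_on_cong)
  then show "isCont u x" using continuous_on_eq_continuous_at[OF open_dom[OF c(1)]] c(2) by blast
qed

lemma continuous_C1_fun: "u \<in> C1_fun \<Longrightarrow> continuous_on UNIV u"
  by (rule continuous_from_charts) (rule C1_on_imp_continuous_on[OF C1_fun_D])

lemma C1_fun_const: "(\<lambda>x. a) \<in> C1_fun" by (simp add: C1_fun_def)

lemma C1_fun_add: "u \<in> C1_fun \<Longrightarrow> v \<in> C1_fun \<Longrightarrow> (\<lambda>x. u x + v x) \<in> C1_fun"
  by (simp add: C1_fun_def C1_on_add)

lemma C1_fun_mult: "u \<in> C1_fun \<Longrightarrow> v \<in> C1_fun \<Longrightarrow> (\<lambda>x. u x * v x) \<in> C1_fun"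
  by (simp add: C1_fun_def C1_on_mult)

lemma C1_fun_lincomb: "u \<in> C1_fun \<Longrightarrow> v \<in> C1_fun \<Longrightarrow> (\<lambda>x. a * u x + b * v x) \<in> C1_fun"
  by (intro C1_fun_add C1_fun_mult C1_fun_const)

lemma C1_fun_sum: "(\<And>i. i \<in> I \<Longrightarrow> u i \<in> C1_fun) \<Longrightarrow> (\<lambda>x. \<Sum>i\<in>I. u i x) \<in> C1_fun"
  by (simp add: C1_fun_def C1_on_sum)

lemma C1_fun_inverse: "u \<in> C1_fun \<Longrightarrow> (\<And>x. u x \<noteq> 0) \<Longrightarrow> (\<lambda>x. inverse (u x)) \<in> C1_fun"
  by (simp add: C1_fun_def C1_on_inverse)

lemma C1_fun_chain:
  assumes "u \<in> C1_fun" "\<And>s. (\<phi> has_real_derivative \<phi>' s) (at s)" "continuous_on UNIV \<phi>'"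
  shows "(\<lambda>x. \<phi> (u x)) \<in> C1_fun"
  unfolding C1_fun_def
proof (intro CollectI ballI)
  fix c assume "c \<in> \<A>"
  from C1_on_real_chain[OF C1_fun_D[OF assms(1) this] assms(2,3)]
  show "C1_on (img_ch c) (\<lambda>z. \<phi> (u (pt c z)))" .
qed

lemma smooth_imp_C1_fun: "smooth_fun \<A> u \<Longrightarrow> u \<in> C1_fun"
  by (auto simp: smooth_fun_def C1_fun_def o_def intro: smooth_on_imp_C1_on)

lemma del_of_lincomb:
  assumes "u \<in> C1_fun" "v \<in> C1_fun" "c \<in> \<A>" "x \<in> dom_ch c"
  shows "del_of (\<lambda>x. a * u x + b * v x) c x = a *\<^sub>R del_of u c x + b *\<^sub>R del_of v c x"
proof -
  let ?z = "crd c x"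
  let ?U = "\<lambda>z. complex_of_real (u (pt c z))" and ?V = "\<lambda>z. complex_of_real (v (pt c z))"
  have z: "?z \<in> img_ch c" by (rule crd_in[OF assms(3,4)])
  have "((\<lambda>z. of_real a * ?U z + of_real b * ?V z) has_derivative (\<lambda>h. of_real a * fd ?U ?z h + of_real b * fd ?V ?z h)) (at ?z)"
    by (intro has_derivative_add has_derivative_mult_right C1_onD(1)[OF C1_on_of_real[OF C1_fun_D]] assms z)
  then have "dz j (\<lambda>z. complex_of_real (a * u (pt c z) + b * v (pt c z))) ?z = of_real a * dz j ?U ?z + of_real b * dz j ?V ?z" for j
    unfolding of_real_add of_real_mult
    by (subst dz_has_derivative) (auto simp: dz_def field_simps)
  then show ?thesis by (simp add: del_of_def vec_eq_iff scaleR_conv_of_real[where 'a = complex])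
qed

lemma del_of_chain:
  assumes "u \<in> C1_fun" "c \<in> \<A>" "x \<in> dom_ch c" and h: "\<And>s. (\<phi> has_real_derivative \<phi>' s) (at s)"
  shows "del_of (\<lambda>x. \<phi> (u x)) c x = \<phi>' (u x) *\<^sub>R del_of u c x"
proof -
  let ?z = "crd c x"
  let ?u = "\<lambda>z. u (pt c z)"
  have z: "?z \<in> img_ch c" by (rule crd_in[OF assms(2,3)])
  have px: "pt c ?z = x" by (rule pt_crd[OF assms(2,3)])
  have du: "(?u has_derivative fd ?u ?z) (at ?z)" by (rule C1_onD(1)[OF C1_fun_D[OF assms(1,2)] z])
  have "((\<lambda>z. \<phi> (?u z)) has_derivative (\<lambda>v. \<phi>' (?u ?z) * fd ?u ?z v)) (at ?z)"
    using diff_chain_at[OF du, of \<phi> "(*) (\<phi>' (?u ?z))"] h by (simp add: o_def has_field_derivative_def)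
  from bounded_linear.has_derivative[OF bounded_linear_of_real this]
  have "dz j (\<lambda>z. complex_of_real (\<phi> (?u z))) ?z = of_real (\<phi>' (u x)) * dz j (\<lambda>z. complex_of_real (?u z)) ?z" for j
    using C1_on_differentiable[OF C1_fun_D[OF assms(1,2)] z]
    by (subst dz_has_derivative) (auto simp: dz_def fd_of_real px field_simps)
  then show ?thesis by (simp add: del_of_def vec_eq_iff scaleR_conv_of_real[where 'a = complex])
qed

lemma del_of_trans:
  assumes u: "u \<in> C1_fun" and c: "c \<in> \<A>" and d: "d \<in> \<A>" and x: "x \<in> dom_ch c \<inter> dom_ch d"
  shows "del_of u c x = transpose (Jac c d (crd c x)) *v del_of u d x"
proof -
  let ?z = "crd c x" and ?f = "trans_map c d"
  let ?U = "\<lambda>z. complex_of_real (u (pt d z))"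
  have z: "?z \<in> overlap c d" using x by (auto simp: overlap_def)
  have fz: "?f ?z = crd d x" using x c by (simp add: trans_map_def)
  have "dz j (\<lambda>z. complex_of_real (u (pt c z))) ?z = (\<Sum>a\<in>UNIV. Jac c d ?z $ a $ j * dz a ?U (crd d x))" for j
  proof -
    have "dz j (\<lambda>z. complex_of_real (u (pt c z))) ?z = dz j (\<lambda>z. ?U (?f z)) ?z"
    proof (rule dz_cong[OF open_overlap[OF c d] z])
      show "complex_of_real (u (pt c w)) = ?U (?f w)" if "w \<in> overlap c d" for w
        using that d by (simp add: mem_overlap[OF c] trans_map_def)
      show "(\<lambda>z. complex_of_real (u (pt c z))) differentiable at ?z"
        by (rule C1_on_differentiable[OF C1_on_of_real[OF C1_fun_D[OF u c]]]) (use x crd_in[OF c] in auto)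
    qed
    also have "\<dots> = (\<Sum>a\<in>UNIV. Jac c d ?z $ a $ j * dz a ?U (?f ?z))"
      by (rule dz_chain(1)[OF Jac[OF c d z]])
         (use C1_on_differentiable[OF C1_on_of_real[OF C1_fun_D[OF u d]]] fz x crd_in[OF d] in auto)
    finally show ?thesis by (simp only: fz)
  qed
  then show ?thesis by (simp add: del_of_def vec_eq_iff matrix_vector_mult_def transpose_def)
qed

text \<open>The classical derivative is the weak one, by integration by parts in each chart.\<close>

lemma weak_del_del_of:
  assumes u: "u \<in> C1_fun" shows "weak_del \<A> u (del_of u)"
  unfolding weak_del_def
proof (intro conjI ballI allI impI)
  fix c d x v assume cd: "c \<in> \<A>" "d \<in> \<A>" and x: "x \<in> dom_ch c \<inter> dom_ch d"
  let ?J = "Jac c d (crd c x)"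
  have "(\<Sum>j\<in>UNIV. del_of u c x $ j * v $ j) = (\<Sum>j\<in>UNIV. \<Sum>a\<in>UNIV. ?J $ a $ j * del_of u d x $ a * v $ j)"
    unfolding del_of_trans[OF u cd x] by (simp add: matrix_vector_mult_def transpose_def sum_distrib_right)
  also have "\<dots> = (\<Sum>a\<in>UNIV. \<Sum>j\<in>UNIV. ?J $ a $ j * del_of u d x $ a * v $ j)" by (rule sum.swap)
  also have "\<dots> = (\<Sum>a\<in>UNIV. del_of u d x $ a * tangent_map c d x v $ a)"
    unfolding tangent_map_eq[OF cd x] by (simp add: matrix_vector_mult_def sum_distrib_left mult_ac)
  finally show "(\<Sum>j\<in>UNIV. del_of u c x $ j * v $ j) = (\<Sum>j\<in>UNIV. del_of u d x $ j * tangent_map c d x v $ j)" .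
next
  fix c assume c: "c \<in> \<A>"
  let ?U = "\<lambda>z. complex_of_real (u (pt c z))"
  have U: "C1_on (img_ch c) ?U" by (rule C1_on_of_real[OF C1_fun_D[OF u c]])
  have li: "loc_integrable_on (img_ch c) f" if "continuous_on (img_ch c) f" for f :: "complex^'n \<Rightarrow> complex"
    unfolding loc_integrable_on_def set_integrable_def
    using that continuous_on_subset by (auto intro!: borel_integrable_compact)
  show "loc_integrable_on (img_ch c) ?U" by (rule li[OF C1_on_imp_continuous_on[OF U]])
  fix j
  have D: "del_of u c (pt c z) $ j = dz j ?U z" if "z \<in> img_ch c" for z using that c by (simp add: del_of_def)
  have "continuous_on (img_ch c) (\<lambda>z. del_of u c (pt c z) $ j)"
    using continuous_on_dz[OF U, of j] D by (simp cong: continuous_on_cong)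
  then show "loc_integrable_on (img_ch c) (\<lambda>z. del_of u c (pt c z) $ j)" by (rule li)
  fix \<eta> assume t: "test_function (img_ch c) \<eta>"
  then obtain K where K: "compact K" "K \<subseteq> img_ch c" "\<And>z. z \<notin> K \<Longrightarrow> \<eta> z = 0" and sm: "smooth_on UNIV \<eta>"
    by (auto simp: test_function_def)
  have "(LINT z:img_ch c|lborel. ?U z * dz j \<eta> z) = - (LINT z:img_ch c|lborel. dz j ?U z * \<eta> z)"
    by (rule integral_by_parts_dz(1)[OF open_img[OF c] U smooth_on_imp_C1_on[OF sm] K])
  also have "(LINT z:img_ch c|lborel. dz j ?U z * \<eta> z) = (LINT z:img_ch c|lborel. del_of u c (pt c z) $ j * \<eta> z)"
    by (rule set_lebesgue_integral_cong) (use open_img[OF c] D in auto)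
  finally show "(LINT z:img_ch c|lborel. ?U z * dz j \<eta> z) = - (LINT z:img_ch c|lborel. del_of u c (pt c z) $ j * \<eta> z)" .
qed

text \<open>The function is \<open>t\<^sup>2\<close> for \<open>t > 0\<close> and 0 otherwise.\<close>

lemma C1_truncated_square: "((\<lambda>t. (t\<^sup>2 + signed_powr 2 t) / 2) has_real_derivative (2 * t + signed_powr_deriv 2 t) / 2) (at t)"
  by (auto intro!: derivative_eq_intros DERIV_signed_powr)

text \<open>In the chart \<open>c\<close> the function is the squared positive part of \<open>r\<^sup>2 - \<bar>z - w\<bar>\<^sup>2\<close>.  In another chart it is
  continuously differentiable because changes of charts are, and because the closed coordinate ball is
  compact, hence closed in the manifold.\<close>

lemma bump_function:
  assumes c: "c \<in> \<A>" and r: "r > 0" "cball w r \<subseteq> img_ch c"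
  obtains \<beta> where "\<beta> \<in> C1_fun" "\<And>y. \<beta> y \<ge> 0" "\<And>y. y \<notin> pt c ` cball w r \<Longrightarrow> \<beta> y = 0" "\<And>y. y \<in> pt c ` ball w r \<Longrightarrow> \<beta> y > 0"
proof -
  define \<chi>' where "\<chi>' t = (t\<^sup>2 + signed_powr 2 t) / 2" for t
  define b where "b z = \<chi>' (r\<^sup>2 - (z - w) \<bullet> (z - w))" for z
  define \<beta> where "\<beta> y = (if y \<in> dom_ch c then b (crd c y) else 0)" for y
  have chi: "\<chi>' t = (if t > 0 then t\<^sup>2 else 0)" for t
    by (auto simp: \<chi>'_def signed_powr_def sgn_if)
  have "C1_on UNIV (\<lambda>z. r\<^sup>2 - (z - w) \<bullet> (z - w))"
    by (rule C1_onI[where f' = "\<lambda>z v. - (2 * ((z - w) \<bullet> v))"])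
       (auto intro!: derivative_eq_intros continuous_intros simp: inner_commute)
  then have b1: "C1_on UNIV b" unfolding b_def
    by (rule C1_on_real_chain[where h' = "\<lambda>t. (2 * t + signed_powr_deriv 2 t) / 2"])
       (auto simp: \<chi>'_def[abs_def] intro!: C1_truncated_square continuous_intros continuous_signed_powr_deriv)
  have bpos: "b z > 0 \<longleftrightarrow> z \<in> ball w r" and b0: "b z = 0 \<longleftrightarrow> z \<notin> ball w r" for z
  proof -
    have "(norm (z - w))\<^sup>2 < r\<^sup>2 \<longleftrightarrow> norm (z - w) < r"
      using r(1) by (metis less_imp_le norm_ge_zero power2_less_imp_less power_strict_mono zero_less_numeral)
    then have "r\<^sup>2 - (z - w) \<bullet> (z - w) > 0 \<longleftrightarrow> z \<in> ball w r"
      by (simp add: dist_norm norm_minus_commute power2_norm_eq_inner[symmetric])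
    then show "b z > 0 \<longleftrightarrow> z \<in> ball w r" "b z = 0 \<longleftrightarrow> z \<notin> ball w r" by (auto simp: b_def chi)
  qed
  define K where "K = pt c ` cball w r"
  have "compact K" unfolding K_def
    by (rule compact_continuous_image[OF continuous_on_subset[OF cont_pt[OF c] r(2)]]) simp
  then have cK: "closed K" by (rule compact_imp_closed)
  have KD: "K \<subseteq> dom_ch c" unfolding K_def using r(2) pt_in[OF c] by blast
  have out: "\<beta> y = 0" if "y \<notin> K" for y
  proof (cases "y \<in> dom_ch c")
    case True
    then have "crd c y \<notin> ball w r" using that pt_crd[OF c True] ball_subset_cball unfolding K_def by (metis imageI subsetD)
    then show ?thesis using b0 True by (simp add: \<beta>_def)
  qed (simp add: \<beta>_def)
  have "\<beta> \<in> C1_fun"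
    unfolding C1_fun_def
  proof (intro CollectI ballI)
    fix d assume d: "d \<in> \<A>"
    define T where "T = img_ch d \<inter> pt d -` (- K)"
    have T: "open T" unfolding T_def
      by (rule continuous_open_preimage[OF cont_pt[OF d] open_img[OF d]]) (use cK in auto)
    have "C1_on (overlap d c \<union> T) (\<lambda>z. \<beta> (pt d z))"
    proof (rule C1_on_Un[OF open_overlap[OF d c] T])
      show "C1_on (overlap d c) (\<lambda>z. \<beta> (pt d z))"
      proof (rule C1_on_cong_open[OF open_overlap[OF d c]])
        show "C1_on (overlap d c) (\<lambda>z. b (trans_map d c z))" by (rule C1_on_compose[OF C1_trans[OF d c] b1]) simp
        show "b (trans_map d c z) = \<beta> (pt d z)" if "z \<in> overlap d c" for z
          using that by (simp add: mem_overlap[OF d] \<beta>_def trans_map_def)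
      qed
      show "C1_on T (\<lambda>z. \<beta> (pt d z))"
        by (rule C1_on_cong_open[OF T, of "\<lambda>z. 0"]) (use out in \<open>auto simp: T_def\<close>)
    qed
    then show "C1_on (img_ch d) (\<lambda>z. \<beta> (pt d z))"
      by (rule C1_on_subset) (use KD in \<open>auto simp: T_def mem_overlap[OF d]\<close>)
  qed
  moreover have "\<beta> y \<ge> 0" for y using bpos[of "crd c y"] b0[of "crd c y"] by (auto simp: \<beta>_def)
  moreover have "\<beta> y > 0" if y: "y \<in> pt c ` ball w r" for y
  proof -
    obtain z where z: "z \<in> ball w r" "y = pt c z" using y by blast
    then have "z \<in> img_ch c" using r(2) ball_subset_cball by blast
    then show ?thesis using z bpos[of z] pt_in[OF c] crd_pt[OF c] by (simp add: \<beta>_def)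
  qed
  ultimately show ?thesis using that[of \<beta>] out unfolding K_def by blast
qed

lemma partition_of_unity:
  obtains F :: "'a set" and \<beta> :: "'a \<Rightarrow> 'a \<Rightarrow> real" and K :: "'a \<Rightarrow> 'a set" where "finite F"
    "\<And>x. \<beta> x \<in> C1_fun" "\<And>x. compact (K x)" "\<And>x. K x \<subseteq> dom_ch (chart_at \<A> x)" "\<And>x y. y \<notin> K x \<Longrightarrow> \<beta> x y = 0"
    "\<And>y. (\<Sum>x\<in>F. \<beta> x y) = 1"
proof -
  obtain F :: "'a set" and r where F: "finite F" "\<And>x. r x > 0"
    "\<And>x. cball (crd (chart_at \<A> x) x) (r x) \<subseteq> img_ch (chart_at \<A> x)"
    "(\<Union>x\<in>F. pt (chart_at \<A> x) ` ball (crd (chart_at \<A> x) x) (r x)) = UNIV"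
    by (rule finite_ball_cover) (rule that)
  define K where "K x = pt (chart_at \<A> x) ` cball (crd (chart_at \<A> x) x) (r x)" for x
  have "\<exists>b. b \<in> C1_fun \<and> (\<forall>y. b y \<ge> 0) \<and> (\<forall>y. y \<notin> K x \<longrightarrow> b y = 0) \<and>
      (\<forall>y. y \<in> pt (chart_at \<A> x) ` ball (crd (chart_at \<A> x) x) (r x) \<longrightarrow> b y > 0)" for x
    using bump_function[OF chart_at(1) F(2,3), of x] unfolding K_def by metis
  then obtain b where b: "\<And>x. b x \<in> C1_fun" "\<And>x y. b x y \<ge> 0" "\<And>x y. y \<notin> K x \<Longrightarrow> b x y = 0"
    "\<And>x y. y \<in> pt (chart_at \<A> x) ` ball (crd (chart_at \<A> x) x) (r x) \<Longrightarrow> b x y > 0"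
    by metis
  define s where "s y = (\<Sum>x\<in>F. b x y)" for y
  have s0: "s y > 0" for y
  proof -
    obtain x where "x \<in> F" "b x y > 0" using F(4) b(4) by blast
    then show ?thesis unfolding s_def using F(1) b(2) by (intro sum_pos2) auto
  qed
  have sC: "s \<in> C1_fun" unfolding s_def[abs_def] by (rule C1_fun_sum[OF b(1)])
  show ?thesis
  proof (rule that[of F "\<lambda>x y. b x y * inverse (s y)" K])
    show "(\<lambda>y. b x y * inverse (s y)) \<in> C1_fun" for x
      using s0 by (intro C1_fun_mult C1_fun_inverse b(1) sC) (metis less_irrefl)
    show "compact (K x)" for x unfolding K_def
      by (rule compact_continuous_image[OF continuous_on_subset[OF cont_pt[OF chart_at(1)] F(3)]]) simp
    show "K x \<subseteq> dom_ch (chart_at \<A> x)" for x unfolding K_def using F(3) pt_in[OF chart_at(1)] by blast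
    show "(\<Sum>x\<in>F. b x y * inverse (s y)) = 1" for y
      using s0[of y] by (simp add: sum_distrib_right[symmetric] s_def[symmetric])
  qed (use F b in auto)
qed

end

context kahler_manifold
begin

text \<open>The real part of the Hermitian product of \<open>\<partial>u\<close> and \<open>\<partial>v\<close>; on the diagonal it is \<open>grad_sq\<close>.\<close>

definition \<Gamma> :: "('a \<Rightarrow> real) \<Rightarrow> ('a \<Rightarrow> real) \<Rightarrow> 'a \<Rightarrow> real" where
  "\<Gamma> u v x = (let c = chart_at \<A> x in Re (gram (matrix_inv (\<omega> c x)) (del_of u c x) (del_of v c x)))"

lemma grad_sq_del_of: "grad_sq \<A> \<omega> (del_of u) = \<Gamma> u u"
  by (simp add: fun_eq_iff grad_sq_def \<Gamma>_def gram_def Let_def)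

text \<open>The definition uses one chosen chart at each point; here independence of that choice is shown, which makes
  \<open>\<Gamma> u v\<close> continuous.\<close>

lemma \<Gamma>_chart:
  assumes "u \<in> C1_fun" "v \<in> C1_fun" "c \<in> \<A>" "x \<in> dom_ch c"
  shows "\<Gamma> u v x = Re (gram (matrix_inv (\<omega> c x)) (del_of u c x) (del_of v c x))"
proof -
  let ?e = "chart_at \<A> x"
  have x: "x \<in> dom_ch ?e \<inter> dom_ch c" using chart_at(2) assms(4) by simp
  note e = chart_at(1)[of x]
  show ?thesis unfolding \<Gamma>_def Let_def
    unfolding gram_pullback[OF metric_pullback[OF e assms(3) x] det_metric_nz[OF e chart_at(2)]]
    unfolding del_of_trans[OF assms(1) e assms(3) x] del_of_trans[OF assms(2) e assms(3) x] ..
qed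

lemma gram_scale_add: "gram M (a *\<^sub>R x + b *\<^sub>R y) w = of_real a * gram M x w + of_real b * gram M y w"
  by (simp add: gram_def scaleR_conv_of_real[where 'a = complex] algebra_simps sum.distrib sum_distrib_left)

lemma gram_scale: "gram M (a *\<^sub>R x) w = of_real a * gram M x w"
  using gram_scale_add[of M a x 0 0 w] by simp

lemma C1_matrix_inv_metric: "c \<in> \<A> \<Longrightarrow> C1_on (img_ch c) (\<lambda>z. matrix_inv (\<omega> c (pt c z)) $ k $ j)"
  by (intro C1_on_matrix_inv open_img C1_metric det_metric_nz pt_in)

lemma continuous_\<Gamma>:
  assumes u: "u \<in> C1_fun" and v: "v \<in> C1_fun" shows "continuous_on UNIV (\<Gamma> u v)"
proof (rule continuous_from_charts)
  fix c assume c: "c \<in> \<A>"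
  let ?U = "\<lambda>z. complex_of_real (u (pt c z))" and ?V = "\<lambda>z. complex_of_real (v (pt c z))"
  have eq: "\<Gamma> u v (pt c z) = Re (\<Sum>j\<in>UNIV. \<Sum>k\<in>UNIV. matrix_inv (\<omega> c (pt c z)) $ k $ j * dz j ?U z * cnj (dz k ?V z))"
    if "z \<in> img_ch c" for z
    using \<Gamma>_chart[OF u v c pt_in[OF c that]] crd_pt[OF c that] by (simp add: gram_def del_of_def)
  have "continuous_on (img_ch c) (\<lambda>z. Re (\<Sum>j\<in>UNIV. \<Sum>k\<in>UNIV. matrix_inv (\<omega> c (pt c z)) $ k $ j * dz j ?U z * cnj (dz k ?V z)))"
    by (intro continuous_intros C1_on_imp_continuous_on[OF C1_matrix_inv_metric[OF c]]
          continuous_on_dz C1_on_of_real C1_fun_D u v c)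
  then show "continuous_on (img_ch c) (\<lambda>z. \<Gamma> u v (pt c z))" using eq by (simp cong: continuous_on_cong)
qed

lemma \<Gamma>_lincomb:
  assumes "u \<in> C1_fun" "v \<in> C1_fun" "w \<in> C1_fun"
  shows "\<Gamma> (\<lambda>x. a * u x + b * v x) w x = a * \<Gamma> u w x + b * \<Gamma> v w x"
  unfolding \<Gamma>_def Let_def del_of_lincomb[OF assms(1,2) chart_at] gram_scale_add by simp

sublocale dirichlet_form vol C1_fun \<Gamma>
proof
  show "compact (UNIV :: 'a set)" by (rule compact_X)
  show "sets vol = sets borel" by simp
  show "emeasure vol UNIV \<noteq> \<infinity>" using emeasure_vol_finite by simp
  show "0 < emeasure vol U" if "open U" "U \<noteq> {}" for U by (rule emeasure_vol_open_pos[OF that])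
  show "\<Gamma> u v x = \<Gamma> v u x" if "u \<in> C1_fun" "v \<in> C1_fun" for u v x
    unfolding \<Gamma>_def Let_def by (rule gram_sym[OF herm_pd_metric[OF chart_at]])
  show "0 \<le> \<Gamma> u u x" for u x
    unfolding \<Gamma>_def Let_def by (rule gram_self_nonneg[OF herm_pd_metric[OF chart_at]])
  show "\<Gamma> (\<lambda>x. \<phi> (u x)) v x = \<phi>' (u x) * \<Gamma> u v x"
    if "u \<in> C1_fun" "v \<in> C1_fun" "\<And>s. (\<phi> has_real_derivative \<phi>' s) (at s)" "continuous_on UNIV \<phi>'" for u v \<phi> \<phi>' x
    unfolding \<Gamma>_def Let_def del_of_chain[OF that(1) chart_at that(3)] gram_scale by simp
qed (fact continuous_C1_fun continuous_\<Gamma> C1_fun_const C1_fun_lincomb \<Gamma>_lincomb C1_fun_chain)+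

lemma C1_dzbar:
  assumes u: "smooth_fun \<A> u" and c: "c \<in> \<A>"
  shows "C1_on (img_ch c) (dzbar k (\<lambda>z. complex_of_real (u (pt c z))))"
proof (rule C1_on_cong_open[OF open_img[OF c]])
  let ?u = "\<lambda>z. u (pt c z)"
  have sm: "smooth_on (img_ch c) ?u" using u c by (simp add: smooth_fun_def o_def)
  have B: "axis k (1::complex) \<in> Basis" "axis k \<i> \<in> Basis" by (auto simp: Basis_vec_def Basis_complex_def)
  have F: "C1_on (img_ch c) (\<lambda>z. complex_of_real (fd ?u z b))" if "b \<in> Basis" for b
    by (rule C1_on_of_real[OF smooth_on_imp_C1_on[OF smooth_on_fd[OF sm that]]])
  show "C1_on (img_ch c) (\<lambda>z. (complex_of_real (fd ?u z (axis k 1)) + \<i> * complex_of_real (fd ?u z (axis k \<i>))) * inverse 2)"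
    by (intro C1_on_mult C1_on_add C1_on_const F B)
  show "(complex_of_real (fd ?u z (axis k 1)) + \<i> * complex_of_real (fd ?u z (axis k \<i>))) * inverse 2 = dzbar k (\<lambda>z. complex_of_real (u (pt c z))) z"
    if "z \<in> img_ch c" for z
    unfolding dzbar_def divide_inverse fd_of_real[OF C1_on_differentiable[OF smooth_on_imp_C1_on[OF sm] that]] ..
qed

text \<open>Independence of the chart, from the transformation rules of the metric and of the complex Hessian.\<close>

lemma laplacian_chart:
  assumes u: "smooth_fun \<A> u" and d: "d \<in> \<A>" and xd: "x \<in> dom_ch d"
  shows "laplacian \<A> \<omega> u x = Re (\<Sum>j\<in>UNIV. \<Sum>k\<in>UNIV. matrix_inv (\<omega> d x) $ k $ j *
       dz j (dzbar k (\<lambda>z. complex_of_real (u (pt d z)))) (crd d x))"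
proof -
  define c where "c = chart_at \<A> x"
  have c: "c \<in> \<A>" and xc: "x \<in> dom_ch c" by (simp_all add: c_def chart_at)
  have x: "x \<in> dom_ch c \<inter> dom_ch d" using xc xd by simp
  define H where "H e = (\<chi> j k. dz j (dzbar k (\<lambda>z. complex_of_real (u (pt e z)))) (crd e x))" for e :: "('a, 'n) chart"
  have tr: "(\<Sum>j\<in>UNIV. \<Sum>k\<in>UNIV. matrix_inv (\<omega> e x) $ k $ j * dz j (dzbar k (\<lambda>z. complex_of_real (u (pt e z)))) (crd e x))
     = trace (matrix_inv (\<omega> e x) ** H e)" for e :: "('a, 'n) chart"
    unfolding trace_def matrix_matrix_mult_def H_def by (subst sum.swap) simp
  let ?z = "crd c x" and ?f = "trans_map c d" and ?J = "Jac c d (crd c x)"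
  let ?U = "\<lambda>z. complex_of_real (u (pt d z))"
  have z: "?z \<in> overlap c d" using x by (auto simp: overlap_def)
  have zi: "?z \<in> img_ch c" by (rule crd_in[OF c xc])
  have fz: "?f ?z = crd d x" using x c by (simp add: trans_map_def)
  have u1: "u \<in> C1_fun" by (rule smooth_imp_C1_fun[OF u])
  have agree: "complex_of_real (u (pt c w)) = ?U (?f w)" if "w \<in> overlap c d" for w
    using that d by (simp add: mem_overlap[OF c] trans_map_def)
  have fin: "?f w \<in> img_ch d" if "w \<in> overlap c d" for w
    using trans_in[OF c d that] mem_overlap[OF d] by blast
  have dzb: "dzbar k (\<lambda>z. complex_of_real (u (pt c z))) w = dzbar k (\<lambda>w. ?U (?f w)) w" if "w \<in> overlap c d" for k w
  proof -
    have wi: "w \<in> img_ch c" using that mem_overlap[OF c] by blast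
    have "((\<lambda>z. complex_of_real (u (pt c z))) has_derivative fd (\<lambda>z. complex_of_real (u (pt c z))) w) (at w)"
      by (rule C1_onD(1)[OF C1_on_of_real[OF C1_fun_D[OF u1 c]] wi])
    then have "((\<lambda>w. ?U (?f w)) has_derivative fd (\<lambda>z. complex_of_real (u (pt c z))) w) (at w)"
      by (rule has_derivative_transform_within_open[OF _ open_overlap[OF c d] that agree])
    from frechet_derivative_at[OF this] show ?thesis by (simp add: dzbar_def)
  qed
  have diffc: "dzbar k (\<lambda>z. complex_of_real (u (pt c z))) differentiable at ?z" for k
    by (rule C1_on_differentiable[OF C1_dzbar[OF u c] zi])
  have diffW: "dzbar k (\<lambda>w. ?U (?f w)) differentiable at ?z" for k
  proof -
    have "(dzbar k (\<lambda>z. complex_of_real (u (pt c z))) has_derivative fd (dzbar k (\<lambda>z. complex_of_real (u (pt c z)))) ?z) (at ?z)"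
      using diffc[of k] by (simp add: frechet_derivative_works)
    then have "(dzbar k (\<lambda>w. ?U (?f w)) has_derivative fd (dzbar k (\<lambda>z. complex_of_real (u (pt c z)))) ?z) (at ?z)"
      by (rule has_derivative_transform_within_open[OF _ open_overlap[OF c d] z dzb])
    then show ?thesis unfolding differentiable_def by blast
  qed
  have "H c = (\<chi> j k. dz j (dzbar k (\<lambda>w. ?U (?f w))) ?z)"
    unfolding H_def vec_eq_iff vec_lambda_beta
    using dz_cong[OF open_overlap[OF c d] z dzb diffc] by simp
  also have "\<dots> = transpose ?J ** (\<chi> j k. dz j (dzbar k ?U) (?f ?z)) ** conj_mat ?J"
  proof (rule hessian_chain[OF open_overlap[OF c d] z Jac[OF c d]])
    show "?U differentiable at (?f w)" if "w \<in> overlap c d" for w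
      by (rule C1_on_differentiable[OF C1_on_of_real[OF C1_fun_D[OF u1 d]] fin[OF that]])
    show "dzbar k ?U differentiable at (?f ?z)" for k
      by (rule C1_on_differentiable[OF C1_dzbar[OF u d] fin[OF z]])
  qed (assumption | rule diffW)+
  also have "(\<chi> j k. dz j (dzbar k ?U) (?f ?z)) = H d" unfolding H_def fz ..
  finally have "trace (matrix_inv (\<omega> d x) ** H d) = trace (matrix_inv (\<omega> c x) ** H c)"
    by (rule trace_pullback[OF metric_pullback[OF c d x] det_metric_nz[OF c xc]])
  then show ?thesis unfolding laplacian_def Let_def c_def[symmetric] tr by simp
qed

lemma set_integral_Re:
  assumes "set_integrable lborel S F"
  shows "(LINT z:S|lborel. k * Re (F z)) = k * Re (LINT z:S|lborel. F z)"
proof -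
  have "Re (LINT z:S|lborel. F z) = (\<integral>z. Re (indicator S z *\<^sub>R F z) \<partial>lborel)"
    using assms unfolding set_integrable_def set_lebesgue_integral_def by (simp only: integral_Re)
  then show ?thesis unfolding set_lebesgue_integral_def by (simp add: mult.left_commute)
qed

text \<open>For a test function supported in one chart the claim is \<open>integral_by_parts_laplace\<close> there: up to a constant
  the density of the volume is the determinant of the metric.\<close>

lemma eigenfunction_weak_local:
  assumes u: "smooth_fun \<A> u" and ev: "\<And>x. - laplacian \<A> \<omega> u x = \<mu> * u x"
    and \<psi>: "\<psi> \<in> C1_fun" and c: "c \<in> \<A>" and K: "compact K" "K \<subseteq> dom_ch c" "\<And>x. x \<notin> K \<Longrightarrow> \<psi> x = 0"
  shows "(\<integral>x. \<Gamma> \<psi> u x \<partial>vol) = \<mu> * (\<integral>x. \<psi> x * u x \<partial>vol)"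
proof -
  have u1: "u \<in> C1_fun" by (rule smooth_imp_C1_fun[OF u])
  define S where "S = img_ch c"
  define G where "G z = \<omega> c (pt c z)" for z
  define U where "U z = complex_of_real (u (pt c z))" for z
  define P where "P z = (if z \<in> S then complex_of_real (\<psi> (pt c z)) else 0)" for z
  define V where "V k = dzbar k U" for k
  define K' where "K' = crd c ` K"
  define \<kappa> :: real where "\<kappa> = 2 ^ CARD('n) * fact CARD('n)"
  have S: "open S" unfolding S_def by (rule open_img[OF c])
  have K': "compact K'" "K' \<subseteq> S" unfolding K'_def S_def
    using compact_continuous_image[OF continuous_on_subset[OF cont_crd[OF c] K(2)] K(1)] K(2) crd_in[OF c] by auto
  have notK: "pt c z \<notin> K" if "z \<in> S" "z \<notin> K'" for z
    using that crd_pt[OF c] unfolding K'_def S_def by (metis imageI)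
  have PC: "C1_on UNIV P" unfolding P_def
    by (rule C1_on_extend_0[OF S _ K'(1) _ K'(2)])
       (use C1_on_of_real[OF C1_fun_D[OF \<psi> c]] notK K(3) in \<open>auto simp: S_def\<close>)
  have P0: "P z = 0" if "z \<notin> K'" for z using notK[of z] that K(3) by (auto simp: P_def)
  have GC: "C1_on S (\<lambda>z. G z $ a $ b)" for a b unfolding G_def S_def by (rule C1_metric[OF c])
  have Gnz: "det (G z) \<noteq> 0" if "z \<in> S" for z
    unfolding G_def by (rule det_metric_nz[OF c]) (use that pt_in[OF c] S_def in auto)
  have kah: "dz l (\<lambda>z. G z $ j $ k) z = dz j (\<lambda>z. G z $ l $ k) z" if "z \<in> S" for z j k l
    using kahler c that unfolding kahler_metric_def G_def S_def by blast
  have VC: "C1_on S (V k)" for k unfolding V_def U_def[abs_def] S_def by (rule C1_dzbar[OF u c])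
  define F1 where "F1 z = (\<Sum>j\<in>UNIV. \<Sum>k\<in>UNIV. matrix_inv (G z) $ k $ j * dz j (V k) z) * P z * det (G z)" for z
  define F2 where "F2 z = (\<Sum>j\<in>UNIV. \<Sum>k\<in>UNIV. matrix_inv (G z) $ k $ j * dz j P z * V k z) * det (G z)" for z
  have ibp: "(LINT z:S|lborel. F1 z) = - (LINT z:S|lborel. F2 z)"
    unfolding F1_def F2_def by (rule integral_by_parts_laplace[OF S GC Gnz kah VC PC K' P0])
  have si: "set_integrable lborel S F" if "continuous_on S F" "\<And>z. z \<notin> K' \<Longrightarrow> F z = 0" for F :: "complex^'n \<Rightarrow> complex"
    unfolding set_integrable_def
  proof (rule integrable_compact_support[OF K'(1)])
    show "continuous_on K' (\<lambda>z. indicator S z *\<^sub>R F z)"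
      by (rule continuous_on_cong[THEN iffD1, OF refl _ continuous_on_subset[OF that(1) K'(2)]]) (use K'(2) in auto)
  qed (simp add: that(2))
  have cM: "continuous_on S (\<lambda>z. matrix_inv (G z) $ k $ j)" for k j
    unfolding G_def S_def by (rule C1_on_imp_continuous_on[OF C1_matrix_inv_metric[OF c]])
  have cd: "continuous_on S (\<lambda>z. det (G z))" by (intro C1_on_imp_continuous_on C1_on_det GC)
  have i1: "set_integrable lborel S F1"
    by (rule si) (auto simp: F1_def[abs_def] P0 intro!: continuous_intros cM cd continuous_on_dz VC
        C1_on_imp_continuous_on[OF C1_on_subset[OF PC subset_UNIV]])
  have dP0: "dz j P z = 0" if "z \<notin> K'" for z j using fd_outside_0[OF K'(1) P0 that] by (simp add: dz_def)
  have i2: "set_integrable lborel S F2"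
    by (rule si) (auto simp: F2_def[abs_def] dP0 intro!: continuous_intros cM cd C1_on_imp_continuous_on[OF VC]
        continuous_on_dz C1_on_subset[OF PC subset_UNIV])
  have dens: "dens c z = \<kappa> * Re (det (G z))" for z unfolding dens_eq \<kappa>_def G_def ..
  have im: "Im (det (G z)) = 0" if "z \<in> S" for z
    unfolding G_def using det_herm_pd(1)[OF herm_pd_metric[OF c pt_in[OF c]]] that by (simp add: S_def)
  have out: "\<psi> x = 0" if "x \<notin> dom_ch c" for x using that K(2,3) by blast
  have Sm: "S \<in> sets lborel" using S by simp
  have "(\<integral>x. \<psi> x * u x * \<mu> \<partial>vol) = (LINT z:S|lborel. dens c z * (\<psi> (pt c z) * u (pt c z) * \<mu>))"
    unfolding S_def
    by (rule integral_vol_chart[OF c])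
       (simp_all add: out borel_measurable_continuous_onI[OF continuous_C1_fun[OF C1_fun_mult[OF C1_fun_mult[OF \<psi> u1] C1_fun_const]]])
  also have "\<dots> = (LINT z:S|lborel. (- \<kappa>) * Re (F1 z))"
  proof (rule set_lebesgue_integral_cong[OF Sm], intro allI impI)
    fix z assume z: "z \<in> S"
    have "u (pt c z) * \<mu> = - Re (\<Sum>j\<in>UNIV. \<Sum>k\<in>UNIV. matrix_inv (G z) $ k $ j * dz j (V k) z)"
      using ev[of "pt c z"] laplacian_chart[OF u c pt_in[OF c]] z crd_pt[OF c]
      by (simp add: S_def G_def V_def U_def[abs_def] mult.commute)
    then have "\<psi> (pt c z) * u (pt c z) * \<mu> = \<psi> (pt c z) * - Re (\<Sum>j\<in>UNIV. \<Sum>k\<in>UNIV. matrix_inv (G z) $ k $ j * dz j (V k) z)"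
      by (simp only: mult.assoc)
    then show "dens c z * (\<psi> (pt c z) * u (pt c z) * \<mu>) = (- \<kappa>) * Re (F1 z)"
      using z im[OF z] by (simp add: F1_def P_def dens del: Re_sum)
  qed
  also have "\<dots> = (- \<kappa>) * Re (LINT z:S|lborel. F1 z)" by (rule set_integral_Re[OF i1])
  also have "\<dots> = \<kappa> * Re (LINT z:S|lborel. F2 z)" by (simp add: ibp)
  also have "\<dots> = (LINT z:S|lborel. \<kappa> * Re (F2 z))" by (rule set_integral_Re[OF i2, symmetric])
  also have "\<dots> = (LINT z:S|lborel. dens c z * \<Gamma> \<psi> u (pt c z))"
  proof (rule set_lebesgue_integral_cong[OF Sm], intro allI impI)
    fix z assume z: "z \<in> S"
    then have zi: "z \<in> img_ch c" by (simp add: S_def)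
    have dP: "dz j P z = dz j (\<lambda>z. complex_of_real (\<psi> (pt c z))) z" for j
      by (rule dz_cong[OF S z]) (use C1_on_differentiable[OF PC] in \<open>auto simp: P_def\<close>)
    have Vk: "V k z = cnj (dz k U z)" for k
      unfolding V_def U_def[abs_def] by (rule cnj_dzbar_of_real[OF C1_on_differentiable[OF C1_fun_D[OF u1 c] zi]])
    have "\<Gamma> \<psi> u (pt c z) = Re (\<Sum>j\<in>UNIV. \<Sum>k\<in>UNIV. matrix_inv (G z) $ k $ j * dz j P z * V k z)"
      unfolding \<Gamma>_chart[OF \<psi> u1 c pt_in[OF c zi]] gram_def del_of_def vec_lambda_beta crd_pt[OF c zi] dP Vk G_def U_def[abs_def] ..
    then show "\<kappa> * Re (F2 z) = dens c z * \<Gamma> \<psi> u (pt c z)"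
      using im[OF z] by (simp add: F2_def dens del: Re_sum)
  qed
  also have "\<dots> = (\<integral>x. \<Gamma> \<psi> u x \<partial>vol)"
    unfolding S_def
  proof (rule integral_vol_chart[OF c, symmetric])
    show "\<Gamma> \<psi> u \<in> borel_measurable borel" by (rule borel_measurable_continuous_onI[OF continuous_\<Gamma>[OF \<psi> u1]])
    fix x assume x: "x \<notin> dom_ch c"
    let ?d = "chart_at \<A> x"
    have clK: "closed K" using K(1) by (rule compact_imp_closed)
    have op: "open (img_ch ?d \<inter> pt ?d -` (- K))"
      by (rule continuous_open_preimage[OF cont_pt[OF chart_at(1)] open_img[OF chart_at(1)]]) (use clK in auto)
    have mem: "crd ?d x \<in> img_ch ?d \<inter> pt ?d -` (- K)"
      using x K(2) crd_in[OF chart_at] pt_crd[OF chart_at] by auto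
    have "dz j (\<lambda>z. complex_of_real (\<psi> (pt ?d z))) (crd ?d x) = dz j (\<lambda>z. 0) (crd ?d x)" for j
      by (rule dz_cong[OF op mem]) (use K(3) C1_on_differentiable[OF C1_on_of_real[OF C1_fun_D[OF \<psi> chart_at(1)]] crd_in[OF chart_at]] in auto)
    then have "del_of \<psi> ?d x = 0" by (simp add: del_of_def vec_eq_iff dz_def)
    then show "\<Gamma> \<psi> u x = 0" by (simp add: \<Gamma>_def gram_def)
  qed
  finally show ?thesis by (simp add: mult.commute)
qed

text \<open>A partition of unity reduces the test function to the local case.\<close>

theorem eigenfunction_weak:
  assumes "u \<in> eigenspace \<A> \<omega> \<mu>" shows "weak_eigen \<mu> u"
proof -
  have u: "smooth_fun \<A> u" and ev: "\<And>x. - laplacian \<A> \<omega> u x = \<mu> * u x" using assms by (auto simp: eigenspace_def)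
  have u1: "u \<in> C1_fun" by (rule smooth_imp_C1_fun[OF u])
  obtain F :: "'a set" and \<beta> :: "'a \<Rightarrow> 'a \<Rightarrow> real" and K :: "'a \<Rightarrow> 'a set" where F: "finite F"
    "\<And>x. \<beta> x \<in> C1_fun" "\<And>x. compact (K x)" "\<And>x. K x \<subseteq> dom_ch (chart_at \<A> x)" "\<And>x y. y \<notin> K x \<Longrightarrow> \<beta> x y = 0"
    "\<And>y. (\<Sum>x\<in>F. \<beta> x y) = 1"
    by (rule partition_of_unity) (rule that)
  have "(\<integral>x. \<Gamma> \<phi> u x \<partial>vol) = \<mu> * (\<integral>x. \<phi> x * u x \<partial>vol)" if \<phi>: "\<phi> \<in> C1_fun" for \<phi>
  proof -
    have p: "(\<lambda>y. \<beta> x y * \<phi> y) \<in> C1_fun" for x by (rule C1_fun_mult[OF F(2) \<phi>])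
    have "(\<integral>y. \<Gamma> (\<lambda>y. \<Sum>x\<in>F'. \<beta> x y * \<phi> y) u y \<partial>vol) = \<mu> * (\<integral>y. (\<Sum>x\<in>F'. \<beta> x y * \<phi> y) * u y \<partial>vol)" if "finite F'" for F'
      using that
    proof (induction F')
      case empty
      have "\<Gamma> (\<lambda>y. 0) u y = 0" for y using \<Gamma>_lincomb[OF u1 u1 u1, of 0 0 y] by simp
      then show ?case by simp
    next
      case (insert x F')
      let ?a = "\<lambda>y. \<beta> x y * \<phi> y" and ?b = "\<lambda>y. \<Sum>x\<in>F'. \<beta> x y * \<phi> y"
      have b: "?b \<in> C1_fun" by (rule C1_fun_sum[OF p])
      have G: "\<Gamma> (\<lambda>y. ?a y + ?b y) u y = \<Gamma> ?a u y + \<Gamma> ?b u y" for y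
        using \<Gamma>_lincomb[OF p b u1, of 1 x 1 y] by simp
      have i: "integrable vol (\<Gamma> ?a u)" "integrable vol (\<Gamma> ?b u)" "integrable vol (\<lambda>y. ?a y * u y)" "integrable vol (\<lambda>y. ?b y * u y)"
        using continuous_\<Gamma>[OF p u1] continuous_\<Gamma>[OF b u1] continuous_C1_fun[OF C1_fun_mult[OF p u1]] continuous_C1_fun[OF C1_fun_mult[OF b u1]]
        by (auto intro: integrable_cont)
      have "(\<integral>y. \<Gamma> ?a u y \<partial>vol) = \<mu> * (\<integral>y. ?a y * u y \<partial>vol)"
        by (rule eigenfunction_weak_local[OF u ev p chart_at(1) F(3)[of x] F(4)[of x]]) (simp add: F(5))
      moreover have "(\<integral>y. \<Gamma> (\<lambda>y. \<Sum>x\<in>insert x F'. \<beta> x y * \<phi> y) u y \<partial>vol) = (\<integral>y. \<Gamma> ?a u y \<partial>vol) + (\<integral>y. \<Gamma> ?b u y \<partial>vol)"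
        using insert.hyps i by (simp add: G)
      moreover have "(\<integral>y. (\<Sum>x\<in>insert x F'. \<beta> x y * \<phi> y) * u y \<partial>vol) = (\<integral>y. ?a y * u y \<partial>vol) + (\<integral>y. ?b y * u y \<partial>vol)"
        using insert.hyps i by (simp add: distrib_right)
      ultimately show ?case using insert.IH by (simp add: algebra_simps)
    qed
    from this[OF F(1)] show ?thesis by (simp add: sum_distrib_right[symmetric] F(6))
  qed
  then show ?thesis using u1 by (simp add: weak_eigen_def)
qed

end

section \<open>The eigenvalue estimate\<close>

context kahler_manifold
begin

text \<open>The Sobolev inequality may thus be applied to all continuously differentiable functions, in particular to
  the nonlinear functions of eigenfunctions that occur in the iteration.\<close>

lemma W12_del_of: assumes u: "u \<in> C1_fun" shows "W12 \<A> \<omega> u (del_of u)"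
  unfolding W12_def grad_sq_del_of
proof (intro conjI)
  show "u \<in> borel_measurable borel" by (rule borel_measurable_continuous_onI[OF continuous_C1_fun[OF u]])
  show "integrable vol (\<lambda>x. (u x)\<^sup>2)" by (intro integrable_cont continuous_intros continuous_C1_fun u)
  show "integrable vol (\<Gamma> u u)" by (intro integrable_cont continuous_\<Gamma> u)
qed (rule weak_del_del_of[OF u])

lemma mean_eq_avg: "mean \<A> \<omega> u = avg u"
  by (simp add: mean_def avg_def total_vol_def)

text \<open>With \<open>T = Cs I \<lambda>\<^sub>k\<close>, the inequality \<open>k \<le> C T powr (q/(q-1))\<close> is solved for \<open>\<lambda>\<^sub>k\<close>.  For \<open>k = 0\<close> only \<open>\<lambda>\<^sub>0 \<ge> 0\<close> is
  claimed, and for \<open>k > 0\<close> the inequality \<open>T \<ge> 1\<close> forces \<open>I > 0\<close>.\<close>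

lemma eigenvalue_lower_bound:
  assumes q: "q > 1" and Cs: "Cs > 0" and I: "I \<ge> 0"
    and sob: "\<And>u. u \<in> C1_fun \<Longrightarrow> ((1 / total_vol \<A> \<omega>) * (\<integral>x. \<bar>u x - mean \<A> \<omega> u\<bar> powr (2 * q) \<partial>vol)) powr (1 / q)
            \<le> Cs * (I / total_vol \<A> \<omega>) * (\<integral>x. grad_sq \<A> \<omega> (del_of u) x \<partial>vol)"
    and lam: "eigenvalue_sequence \<A> \<omega> lam"
  shows "lam k \<ge> inverse (Cs * (exp 4 * moser_const q) powr ((q - 1) / q)) * inverse I * real k powr ((q - 1) / q)"
proof -
  define S where "S = Cs * I"
  interpret S: sobolev_dirichlet_form vol C1_fun \<Gamma> q S
  proof
    show "1 < q" "0 \<le> S" using q Cs I by (auto simp: S_def)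
    show "avg (\<lambda>x. \<bar>u x - avg u\<bar> powr (2 * q)) powr (1 / q) \<le> S * avg (\<Gamma> u u)" if "u \<in> C1_fun" for u
      using sob[OF that] unfolding mean_eq_avg grad_sq_del_of S_def by (simp add: avg_def total_vol_def)
  qed
  obtain J :: "(real \<times> nat) set" and e where J: "finite J" "k + 1 \<le> card J" "orthonormal J e"
    "\<And>i. i \<in> J \<Longrightarrow> weak_eigen (fst i) (e i)" "\<And>i. i \<in> J \<Longrightarrow> 0 \<le> fst i" "\<And>i. i \<in> J \<Longrightarrow> fst i \<le> lam k" "(lam k, 0) \<in> J"
    by (rule orthonormal_eigenfunctions[of lam "eigenspace \<A> \<omega>" k])
       (use lam in \<open>auto simp: eigenvalue_sequence_def intro: eigenfunction_weak\<close>)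
  have lam0: "lam k \<ge> 0" using J(5)[OF J(7)] by simp
  define A where "A = exp 4 * moser_const q"
  have A: "A > 0" unfolding A_def moser_const_def by simp
  show ?thesis
  proof (cases "k = 0")
    case True then show ?thesis using lam0 by simp
  next
    case False
    then have c2: "card J \<ge> 2" using J(2) by simp
    define T where "T = S * lam k"
    have T: "T \<ge> 1" unfolding T_def by (rule S.poincare[OF J(1) c2 J(4) J(3) J(6)])
    have S0: "S > 0" using T S.S lam0 by (cases "S = 0") (auto simp: T_def)
    then have I0: "I > 0" using I Cs by (cases "I = 0") (auto simp: S_def)
    have "real k \<le> real (card J)" using J(2) by simp
    also have "\<dots> \<le> A * T powr (q / (q - 1))"
      unfolding A_def T_def by (rule S.card_eigen_le[OF J(1) c2 J(4) J(3) J(5) J(6)])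
    finally have "real k powr ((q - 1) / q) \<le> (A * T powr (q / (q - 1))) powr ((q - 1) / q)"
      using q by (intro powr_mono2) auto
    also have "\<dots> = A powr ((q - 1) / q) * T"
      using A T q by (simp add: powr_mult powr_powr)
    finally have "real k powr ((q - 1) / q) \<le> A powr ((q - 1) / q) * (Cs * I * lam k)"
      by (simp add: T_def S_def)
    then show ?thesis unfolding A_def[symmetric] using A Cs I0 by (simp add: field_simps)
  qed
qed

end

theorem corollary2p1:
  fixes \<A> :: "('a::t2_space, 'n::finite) chart set"
    and \<omega>\<^sub>X :: "('a, 'n) form11"
    and p q K :: real
    and \<gamma> :: "'a \<Rightarrow> real"
  assumes "compact_kahler_manifold \<A> \<omega>\<^sub>X"
    and "total_vol \<A> \<omega>\<^sub>X = 1"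
    and "p > real CARD('n)"
    and "sobolev_exponent \<A> \<omega>\<^sub>X p q"
    and "K > 0"
    and "admissible_weight \<A> \<omega>\<^sub>X \<gamma>"
  shows "\<exists>c>0. \<forall>\<omega>\<in>W_class \<A> \<omega>\<^sub>X p K \<gamma>. \<forall>lam.
           eigenvalue_sequence \<A> \<omega> lam \<longrightarrow>
           (\<forall>k. lam k \<ge> c * inverse (I_class \<A> \<omega>\<^sub>X \<omega>) * real k powr ((q - 1) / q))"
proof -
  interpret X: kahler_manifold \<A> \<omega>\<^sub>X
    using assms(1) by unfold_locales (auto simp: compact_kahler_manifold_def)
  have q: "q > 1" using assms(4) by (simp add: sobolev_exponent_def)
  have ex: "\<exists>C\<^sub>S>0. \<forall>\<omega>\<in>W_class \<A> \<omega>\<^sub>X p K \<gamma>. \<forall>u D. W12 \<A> \<omega>\<^sub>X u D \<longrightarrow>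
      integrable (top_power \<A> \<omega>) (\<lambda>x. \<bar>u x - mean \<A> \<omega> u\<bar> powr (2 * q)) \<and>
      ((1 / total_vol \<A> \<omega>) * (\<integral>x. \<bar>u x - mean \<A> \<omega> u\<bar> powr (2 * q) \<partial>top_power \<A> \<omega>)) powr (1 / q)
        \<le> C\<^sub>S * (I_class \<A> \<omega>\<^sub>X \<omega> / total_vol \<A> \<omega>) * (\<integral>x. grad_sq \<A> \<omega> D x \<partial>top_power \<A> \<omega>)"
    by (rule assms(4)[unfolded sobolev_exponent_def, THEN conjunct2, THEN spec[of _ K], THEN spec[of _ \<gamma>],
          THEN mp, OF conjI[OF assms(5,6)]])
  then obtain Cs where Cs: "Cs > 0" and sob0: "\<forall>\<omega>\<in>W_class \<A> \<omega>\<^sub>X p K \<gamma>. \<forall>u D. W12 \<A> \<omega>\<^sub>X u D \<longrightarrow>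
      integrable (top_power \<A> \<omega>) (\<lambda>x. \<bar>u x - mean \<A> \<omega> u\<bar> powr (2 * q)) \<and>
      ((1 / total_vol \<A> \<omega>) * (\<integral>x. \<bar>u x - mean \<A> \<omega> u\<bar> powr (2 * q) \<partial>top_power \<A> \<omega>)) powr (1 / q)
        \<le> Cs * (I_class \<A> \<omega>\<^sub>X \<omega> / total_vol \<A> \<omega>) * (\<integral>x. grad_sq \<A> \<omega> D x \<partial>top_power \<A> \<omega>)"
    by (elim exE conjE)
  note sob = sob0[THEN bspec, THEN spec, THEN spec, THEN mp, THEN conjunct2]
  let ?c = "inverse (Cs * (exp 4 * moser_const q) powr ((q - 1) / q))"
  have c: "?c > 0" using Cs by (simp add: moser_const_def)
  have "lam k \<ge> ?c * inverse (I_class \<A> \<omega>\<^sub>X \<omega>) * real k powr ((q - 1) / q)"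
    if \<omega>: "\<omega> \<in> W_class \<A> \<omega>\<^sub>X p K \<gamma>" and lam: "eigenvalue_sequence \<A> \<omega> lam" for \<omega> lam k
  proof -
    interpret kahler_manifold \<A> \<omega>
      using \<omega> by unfold_locales (simp add: W_class_def)
    show ?thesis
    proof (rule eigenvalue_lower_bound[OF q Cs _ _ lam])
      show "0 \<le> I_class \<A> \<omega>\<^sub>X \<omega>" by (simp add: I_class_def)
    qed (rule sob[OF \<omega> X.W12_del_of])
  qed
  with c show ?thesis by blast
qed

end
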